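(* Let $k,m\ge 2$ be integers and let $F=(f_1,\ldots,f_m)$ be a system of nonconstant polynomials $f_i\in\mathbb{Z}[x_1,\ldots,x_k]$ of total degrees $d_i$. Assume that $F$ has property P and that the polynomials $f_1,\ldots,f_m$ are relatively prime over $\mathbb{Q}$. Let $d=\max_{1\le i\le m} d_i$. Then, as $x\to\infty$, $$\sum_{\substack{1\le x_1,\ldots,x_k\le x\\ \gcd_F(x_1,\ldots,x_k)=1}} 1 = C_F\, x^k + O\left(x^{k-1}(\log x)^{d^m}\right),\qquad C_F=\prod_p\left(1-\frac{N_F(p)}{p^k}\right),$$ where the product is over all primes $p$.
   Context: For a system $F=(f_1,\ldots,f_m)$ of nonconstant polynomials in $\mathbb{Z}[x_1,\ldots,x_k]$ and $n\in\mathbb{N}=\{1,2,\ldots\}$, $N_F(n)$ denotes the number of $(x_1,\ldots,x_k)\in\{1,\ldots,n\}^k$ with $f_i(x_1,\ldots,x_k)\equiv 0 \pmod n$ for all $1\le i\le m$. For $x_1,\ldots,x_k\in\mathbb{N}$, ${\gcd}_F(x_1,\ldots,x_k)=\gcd(f_1(x_1,\ldots,x_k),\ldots,f_m(x_1,\ldots,x_k))$. Property P: for every $1\le i\le m$, with $d_i$ the total degree of $f_i$, all coefficients of the monomials of degree $d_i$ occurring in $f_i$ are positive. Polynomials are relatively prime over $\mathbb{Q}$ if they have no nonconstant common factor in $\mathbb{Q}[x_1,\ldots,x_k]$. The sum is over positive integers $x_1,\ldots,x_k\le x$, where $x$ is real. The implied constant may depend on $F$ (hence on $k,m$), but not on $x$.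 *)

theory Defs
  imports
    "HOL-Analysis.Analysis"
    "HOL-Library.Poly_Mapping"
    "HOL-Library.Landau_Symbols"
    "HOL-Number_Theory.Cong"
begin

text \<open>
  A monomial is its finitely supported exponent function, a polynomial the finitely supported
  function assigning to each monomial its coefficient. Multiplication on
  \<^typ>\<open>'a \<Rightarrow>\<^sub>0 'b\<close> is convolution, so this type with the library's ring operations is the
  polynomial ring in the countably many variables $X_0, X_1, \ldots$; the polynomials in
  \<open>k\<close> variables are those using only $X_0, \ldots, X_{k-1}$. Thus the variables
  $x_1, \ldots, x_k$ and the members $f_1, \ldots, f_m$ of a system are both numbered from 0.
\<close>

type_synonym 'a mpoly = "(nat \<Rightarrow>\<^sub>0 nat) \<Rightarrow>\<^sub>0 'a"

definition mpolys :: "nat \<Rightarrow> 'a::zero mpoly set" where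
  "mpolys k = {f. \<forall>t \<in> Poly_Mapping.keys f. Poly_Mapping.keys t \<subseteq> {..<k}}"

definition mconst :: "'a::zero mpoly \<Rightarrow> bool" where
  "mconst f \<longleftrightarrow> Poly_Mapping.keys f \<subseteq> {0}"

definition meval :: "'a::comm_semiring_1 mpoly \<Rightarrow> (nat \<Rightarrow> 'a) \<Rightarrow> 'a" where
  "meval f a = (\<Sum>t \<in> Poly_Mapping.keys f. Poly_Mapping.lookup f t *
     (\<Prod>j \<in> Poly_Mapping.keys t. a j ^ Poly_Mapping.lookup t j))"

definition monom_deg :: "(nat \<Rightarrow>\<^sub>0 nat) \<Rightarrow> nat" where
  "monom_deg t = (\<Sum>j \<in> Poly_Mapping.keys t. Poly_Mapping.lookup t j)"

text \<open>The inserted 0 only matters for the zero polynomial.\<close>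

definition total_deg :: "'a::zero mpoly \<Rightarrow> nat" where
  "total_deg f = Max (insert 0 (monom_deg ` Poly_Mapping.keys f))"

definition property_P :: "nat \<Rightarrow> (nat \<Rightarrow> int mpoly) \<Rightarrow> bool" where
  "property_P m F \<longleftrightarrow> (\<forall>i<m. \<forall>t \<in> Poly_Mapping.keys (F i).
     monom_deg t = total_deg (F i) \<longrightarrow> Poly_Mapping.lookup (F i) t > 0)"

definition rat_mpoly :: "int mpoly \<Rightarrow> rat mpoly" where
  "rat_mpoly f = Poly_Mapping.map of_int f"

text \<open>
  The cofactor \<open>h\<close> is required to lie in $\mathbb{Q}[x_1,\ldots,x_k]$ as well, so that
  divisibility is that of this ring and not of the one with infinitely many variables.
\<close>

definition relatively_prime_over_rat :: "nat \<Rightarrow> nat \<Rightarrow> (nat \<Rightarrow> int mpoly) \<Rightarrow> bool" where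
  "relatively_prime_over_rat k m F \<longleftrightarrow>
     \<not> (\<exists>g \<in> mpolys k. \<not> mconst g \<and> (\<forall>i<m. \<exists>h \<in> mpolys k. rat_mpoly (F i) = g * h))"

definition N_F :: "nat \<Rightarrow> nat \<Rightarrow> (nat \<Rightarrow> int mpoly) \<Rightarrow> nat \<Rightarrow> nat" where
  "N_F k m F n = card {a \<in> {..<k} \<rightarrow>\<^sub>E {1..n}.
     \<forall>i<m. [meval (F i) (\<lambda>j. int (a j)) = 0] (mod int n)}"

definition gcd_F :: "nat \<Rightarrow> (nat \<Rightarrow> int mpoly) \<Rightarrow> (nat \<Rightarrow> nat) \<Rightarrow> int" where
  "gcd_F m F a = Gcd ((\<lambda>i. meval (F i) (\<lambda>j. int (a j))) ` {..<m})"

text \<open>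
  The product over the primes, in increasing order, is written as a product over all
  \<open>n\<close> whose factors are 1 at the non-primes.
\<close>

definition euler_factor :: "nat \<Rightarrow> nat \<Rightarrow> (nat \<Rightarrow> int mpoly) \<Rightarrow> nat \<Rightarrow> real" where
  "euler_factor k m F n = (if prime n then 1 - real (N_F k m F n) / real n ^ k else 1)"

definition C_F :: "nat \<Rightarrow> nat \<Rightarrow> (nat \<Rightarrow> int mpoly) \<Rightarrow> real" where
  "C_F k m F = prodinf (euler_factor k m F)"

end

theory Submission
  imports Defs "HOL-Computational_Algebra.Computational_Algebra"
begin

text \<open>
  Property P makes \<open>f\<^sub>0\<close> monic in the last variable after the shift $x_j \mapsto x_j + x_k$. Gauss's
  lemma turns relative primality into an eliminant: some combination \<open>G\<close> of the $f_i$ satisfies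
  $U f_0 + V G = R$ with \<open>R \<noteq> 0\<close> free of the last variable, and \<open>R\<close> becomes monic in the first
  variable after a further shift. Cutting by planes in these two variables and applying Bezout's
  theorem modulo \<open>p\<close> in each plane gives $N_F(p) \le d^2 p^{k-2}$ for all but finitely many \<open>p\<close>.

  The condition that no prime divides all values is resolved by a Moebius sum truncated at
  square-free \<open>n \<le> x\<close>, represented by their sets of prime factors. The truncation error at a point \<open>a\<close> only
  involves \<open>n = \<Prod>M\<close> such that \<open>n \<le> x < q * n\<close>, where \<open>q\<close> is the largest prime dividing all values
  at \<open>a\<close>. As \<open>q\<close> divides \<open>R(a)\<close>, it takes few values once all coordinates but the last are fixed, and
  then the last coordinate is determined by its residues modulo \<open>n\<close> and \<open>q\<close>.
\<close>

subsection \<open>Evaluating integer polynomials in commutative rings\<close>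

text \<open>The exponent of the logarithm comes from the number of solutions per prime. For
  square-free n with w prime factors Bezout's theorem gives O(C^w n^(k-2)) solutions modulo n, where
  d^2 <= C = d^m because m >= 2. The boundary error at n is then O(C^w x^(k-1) / n), and these terms
  sum to O(x^(k-1) (log x)^C) over n <= x. For n > x the box contains no full residue system,
  although the values at a point can be of order x^d; hence the truncation at x. Its error is
  weighted by log n / log P(n), with P(n) the largest prime factor, and the point is that the sum of
  C^w / n with this weight is still O((log x)^C). Where R vanishes it gives no control of the primes
  dividing all values; such points lie on a hypersurface, and there all terms are counted in
  absolute value. The combination G exists because Bezout's theorem in a plane concerns two curves.
  The finitely many primes at which a leading coefficient vanishes cost a constant factor, since
  each occurs at most once in a square-free n.\<close>

definition monom_eval :: "(nat \<Rightarrow> 'b::comm_ring_1) \<Rightarrow> (nat \<Rightarrow>\<^sub>0 nat) \<Rightarrow> 'b" where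
  "monom_eval a t = (\<Prod>j \<in> Poly_Mapping.keys t. a j ^ Poly_Mapping.lookup t j)"

text \<open>The values \<open>a j\<close> may lie in any commutative ring, whereas
  \<open>meval\<close> stays in the coefficient ring. Numerical evaluation, substitution of
  polynomials and specialisation of some variables are thus instances of one operation.\<close>

definition mev :: "int mpoly \<Rightarrow> (nat \<Rightarrow> 'b::comm_ring_1) \<Rightarrow> 'b" where
  "mev f a = (\<Sum>t \<in> Poly_Mapping.keys f. of_int (Poly_Mapping.lookup f t) * monom_eval a t)"

definition mvar :: "nat \<Rightarrow> int mpoly" where
  "mvar j = Poly_Mapping.single (Poly_Mapping.single j 1) 1"

lemma mev_int: "mev f a = meval f a" for a :: "nat \<Rightarrow> int"
  by (simp add: mev_def meval_def monom_eval_def)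

lemma monom_eval_superset:
  assumes "finite J" "Poly_Mapping.keys t \<subseteq> J"
  shows "monom_eval a t = (\<Prod>j\<in>J. a j ^ Poly_Mapping.lookup t j)"
  unfolding monom_eval_def
  by (rule prod.mono_neutral_left) (use assms in \<open>auto simp: in_keys_iff\<close>)

lemma monom_eval_0 [simp]: "monom_eval a 0 = 1"
  by (simp add: monom_eval_def)

lemma monom_eval_add: "monom_eval a (s + t) = monom_eval a s * monom_eval a t"
proof -
  let ?J = "Poly_Mapping.keys s \<union> Poly_Mapping.keys t"
  have "Poly_Mapping.keys (s + t) \<subseteq> ?J" by (rule Poly_Mapping.keys_add)
  then show ?thesis
    by (simp add: monom_eval_superset[of ?J] lookup_add power_add prod.distrib)
qed

lemma mev_superset:
  assumes "finite S" "Poly_Mapping.keys f \<subseteq> S"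
  shows "mev f a = (\<Sum>t\<in>S. of_int (Poly_Mapping.lookup f t) * monom_eval a t)"
  unfolding mev_def
  by (rule sum.mono_neutral_left) (use assms in \<open>auto simp: in_keys_iff\<close>)

lemma mev_0 [simp]: "mev 0 a = 0"
  by (simp add: mev_def)

lemma mev_single: "mev (Poly_Mapping.single t c) a = of_int c * monom_eval a t"
  by (simp add: mev_def)

lemma mev_add: "mev (f + g) a = mev f a + mev g a"
proof -
  let ?S = "Poly_Mapping.keys f \<union> Poly_Mapping.keys g"
  have "Poly_Mapping.keys (f + g) \<subseteq> ?S" by (rule Poly_Mapping.keys_add)
  then show ?thesis
    by (simp add: mev_superset[of ?S] lookup_add algebra_simps sum.distrib)
qed

lemma mev_uminus: "mev (- f) a = - mev f a"
  by (metis add.right_inverse add_eq_0_iff mev_0 mev_add)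

lemma mev_diff: "mev (f - g) a = mev f a - mev g a"
  by (metis mev_add mev_uminus diff_conv_add_uminus)

lemma mev_sum: "mev (\<Sum>i\<in>I. f i) a = (\<Sum>i\<in>I. mev (f i) a)"
  by (induction I rule: infinite_finite_induct) (simp_all add: mev_add)

lemma mpoly_expand:
  "f = (\<Sum>t\<in>Poly_Mapping.keys f. Poly_Mapping.single t (Poly_Mapping.lookup f t))"
  by (rule poly_mapping_eqI)
    (auto simp: lookup_sum lookup_single when_def in_keys_iff)

lemma mev_mult: "mev (f * g) a = mev f a * mev g a"
proof -
  let ?l = "Poly_Mapping.lookup"
  have "f * g = (\<Sum>s\<in>Poly_Mapping.keys f. Poly_Mapping.single s (?l f s)) *
      (\<Sum>t\<in>Poly_Mapping.keys g. Poly_Mapping.single t (?l g t))"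
    by (subst mpoly_expand[of f], subst mpoly_expand[of g]) simp
  also have "\<dots> = (\<Sum>s\<in>Poly_Mapping.keys f. \<Sum>t\<in>Poly_Mapping.keys g.
      Poly_Mapping.single (s + t) (?l f s * ?l g t))"
    by (simp add: sum_product mult_single)
  finally show ?thesis
    by (simp add: mev_sum mev_single monom_eval_add mev_def[of f] mev_def[of g]
        sum_product algebra_simps)
qed

lemma mpoly_of_int: "of_int c = (Poly_Mapping.single 0 c :: int mpoly)"
  using single_of_int[of c, where ?'b = int and ?'a = "nat \<Rightarrow>\<^sub>0 nat"] by simp

lemma mev_of_int [simp]: "mev (of_int c) a = of_int c"
  by (simp add: mpoly_of_int mev_single)

lemma mev_1 [simp]: "mev 1 a = 1"
  using mev_of_int[of 1 a] by simp

lemma mev_power: "mev (f ^ n) a = mev f a ^ n"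
  by (induction n) (simp_all add: mev_mult)

lemma mev_mvar [simp]: "mev (mvar j) a = a j"
  by (simp add: mvar_def mev_single monom_eval_def)

lemma mev_prod: "mev (\<Prod>i\<in>I. f i) a = (\<Prod>i\<in>I. mev (f i) a)"
  by (induction I rule: infinite_finite_induct) (simp_all add: mev_mult)

section \<open>Ring homomorphisms and evaluation\<close>

definition is_hom :: "('b::comm_ring_1 \<Rightarrow> 'c::comm_ring_1) \<Rightarrow> bool" where
  "is_hom h \<longleftrightarrow> h 1 = 1 \<and> (\<forall>x y. h (x + y) = h x + h y) \<and> (\<forall>x y. h (x * y) = h x * h y)"

lemma is_homD:
  assumes "is_hom h"
  shows "h 0 = 0" "h 1 = 1" "h (x + y) = h x + h y" "h (x * y) = h x * h y" "h (- x) = - h x"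
    "h (x - y) = h x - h y"
proof -
  show "h 1 = 1" and add: "\<And>x y. h (x + y) = h x + h y" and "h (x * y) = h x * h y" for x y
    using assms unfolding is_hom_def by auto
  show 0: "h 0 = 0" using add[of 0 0] by simp
  show neg: "h (- x) = - h x" for x using add[of x "- x"] 0 by (simp add: add_eq_0_iff)
  show "h (x - y) = h x - h y" using add[of x "- y"] neg by simp
qed

lemma is_hom_sum: "is_hom h \<Longrightarrow> h (\<Sum>i\<in>I. f i) = (\<Sum>i\<in>I. h (f i))"
  by (induction I rule: infinite_finite_induct) (simp_all add: is_homD)

lemma is_hom_prod: "is_hom h \<Longrightarrow> h (\<Prod>i\<in>I. f i) = (\<Prod>i\<in>I. h (f i))"
  by (induction I rule: infinite_finite_induct) (simp_all add: is_homD)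

lemma is_hom_power: "is_hom h \<Longrightarrow> h (x ^ n) = h x ^ n"
  by (induction n) (simp_all add: is_homD)

lemma is_hom_of_nat: "is_hom h \<Longrightarrow> h (of_nat n) = of_nat n"
  by (induction n) (simp_all add: is_homD)

lemma is_hom_of_int: "is_hom h \<Longrightarrow> h (of_int n) = of_int n"
  by (cases n) (simp_all add: is_homD is_hom_of_nat)

text \<open>\<open>int mpoly\<close> is the free commutative ring on the variables, so evaluation
  commutes with every homomorphism. All changes of variables and specialisations below are computed
  by this fact.\<close>

lemma is_hom_mev: "is_hom h \<Longrightarrow> h (mev f a) = mev f (\<lambda>j. h (a j))"
  by (simp add: mev_def monom_eval_def is_hom_sum is_homD is_hom_of_int is_hom_prod is_hom_power)

lemma is_hom_mev_right: "is_hom (\<lambda>f. mev f a)"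
  by (simp add: is_hom_def mev_add mev_mult)

lemma mev_mev: "mev (mev f s) b = mev f (\<lambda>j. mev (s j) b)"
  by (rule is_hom_mev[OF is_hom_mev_right])

lemma is_hom_poly: "is_hom (\<lambda>p. poly p x)"
  by (simp add: is_hom_def)

lemma is_hom_const: "is_hom (\<lambda>c. [:c:])"
  by (simp add: is_hom_def one_pCons)

lemma is_hom_map_poly:
  assumes "is_hom h" shows "is_hom (map_poly h)"
proof -
  have c: "coeff (map_poly h p) n = h (coeff p n)" for p n
    by (simp add: coeff_map_poly is_homD[OF assms])
  show ?thesis unfolding is_hom_def
    by (auto intro!: poly_eqI simp: c is_homD[OF assms] coeff_mult is_hom_sum[OF assms])
qed

lemma coeff_map_hom: "is_hom h \<Longrightarrow> coeff (map_poly h p) n = h (coeff p n)"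
  by (rule coeff_map_poly) (rule is_homD(1))

lemma is_hom_comp: "is_hom g \<Longrightarrow> is_hom h \<Longrightarrow> is_hom (\<lambda>x. g (h x))"
  unfolding is_hom_def by presburger

lemma mvar_power: "mvar j ^ n = Poly_Mapping.single (Poly_Mapping.single j n) 1"
proof (induction n)
  case (Suc n)
  have "Poly_Mapping.single j (1::nat) + Poly_Mapping.single j n = Poly_Mapping.single j (Suc n)"
    by (metis single_add plus_1_eq_Suc)
  with Suc show ?case by (simp add: mvar_def mult_single)
qed simp

lemma monom_eval_mvar: "monom_eval mvar t = Poly_Mapping.single t 1"
proof -
  have *: "(\<Prod>j\<in>J. Poly_Mapping.single (g j) (1::int)) = Poly_Mapping.single (\<Sum>j\<in>J. g j) 1"
    for J and g :: "nat \<Rightarrow> nat \<Rightarrow>\<^sub>0 nat"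
    by (induction J rule: infinite_finite_induct) (simp_all add: mult_single)
  have "t = (\<Sum>j\<in>Poly_Mapping.keys t. Poly_Mapping.single j (Poly_Mapping.lookup t j))"
    by (rule poly_mapping_eqI) (auto simp: lookup_sum lookup_single when_def in_keys_iff)
  then show ?thesis unfolding monom_eval_def mvar_power * by simp
qed

lemma mev_id: "mev f mvar = f"
proof -
  have "mev f mvar = (\<Sum>t\<in>Poly_Mapping.keys f. Poly_Mapping.single t (Poly_Mapping.lookup f t))"
    unfolding mev_def monom_eval_mvar
  proof (rule sum.cong)
    fix t
    show "of_int (Poly_Mapping.lookup f t) * Poly_Mapping.single t 1 =
        Poly_Mapping.single t (Poly_Mapping.lookup f t)"
      by (simp add: mpoly_of_int mult_single)
  qed simp
  then show ?thesis using mpoly_expand[of f] by simp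
qed

lemma mev_cong:
  assumes "f \<in> mpolys k" "\<And>j. j < k \<Longrightarrow> a j = b j"
  shows "mev f a = mev f b"
proof -
  have "a j = b j" if "t \<in> Poly_Mapping.keys f" "j \<in> Poly_Mapping.keys t" for t j
    using assms that unfolding mpolys_def by blast
  then show ?thesis unfolding mev_def monom_eval_def
    by (intro sum.cong prod.cong refl arg_cong2[where f="(*)"]) simp
qed

section \<open>Subrings, among them the polynomials in the first \<open>k\<close> variables\<close>

definition subring :: "'b::comm_ring_1 set \<Rightarrow> bool" where
  "subring S \<longleftrightarrow> 1 \<in> S \<and> (\<forall>x\<in>S. - x \<in> S) \<and> (\<forall>x\<in>S. \<forall>y\<in>S. x + y \<in> S \<and> x * y \<in> S)"

lemma subringD:
  assumes "subring S"
  shows "1 \<in> S" "0 \<in> S" "x \<in> S \<Longrightarrow> - x \<in> S" "x \<in> S \<Longrightarrow> y \<in> S \<Longrightarrow> x + y \<in> S"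
    "x \<in> S \<Longrightarrow> y \<in> S \<Longrightarrow> x - y \<in> S" "x \<in> S \<Longrightarrow> y \<in> S \<Longrightarrow> x * y \<in> S"
proof -
  show 1: "1 \<in> S" and neg: "\<And>x. x \<in> S \<Longrightarrow> - x \<in> S"
    and add: "\<And>x y. x \<in> S \<Longrightarrow> y \<in> S \<Longrightarrow> x + y \<in> S" and "x \<in> S \<Longrightarrow> y \<in> S \<Longrightarrow> x * y \<in> S"
    using assms unfolding subring_def by auto
  show "0 \<in> S" using add[OF 1 neg[OF 1]] by simp
  show "x \<in> S \<Longrightarrow> y \<in> S \<Longrightarrow> x - y \<in> S" using add[of x "- y"] neg by simp
qed

lemma subring_sum: "subring S \<Longrightarrow> (\<And>i. i \<in> I \<Longrightarrow> f i \<in> S) \<Longrightarrow> (\<Sum>i\<in>I. f i) \<in> S"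
  by (induction I rule: infinite_finite_induct) (simp_all add: subringD(2,4))

lemma subring_prod: "subring S \<Longrightarrow> (\<And>i. i \<in> I \<Longrightarrow> f i \<in> S) \<Longrightarrow> (\<Prod>i\<in>I. f i) \<in> S"
  by (induction I rule: infinite_finite_induct) (simp_all add: subringD(1,6))

lemma subring_power: "subring S \<Longrightarrow> x \<in> S \<Longrightarrow> x ^ n \<in> S"
  by (induction n) (simp_all add: subringD(1,6))

lemma subring_of_nat: "subring S \<Longrightarrow> of_nat n \<in> S"
  by (induction n) (simp_all add: subringD(1,2,4))

lemma subring_of_int: "subring S \<Longrightarrow> of_int n \<in> S"
  using subring_of_nat[of S] subringD(3)[of S] by (cases n) (simp_all del: of_nat_Suc)

lemma subring_mev:
  assumes "subring S" "f \<in> mpolys k" "\<And>j. j < k \<Longrightarrow> a j \<in> S"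
  shows "mev f a \<in> S"
  using assms(2,3) unfolding mev_def monom_eval_def mpolys_def
  by (intro subring_sum subringD(6) subring_prod subring_power subring_of_int assms(1)) auto

text \<open>The polynomials in \<open>k\<close> variables form a set within one type. That an
  eliminated variable does not reappear is therefore proved through closure of this set under the
  ring operations.\<close>

lemma subring_mpolys: "subring (mpolys k :: int mpoly set)"
proof -
  have "x + y \<in> mpolys k" if "x \<in> mpolys k" "y \<in> mpolys k" for x y :: "int mpoly"
    using that Poly_Mapping.keys_add[of x y] unfolding mpolys_def by auto
  moreover have "x * y \<in> mpolys k" if "x \<in> mpolys k" "y \<in> mpolys k" for x y :: "int mpoly"
  proof -
    have "Poly_Mapping.keys t \<subseteq> {..<k}" if "t \<in> Poly_Mapping.keys (x * y)" for t
    proof -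
      obtain u v where uv: "t = u + v" "u \<in> Poly_Mapping.keys x" "v \<in> Poly_Mapping.keys y"
        using \<open>t \<in> Poly_Mapping.keys (x * y)\<close> keys_mult[of x y] by auto
      then have "Poly_Mapping.keys u \<subseteq> {..<k}" "Poly_Mapping.keys v \<subseteq> {..<k}"
        using \<open>x \<in> mpolys k\<close> \<open>y \<in> mpolys k\<close> unfolding mpolys_def by auto
      with uv(1) show ?thesis using Poly_Mapping.keys_add[of u v] by auto
    qed
    then show ?thesis unfolding mpolys_def by auto
  qed
  moreover have "1 \<in> (mpolys k :: int mpoly set)" by (simp add: mpolys_def)
  moreover have "- x \<in> mpolys k" if "x \<in> mpolys k" for x :: "int mpoly"
    using that by (simp add: mpolys_def)
  ultimately show ?thesis unfolding subring_def by blast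
qed

lemma mvar_in_mpolys: "j < k \<Longrightarrow> mvar j \<in> mpolys k"
  by (auto simp: mpolys_def mvar_def)

lemma mpolys_mono: "k \<le> l \<Longrightarrow> mpolys k \<subseteq> mpolys l"
  by (force simp: mpolys_def)

subsection \<open>Polynomials in one distinguished variable\<close>

text \<open>The passage to polynomials in \<open>X_i\<close> over the remaining variables, with
  coefficients kept in the type \<open>int mpoly\<close>. For \<open>Suc k\<close> variables and
  \<open>i = k\<close>, \<open>uni_in_poly_over\<close> locates the coefficients in
  \<open>mpolys k\<close>; \<open>poly_uni\<close> and \<open>uni_poly\<close> invert the
  passage.\<close>

definition uni :: "nat \<Rightarrow> int mpoly \<Rightarrow> int mpoly poly" where
  "uni i f = mev f (\<lambda>j. if j = i then [:0, 1:] else [:mvar j:])"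

definition poly_over :: "'b::comm_ring_1 set \<Rightarrow> 'b poly set" where
  "poly_over S = {p. \<forall>n. coeff p n \<in> S}"

lemma subring_poly_over:
  assumes "subring S" shows "subring (poly_over S)"
proof -
  have "coeff 1 n \<in> S" for n by (cases n) (simp_all add: subringD(1,2)[OF assms] coeff_1)
  then show ?thesis
    unfolding subring_def[of "poly_over S"] unfolding poly_over_def
    by (auto simp: coeff_mult simp del: coeff_1 intro!: subring_sum[OF assms] subringD(3,4,6)[OF assms])
qed

lemma is_hom_uni: "is_hom (uni i)"
  unfolding uni_def by (rule is_hom_mev_right)

lemma poly_uni: "poly (uni i f) (mvar i) = f"
proof -
  have "poly (uni i f) (mvar i) = mev f (\<lambda>j. poly (if j = i then [:0, 1:] else [:mvar j:]) (mvar i))"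
    unfolding uni_def by (rule is_hom_mev[OF is_hom_poly])
  also have "(\<lambda>j. poly (if j = i then [:0, 1:] else [:mvar j:]) (mvar i)) = mvar"
    by auto
  finally show ?thesis by (simp add: mev_id)
qed

lemma uni_eq_0_iff [simp]: "uni i f = 0 \<longleftrightarrow> f = 0"
  by (metis poly_0 poly_uni is_homD(1)[OF is_hom_uni])

lemma mev_uni: "mev f a = poly (map_poly (\<lambda>c. mev c a) (uni i f)) (a i)"
proof -
  have h: "is_hom (\<lambda>p. poly (map_poly (\<lambda>c. mev c a) p) (a i))"
    by (rule is_hom_comp[OF is_hom_poly is_hom_map_poly[OF is_hom_mev_right]])
  show ?thesis unfolding uni_def is_hom_mev[OF h]
    by (rule arg_cong[where f = "mev f"]) (auto simp: map_poly_pCons)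
qed

lemma uni_const:
  assumes "f \<in> mpolys k" shows "uni k f = [:f:]"
proof -
  have "uni k f = mev f (\<lambda>j. [:mvar j:])"
    unfolding uni_def by (rule mev_cong[OF assms]) auto
  also have "\<dots> = [:f:]" using is_hom_mev[OF is_hom_const, of f mvar] by (simp add: mev_id)
  finally show ?thesis .
qed

lemma uni_in_poly_over:
  assumes "f \<in> mpolys (Suc k)" shows "uni k f \<in> poly_over (mpolys k)"
  unfolding uni_def
proof (rule subring_mev[OF subring_poly_over[OF subring_mpolys] assms])
  fix j assume "j < Suc k"
  then show "(if j = k then [:0, 1:] else [:mvar j:]) \<in> poly_over (mpolys k)"
    using subringD(1,2)[OF subring_mpolys[of k]]
    by (auto simp: poly_over_def coeff_pCons mvar_in_mpolys less_Suc_eq split: nat.splits)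
qed

lemma poly_in_subring:
  fixes p :: "'b::comm_ring_1 poly"
  shows "subring S \<Longrightarrow> p \<in> poly_over S \<Longrightarrow> x \<in> S \<Longrightarrow> poly p x \<in> S"
  unfolding poly_altdef poly_over_def
  by (intro subring_sum subringD(6) subring_power) auto

lemma poly_over_mvar_in:
  assumes "p \<in> poly_over (mpolys k)" shows "poly p (mvar k) \<in> mpolys (Suc k)"
  by (rule poly_in_subring[OF subring_mpolys])
    (use assms mpolys_mono[of k "Suc k"] in \<open>auto simp: poly_over_def mvar_in_mpolys\<close>)

lemma uni_poly:
  assumes "p \<in> poly_over (mpolys k)" shows "uni k (poly p (mvar k)) = p"
proof -
  have X: "uni k (mvar k) = [:0, 1:]" by (simp add: uni_def)
  have "uni k (poly p (mvar k)) = (\<Sum>i\<le>degree p. uni k (coeff p i) * uni k (mvar k) ^ i)"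
    unfolding poly_altdef by (simp add: is_hom_sum[OF is_hom_uni] is_homD[OF is_hom_uni] is_hom_power[OF is_hom_uni])
  also have "\<dots> = (\<Sum>i\<le>degree p. monom (coeff p i) i)"
  proof (rule sum.cong)
    fix i assume "i \<in> {..degree p}"
    have "uni k (coeff p i) = [:coeff p i:]"
      using assms by (intro uni_const) (auto simp: poly_over_def)
    then show "uni k (coeff p i) * uni k (mvar k) ^ i = monom (coeff p i) i"
      by (simp add: X monom_altdef)
  qed simp
  also have "\<dots> = p" by (rule poly_as_sum_of_monoms)
  finally show ?thesis .
qed

lemma mpolys_0_const: "f \<in> mpolys 0 \<Longrightarrow> f = of_int (Poly_Mapping.lookup f 0)"
proof (rule poly_mapping_eqI)
  fix t assume f: "f \<in> mpolys 0"
  have "Poly_Mapping.lookup f t = 0" if "t \<noteq> 0"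
  proof (rule ccontr)
    assume "Poly_Mapping.lookup f t \<noteq> 0"
    then have "Poly_Mapping.keys t = {}" using f by (auto simp: mpolys_def in_keys_iff)
    with that show False by simp
  qed
  then show "Poly_Mapping.lookup f t = Poly_Mapping.lookup (of_int (Poly_Mapping.lookup f 0)) t"
    by (simp add: lookup_of_int when_def)
qed

text \<open>Induction on the number of variables: a point where the leading coefficient in the last
  variable survives leaves a nonzero univariate polynomial, which has a non-root.\<close>

lemma mpoly_nonvanishing:
  assumes "f \<in> mpolys k" "f \<noteq> 0"
  shows "\<exists>a::nat \<Rightarrow> int. mev f a \<noteq> 0"
  using assms
proof (induction k arbitrary: f)
  case 0
  have f: "f = of_int (Poly_Mapping.lookup f 0)" by (rule mpolys_0_const[OF 0(1)])
  then have "Poly_Mapping.lookup f 0 \<noteq> 0" using 0(2) by (metis of_int_0)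
  moreover have "mev f (\<lambda>_. 0 :: int) = Poly_Mapping.lookup f 0"
    by (subst f) (simp only: mev_of_int of_int_eq_id id_apply)
  ultimately show ?case by metis
next
  case (Suc k)
  define c where "c = lead_coeff (uni k f)"
  have "c \<in> mpolys k" "c \<noteq> 0"
    using uni_in_poly_over[OF Suc.prems(1)] Suc.prems(2) by (auto simp: c_def poly_over_def)
  then obtain a :: "nat \<Rightarrow> int" where a: "mev c a \<noteq> 0" using Suc.IH by blast
  define p where "p = map_poly (\<lambda>c. mev c a) (uni k f)"
  have "coeff p (degree (uni k f)) \<noteq> 0"
    using a by (simp add: p_def coeff_map_hom[OF is_hom_mev_right] c_def)
  then have "p \<noteq> 0" by auto
  then obtain z where z: "poly p z \<noteq> 0"
    using poly_all_0_iff_0[of p] by blast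
  \<comment> \<open>The coefficients do not involve the last variable, so the new value at
    \<open>k\<close> leaves them unchanged.\<close>
  let ?b = "a(k := z)"
  have "map_poly (\<lambda>c. mev c ?b) (uni k f) = p"
  proof (rule poly_eqI)
    fix n
    have "coeff (uni k f) n \<in> mpolys k" using uni_in_poly_over[OF Suc.prems(1)] by (auto simp: poly_over_def)
    then show "coeff (map_poly (\<lambda>c. mev c ?b) (uni k f)) n = coeff p n"
      unfolding p_def coeff_map_hom[OF is_hom_mev_right] by (rule mev_cong) auto
  qed
  then have "mev f ?b = poly p z" using mev_uni[of f ?b k] by simp
  then show ?case using z by metis
qed

text \<open>Long division in which each step first multiplies by the leading coefficient of
  \<open>h\<close>. Quotient and remainder keep their coefficients in \<open>S\<close>, and this
  keeps an eliminant free of the distinguished variable.\<close>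

lemma pseudo_division:
  fixes f h :: "'a::idom poly"
  assumes S: "subring S" and h: "h \<in> poly_over S" "h \<noteq> 0" and "f \<in> poly_over S"
  shows "\<exists>e q r. q \<in> poly_over S \<and> r \<in> poly_over S \<and>
    smult (lead_coeff h ^ e) f = q * h + r \<and> (r = 0 \<or> degree r < degree h)"
  using assms(4)
proof (induction "degree f" arbitrary: f rule: less_induct)
  case less
  note SP = subring_poly_over[OF S]
  show ?case
  proof (cases "f = 0 \<or> degree f < degree h")
    case True
    then show ?thesis using less.prems subringD(2)[OF SP]
      by (intro exI[of _ 0] exI[of _ f]) auto
  next
    case False
    define m where "m = monom (lead_coeff f) (degree f - degree h)"
    have m: "m \<in> poly_over S"
      using less.prems subringD(2)[OF S] by (auto simp: m_def poly_over_def)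
    define f' where "f' = smult (lead_coeff h) f - m * h"
    have sm: "smult c p \<in> poly_over S" if "c \<in> S" "p \<in> poly_over S" for c p
      using that subringD(6)[OF S] by (auto simp: poly_over_def)
    have lS: "lead_coeff h \<in> S" using h by (auto simp: poly_over_def)
    have f': "f' \<in> poly_over S"
      unfolding f'_def using sm[OF lS less.prems] subringD(5,6)[OF SP] m h(1) by blast
    have "degree f' \<le> degree f"
      unfolding f'_def
    proof (rule degree_diff_le)
      show "degree (m * h) \<le> degree f"
        using degree_mult_le[of m h] degree_monom_le[of "lead_coeff f" "degree f - degree h"] False
        unfolding m_def by linarith
    qed (rule degree_smult_le)
    moreover have "coeff (m * h) (degree f) = lead_coeff f * lead_coeff h"
      using False by (simp add: m_def coeff_monom_mult)
    then have "coeff f' (degree f) = 0" by (simp add: f'_def mult.commute)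
    ultimately have "f' = 0 \<or> degree f' < degree f" by (rule eq_zero_or_degree_less)
    then obtain e q r where *: "q \<in> poly_over S" "r \<in> poly_over S"
      "smult (lead_coeff h ^ e) f' = q * h + r" "r = 0 \<or> degree r < degree h"
    proof
      assume "f' = 0"
      then show thesis using that[of 0 0 0] subringD(2)[OF SP] by simp
    next
      assume "degree f' < degree f"
      from less.hyps[OF this f'] show thesis using that by blast
    qed
    have "smult (lead_coeff h ^ Suc e) f = (q + smult (lead_coeff h ^ e) m) * h + r"
      using *(3) by (simp add: f'_def algebra_simps smult_diff_right)
    moreover have "q + smult (lead_coeff h ^ e) m \<in> poly_over S"
      using *(1) sm[OF subring_power[OF S lS] m] subringD(4)[OF SP] by blast
    ultimately show ?thesis using *(2,4) by blast
  qed
qed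

text \<open>A nonzero element of least degree in the ideal generated by the
  \<open>uni k (f i)\<close> over \<open>mpolys k\<close> decides. In degree 0 it is an eliminant.
  Otherwise pseudo-division leaves remainders of smaller degree in the ideal, hence zero, and the
  element divides every generator up to a power of its leading coefficient.\<close>

lemma elimination_or_common_divisor:
  fixes f :: "'i \<Rightarrow> int mpoly"
  assumes "finite I" "i0 \<in> I" "f i0 \<noteq> 0" and f: "\<And>i. i \<in> I \<Longrightarrow> f i \<in> mpolys (Suc k)"
  shows "(\<exists>U R. R \<in> mpolys k \<and> R \<noteq> 0 \<and> (\<Sum>i\<in>I. U i * f i) = R) \<or>
    (\<exists>h \<in> poly_over (mpolys k). degree h > 0 \<and>
      (\<forall>i\<in>I. \<exists>e q. q \<in> poly_over (mpolys k) \<and> smult (lead_coeff h ^ e) (uni k (f i)) = q * h))"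
proof -
  let ?S = "poly_over (mpolys k) :: int mpoly poly set"
  note SP = subring_poly_over[OF subring_mpolys[of k]]
  define J where "J = {p. \<exists>u. (\<forall>i\<in>I. u i \<in> ?S) \<and> p = (\<Sum>i\<in>I. u i * uni k (f i))}"
  have gen: "uni k (f i) \<in> J" if "i \<in> I" for i
  proof -
    have "(\<Sum>j\<in>I. (if j = i then 1 else 0) * uni k (f j)) = (\<Sum>j\<in>I. if j = i then uni k (f i) else 0)"
      by (rule sum.cong) auto
    also have "\<dots> = uni k (f i)" using that assms(1) by simp
    finally show ?thesis unfolding J_def using subringD(1,2)[OF SP]
      by (intro CollectI exI[of _ "\<lambda>j. if j = i then 1 else 0"]) auto
  qed
  have JS: "J \<subseteq> ?S"
    unfolding J_def using uni_in_poly_over[OF f]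
    by (auto intro!: subring_sum[OF SP] subringD(6)[OF SP])
  have Jc: "a * p - b * q \<in> J" if "p \<in> J" "q \<in> J" "a \<in> ?S" "b \<in> ?S" for a b p q
  proof -
    obtain u v where "\<forall>i\<in>I. u i \<in> ?S" "p = (\<Sum>i\<in>I. u i * uni k (f i))"
      "\<forall>i\<in>I. v i \<in> ?S" "q = (\<Sum>i\<in>I. v i * uni k (f i))"
      using \<open>p \<in> J\<close> \<open>q \<in> J\<close> unfolding J_def by blast
    then show ?thesis unfolding J_def using that(3,4) subringD(5,6)[OF SP]
      by (intro CollectI exI[of _ "\<lambda>i. a * u i - b * v i"])
        (auto simp: sum_distrib_left sum_subtractf algebra_simps)
  qed
  define P where "P n \<longleftrightarrow> (\<exists>h\<in>J. h \<noteq> 0 \<and> degree h = n)" for n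
  have "P (degree (uni k (f i0)))"
    unfolding P_def by (rule bexI[OF _ gen[OF assms(2)]]) (simp add: assms(3))
  then have "P (LEAST n. P n)" by (rule LeastI)
  then obtain h where h: "h \<in> J" "h \<noteq> 0" "degree h = (LEAST n. P n)" unfolding P_def by auto
  have min: "degree h \<le> degree p" if "p \<in> J" "p \<noteq> 0" for p
    unfolding h(3) by (rule Least_le) (use that in \<open>auto simp: P_def\<close>)
  show ?thesis
  proof (cases "degree h = 0")
    case True
    then obtain R where R: "h = [:R:]" by (meson degree_eq_zeroE)
    obtain u where u: "h = (\<Sum>i\<in>I. u i * uni k (f i))" using h(1) unfolding J_def by blast
    have "R = poly h (mvar k)" by (simp add: R)
    also have "\<dots> = (\<Sum>i\<in>I. poly (u i) (mvar k) * f i)"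
      by (simp add: u poly_sum poly_uni)
    finally have "(\<Sum>i\<in>I. poly (u i) (mvar k) * f i) = R" ..
    moreover have "R \<noteq> 0" using h(2) R by simp
    moreover have "coeff h 0 \<in> mpolys k" using h(1) JS by (auto simp: poly_over_def)
    then have "R \<in> mpolys k" by (simp add: R)
    ultimately show ?thesis by (intro disjI1 exI[of _ "\<lambda>i. poly (u i) (mvar k)"] exI[of _ R]) auto
  next
    case False
    have hS: "h \<in> ?S" using h(1) JS by auto
    have "\<exists>e q. q \<in> ?S \<and> smult (lead_coeff h ^ e) (uni k (f i)) = q * h" if i: "i \<in> I" for i
    proof -
      obtain e q r where *: "q \<in> ?S" "r \<in> ?S"
        "smult (lead_coeff h ^ e) (uni k (f i)) = q * h + r" "r = 0 \<or> degree r < degree h"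
        using pseudo_division[OF subring_mpolys hS h(2) uni_in_poly_over[OF f[OF i]]] by blast
      have "lead_coeff h ^ e \<in> mpolys k"
        using hS by (intro subring_power[OF subring_mpolys]) (auto simp: poly_over_def)
      then have "[:lead_coeff h ^ e:] \<in> ?S"
        using subringD(2)[OF subring_mpolys[of k]] by (auto simp: poly_over_def coeff_pCons split: nat.splits)
      from Jc[OF gen[OF i] h(1) this *(1)] have "r \<in> J" using *(3) by simp
      then have "r = 0" using min[of r] *(4) by fastforce
      then show ?thesis using * by auto
    qed
    then show ?thesis using hS False by blast
  qed
qed

subsection \<open>The leading form\<close>

definition top_at :: "int mpoly \<Rightarrow> (nat \<Rightarrow> int) \<Rightarrow> int" where
  "top_at f c = (\<Sum>t\<in>{t\<in>Poly_Mapping.keys f. monom_deg t = total_deg f}.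
     Poly_Mapping.lookup f t * monom_eval c t)"

lemma monom_deg_le_total_deg: "t \<in> Poly_Mapping.keys f \<Longrightarrow> monom_deg t \<le> total_deg f"
  by (simp add: total_deg_def)

lemma coeff_mult_degree_bounds:
  assumes "degree p \<le> m" "degree q \<le> n"
  shows "coeff (p * q) (m + n) = coeff p m * coeff q n"
proof -
  have "coeff p i * coeff q (m + n - i) = (if i = m then coeff p m * coeff q n else 0)"
    if "i \<le> m + n" for i
    using that assms by (cases "i < m"; cases "i = m") (auto simp: coeff_eq_0)
  then show ?thesis by (simp add: coeff_mult)
qed

lemma coeff_power_degree_bounds:
  assumes "degree p \<le> m"
  shows "degree (p ^ n) \<le> m * n" "coeff (p ^ n) (m * n) = coeff p m ^ n"
proof -
  have "degree (p ^ n) \<le> m * n \<and> coeff (p ^ n) (m * n) = coeff p m ^ n"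
  proof (induction n)
    case (Suc n)
    then show ?case
      using degree_mult_le[of p "p ^ n"] coeff_mult_degree_bounds[OF assms, of "p ^ n" "m * n"] assms
      by (simp add: algebra_simps)
  qed simp
  then show "degree (p ^ n) \<le> m * n" "coeff (p ^ n) (m * n) = coeff p m ^ n" by auto
qed

lemma coeff_prod_degree_bounds:
  assumes "finite J" "\<And>j. j \<in> J \<Longrightarrow> degree (p j) \<le> m j"
  shows "degree (prod p J) \<le> sum m J \<and> coeff (prod p J) (sum m J) = (\<Prod>j\<in>J. coeff (p j) (m j))"
  using assms
proof (induction J rule: finite_induct)
  case (insert x J)
  then show ?case
    using degree_mult_le[of "p x" "prod p J"] coeff_mult_degree_bounds[of "p x" "m x" "prod p J" "sum m J"]
    by (simp add: add_mono le_trans)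
qed simp

lemma monom_eval_of_int: "monom_eval (\<lambda>j. of_int (c j)) t = of_int (monom_eval c t)"
  by (simp add: monom_eval_def)

text \<open>Along the line \<open>u + y * c\<close> the coefficient of
  \<open>y ^ total_deg f\<close> is the leading form at \<open>c\<close>, for every
  \<open>u\<close>. A shift in a direction where the leading form does not vanish therefore makes
  \<open>f\<close> monic up to a constant.\<close>

lemma mev_linear:
  fixes u :: "nat \<Rightarrow> 'b::comm_ring_1" and c :: "nat \<Rightarrow> int"
  defines "a \<equiv> \<lambda>j. [:u j, of_int (c j):]"
  shows "degree (mev f a) \<le> total_deg f" "coeff (mev f a) (total_deg f) = of_int (top_at f c)"
proof -
  have d1: "degree (a j) \<le> 1" for j by (simp add: a_def)
  have m: "degree (monom_eval a t) \<le> monom_deg t \<and>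
      coeff (monom_eval a t) (monom_deg t) = of_int (monom_eval c t)" for t
  proof -
    have "degree (a j ^ Poly_Mapping.lookup t j) \<le> Poly_Mapping.lookup t j" for j
      using coeff_power_degree_bounds(1)[OF d1, of j "Poly_Mapping.lookup t j"] by simp
    from coeff_prod_degree_bounds[of "Poly_Mapping.keys t" "\<lambda>j. a j ^ Poly_Mapping.lookup t j",
        OF finite_keys this] have
      "degree (monom_eval a t) \<le> monom_deg t"
      "coeff (monom_eval a t) (monom_deg t) =
        (\<Prod>j\<in>Poly_Mapping.keys t. coeff (a j ^ Poly_Mapping.lookup t j) (Poly_Mapping.lookup t j))"
      unfolding monom_eval_def monom_deg_def by auto
    moreover have "coeff (a j ^ n) n = of_int (c j ^ n)" for j n
      using coeff_power_degree_bounds(2)[OF d1, of j n] by (simp add: a_def)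
    ultimately show ?thesis by (simp add: monom_eval_def)
  qed
  show "degree (mev f a) \<le> total_deg f"
    unfolding mev_def
  proof (rule degree_sum_le)
    fix t assume t: "t \<in> Poly_Mapping.keys f"
    have "degree (of_int (Poly_Mapping.lookup f t) * monom_eval a t) \<le> 0 + degree (monom_eval a t)"
      by (rule order_trans[OF degree_mult_le]) simp
    then show "degree (of_int (Poly_Mapping.lookup f t) * monom_eval a t) \<le> total_deg f"
      using m[of t] monom_deg_le_total_deg[OF t] by linarith
  qed simp
  have "coeff (of_int (Poly_Mapping.lookup f t) * monom_eval a t) (total_deg f) =
      (if monom_deg t = total_deg f then of_int (Poly_Mapping.lookup f t * monom_eval c t) else 0)"
    if t: "t \<in> Poly_Mapping.keys f" for t
  proof (cases "monom_deg t = total_deg f")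
    case True
    have "coeff (of_int (Poly_Mapping.lookup f t) * monom_eval a t) (monom_deg t) =
        of_int (Poly_Mapping.lookup f t) * of_int (monom_eval c t)"
      using m[of t] by (simp add: of_int_poly)
    with True show ?thesis by simp
  next
    case False
    then have "degree (monom_eval a t) < total_deg f"
      using m[of t] monom_deg_le_total_deg[OF t] by linarith
    then show ?thesis using False by (simp add: of_int_poly coeff_eq_0)
  qed
  then show "coeff (mev f a) (total_deg f) = of_int (top_at f c)"
    unfolding mev_def top_at_def coeff_sum of_int_sum
    by (auto simp: sum.inter_filter intro!: sum.cong)
qed

text \<open>The normalisation \<open>c 0 = 1\<close> lets a shift by multiples of \<open>X_0\<close>
  fix \<open>X_0\<close> itself, so that it is invertible over the integers.\<close>

lemma exists_top_at_nonzero: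
  assumes "f \<in> mpolys k" "f \<noteq> 0"
  shows "\<exists>c. c 0 = 1 \<and> top_at f c \<noteq> 0"
proof -
  define H where "H = (\<Sum>t\<in>{t\<in>Poly_Mapping.keys f. monom_deg t = total_deg f}.
     Poly_Mapping.single t (Poly_Mapping.lookup f t))"
  have mevH: "mev H c = (\<Sum>t\<in>{t\<in>Poly_Mapping.keys f. monom_deg t = total_deg f}.
     of_int (Poly_Mapping.lookup f t) * monom_eval c t)" for c :: "nat \<Rightarrow> 'c::comm_ring_1"
    by (simp add: H_def mev_sum mev_single)
  have top: "top_at f c = mev H c" for c by (simp add: mevH top_at_def)
  have single: "Poly_Mapping.single t c \<in> mpolys k" if "t \<in> Poly_Mapping.keys f" for t and c :: int
    using that assms(1) by (auto simp: mpolys_def split: if_splits)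
  have Hk: "H \<in> mpolys k" unfolding H_def
    by (rule subring_sum[OF subring_mpolys]) (use single in auto)
  have "monom_deg ` Poly_Mapping.keys f \<noteq> {}" using assms(2) by simp
  then have "Max (monom_deg ` Poly_Mapping.keys f) \<in> monom_deg ` Poly_Mapping.keys f"
    by (intro Max_in) auto
  moreover have "total_deg f = Max (monom_deg ` Poly_Mapping.keys f)"
    unfolding total_deg_def using assms(2) by simp
  ultimately obtain t0 where t0: "t0 \<in> Poly_Mapping.keys f" "monom_deg t0 = total_deg f" by auto
  have "Poly_Mapping.lookup H t0 = Poly_Mapping.lookup f t0"
    using t0 by (simp add: H_def lookup_sum lookup_single when_def)
  with t0 have "H \<noteq> 0" by (auto simp: in_keys_iff)
  moreover have "mvar 0 \<noteq> 0"
    using mev_mvar[of 0 "\<lambda>_. 1 :: int"] by (auto simp del: mev_mvar)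
  \<comment> \<open>The additional factor forces a nonzero first coordinate at the chosen
    point.\<close>
  ultimately have "H * mvar 0 \<noteq> 0" by simp
  moreover have "H * mvar 0 \<in> mpolys (Suc k)"
    by (intro subringD(6)[OF subring_mpolys] mvar_in_mpolys subsetD[OF mpolys_mono Hk]) auto
  ultimately obtain b :: "nat \<Rightarrow> int" where "mev (H * mvar 0) b \<noteq> 0"
    using mpoly_nonvanishing by blast
  then have b: "mev H b \<noteq> 0" "b 0 \<noteq> 0" by (auto simp: mev_mult)
  \<comment> \<open>Division by the first coordinate leaves the integers, but by homogeneity it
    shows that the dehomogenised leading form \<open>H1\<close> is nonzero; an integer point for
    \<open>H1\<close> then gives \<open>c\<close>.\<close>
  define b' :: "nat \<Rightarrow> rat" where "b' j = of_int (b j) / of_int (b 0)" for j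
  have scale: "monom_eval (\<lambda>j. x * y j) t = x ^ monom_deg t * monom_eval y t"
    for x and y :: "nat \<Rightarrow> rat" and t
    by (simp add: monom_eval_def monom_deg_def power_mult_distrib prod.distrib power_sum)
  have "mev H (\<lambda>j. of_int (b 0) * b' j) = of_int (b 0) ^ total_deg f * mev H b'"
    unfolding mevH scale sum_distrib_left by (rule sum.cong) auto
  moreover have "mev H (\<lambda>j. of_int (b 0) * b' j) = of_int (mev H b)"
    using b(2) by (simp add: b'_def mevH monom_eval_of_int)
  ultimately have nz: "mev H b' \<noteq> 0" using b by auto
  define H1 where "H1 = mev H (\<lambda>j. if j = 0 then 1 else mvar j)"
  have H1: "mev H1 y = mev H (\<lambda>j. if j = 0 then 1 else y j)" for y :: "nat \<Rightarrow> 'c::comm_ring_1"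
    unfolding H1_def mev_mev by (rule arg_cong[where f = "mev H"]) auto
  have "mev H1 b' = mev H b'"
    unfolding H1 by (rule arg_cong[where f = "mev H"]) (use b(2) in \<open>auto simp: b'_def\<close>)
  with nz have "H1 \<noteq> 0" by auto
  moreover have "H1 \<in> mpolys k" unfolding H1_def
    by (rule subring_mev[OF subring_mpolys Hk])
      (use mvar_in_mpolys subringD(1)[OF subring_mpolys] in auto)
  ultimately obtain y :: "nat \<Rightarrow> int" where "mev H1 y \<noteq> 0" using mpoly_nonvanishing by blast
  then show ?thesis unfolding H1
    by (intro exI[of _ "\<lambda>j. if j = 0 then 1 else y j"]) (simp add: top)
qed

subsection \<open>Common factors\<close>

lemma degree_map_hom_le: "is_hom h \<Longrightarrow> degree (map_poly h p) \<le> degree p"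
  by (rule degree_le) (simp add: coeff_map_hom coeff_eq_0 is_homD(1))

lemma lead_coeff_map_hom:
  assumes h: "is_hom h" and "h (lead_coeff p) \<noteq> 0"
  shows "degree (map_poly h p) = degree p" "lead_coeff (map_poly h p) = h (lead_coeff p)"
proof -
  show "degree (map_poly h p) = degree p"
    using assms(2) degree_map_hom_le[OF h, of p] le_degree[of "map_poly h p" "degree p"]
    by (simp add: coeff_map_hom[OF h])
  then show "lead_coeff (map_poly h p) = h (lead_coeff p)" by (simp add: coeff_map_hom[OF h])
qed

lemma map_poly_smult_hom: "is_hom h \<Longrightarrow> map_poly h (smult c p) = smult (h c) (map_poly h p)"
  by (rule poly_eqI) (simp add: coeff_map_hom is_homD(4))

text \<open>By Gauss's lemma the primitive part of \<open>H\<close> divides \<open>F\<close> itself,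
  so its leading coefficient divides that of \<open>F\<close>. Multiplication by the content of
  \<open>H\<close> turns this into a statement about \<open>H\<close>.\<close>

lemma lead_coeff_dvd_by_content:
  fixes H Q F :: "'a::{factorial_ring_gcd, semiring_gcd_mult_normalize} poly"
  assumes eq: "smult (lead_coeff H ^ e) F = Q * H" and H: "H \<noteq> 0"
  shows "lead_coeff H dvd lead_coeff F * coeff H j"
proof -
  define a H0 where "a = content H" and "H0 = primitive_part H"
  have H0: "H = smult a H0" by (simp add: a_def H0_def)
  have c0: "content H0 = 1" using H by (simp add: H0_def)
  have eq': "smult (lead_coeff H ^ e) F = smult a Q * H0" using eq H0 by simp
  have "content (smult (lead_coeff H ^ e) F) = content (smult a Q)"
    unfolding eq' content_mult c0 by simp
  then have "lead_coeff H ^ e dvd content (smult a Q)"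
    by (metis content_smult dvd_triv_left normalize_dvd_iff)
  then have "[:lead_coeff H ^ e:] dvd smult a Q"
    by (simp only: const_poly_dvd_iff_dvd_content)
  then obtain Q' where Q': "smult a Q = smult (lead_coeff H ^ e) Q'" by (auto elim!: dvdE)
  have "smult (lead_coeff H ^ e) (F - Q' * H0) = 0"
    using eq' Q' by (simp add: smult_diff_right)
  then have "F = Q' * H0" using H by simp
  then have "lead_coeff F = lead_coeff Q' * lead_coeff H0" by (simp add: lead_coeff_mult)
  moreover have "lead_coeff H = a * lead_coeff H0" "coeff H j = a * coeff H0 j"
    by (subst H0, simp)+
  ultimately have "lead_coeff F * coeff H j = lead_coeff H * (lead_coeff Q' * coeff H0 j)"
    by (simp add: algebra_simps)
  then show ?thesis by simp
qed

text \<open>Divisibility over the rationals, cleared of denominators.\<close>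

definition has_common_factor :: "nat \<Rightarrow> 'i set \<Rightarrow> ('i \<Rightarrow> int mpoly) \<Rightarrow> bool" where
  "has_common_factor k I f \<longleftrightarrow> (\<exists>g\<in>mpolys k. \<not> mconst g \<and>
     (\<forall>i\<in>I. \<exists>N q. N \<noteq> 0 \<and> q \<in> mpolys k \<and> of_int N * f i = g * q))"

lemma mconst_iff: "mconst (f :: int mpoly) \<longleftrightarrow> f \<in> mpolys 0"
proof
  assume "f \<in> mpolys 0"
  then have "Poly_Mapping.keys t = {}" if "t \<in> Poly_Mapping.keys f" for t
    using that by (auto simp: mpolys_def)
  then show "mconst f" unfolding mconst_def by auto
qed (auto simp: mconst_def mpolys_def)

text \<open>
  The leading coefficient \<open>l\<close> of \<open>h\<close> is monic in \<open>X\<^sub>0\<close> up to a constant, so divisibility by \<open>l\<close>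
  can be tested after specialising the other variables, and there Gauss's lemma applies.
\<close>

lemma common_factor_of_monic:
  assumes k: "k \<ge> 1" and h: "h \<in> poly_over (mpolys k)" "degree h > 0"
    and f: "\<And>i. i \<in> I \<Longrightarrow> f i \<in> mpolys (Suc k)"
    and q: "\<And>i. i \<in> I \<Longrightarrow> \<exists>e q. q \<in> poly_over (mpolys k) \<and> smult (lead_coeff h ^ e) (uni k (f i)) = q * h"
    and i0: "i0 \<in> I" "lead_coeff (uni k (f i0)) = of_int c0" "c0 \<noteq> 0"
    and c1: "lead_coeff (uni 0 (lead_coeff h)) = of_int c1" "c1 \<noteq> 0"
  shows "has_common_factor (Suc k) I f"
proof -
  define l where "l = lead_coeff h"
  define D where "D = (mpolys k :: int mpoly set)"
  have D: "subring D" unfolding D_def by (rule subring_mpolys)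
  note SP = subring_poly_over[OF D]
  have hD: "h \<in> poly_over D" using h by (simp add: D_def)
  have lD: "l \<in> D" using hD by (auto simp: l_def poly_over_def)
  have l0: "l \<noteq> 0" using h(2) by (auto simp: l_def)
  have u0: "uni 0 p \<in> poly_over D" if "p \<in> D" for p
    unfolding uni_def
  proof (rule subring_mev[OF SP])
    fix j assume "j < k"
    then show "(if j = 0 then [:0, 1:] else [:mvar j:]) \<in> poly_over D"
      using subringD(1,2)[OF D] mvar_in_mpolys[of j k]
      by (auto simp: poly_over_def coeff_pCons D_def split: nat.splits)
  qed (use that in \<open>simp add: D_def\<close>)
  have ev0: "poly p (mvar 0) \<in> D" if "p \<in> poly_over D" for p
    by (rule poly_in_subring[OF D that]) (use k in \<open>simp add: D_def mvar_in_mpolys\<close>)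
  \<comment> \<open>Up to powers of \<open>c1\<close>, \<open>l\<close> divides every coefficient of
    \<open>h\<close>; hence a constant multiple of \<open>h / l\<close> is a polynomial with
    constant leading coefficient.\<close>
  have coeff_dvd: "\<exists>n g. g \<in> D \<and> of_int (c1 ^ n) * coeff h j = g * l" for j
  proof -
    define hj where "hj = coeff h j"
    have hjD: "hj \<in> D" using hD by (auto simp: hj_def poly_over_def)
    have "uni 0 l \<noteq> 0" using l0 by simp
    then obtain n g r where gr: "g \<in> poly_over D" "r \<in> poly_over D"
      "smult (lead_coeff (uni 0 l) ^ n) (uni 0 hj) = g * uni 0 l + r" "r = 0 \<or> degree r < degree (uni 0 l)"
      using pseudo_division[OF D u0[OF lD] _ u0[OF hjD]] by blast
    have r0: "r = 0"
    proof (rule ccontr)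
      assume "r \<noteq> 0"
      then have "lead_coeff r \<noteq> 0" "lead_coeff r \<in> mpolys k"
        using gr(2) by (auto simp: poly_over_def D_def)
      then obtain \<alpha> :: "nat \<Rightarrow> int" where \<alpha>: "mev (lead_coeff r) \<alpha> \<noteq> 0"
        using mpoly_nonvanishing by blast
      \<comment> \<open>All variables except \<open>X_0\<close> are specialised at a point where the
        remainder survives. The degree of \<open>l\<close> does not drop, its leading coefficient in
        \<open>X_0\<close> being the constant \<open>c1\<close>.\<close>
      define sp :: "int mpoly \<Rightarrow> int poly" where
        "sp p = mev p (\<lambda>j. if j = 0 then [:0, 1:] else [:\<alpha> j:])" for p
      have sp: "is_hom sp" unfolding sp_def by (rule is_hom_mev_right)
      define ev where "ev = map_poly (\<lambda>c. mev c \<alpha>)"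
      have ev: "is_hom ev" unfolding ev_def by (rule is_hom_map_poly[OF is_hom_mev_right])
      have cev: "coeff (ev p) i = mev (coeff p i) \<alpha>" for p i
        unfolding ev_def by (rule coeff_map_hom[OF is_hom_mev_right])
      have sp_ev: "sp p = ev (uni 0 p)" for p
        unfolding sp_def uni_def is_hom_mev[OF ev]
        by (rule arg_cong[where f = "mev p"]) (auto simp: ev_def map_poly_pCons)
      have dl: "degree (sp l) = degree (uni 0 l)" "sp l \<noteq> 0"
      proof -
        have "coeff (sp l) (degree (uni 0 l)) = c1"
          unfolding sp_ev cev using c1(1) by (simp add: l_def)
        moreover have "degree (sp l) \<le> degree (uni 0 l)"
          unfolding sp_ev ev_def by (rule degree_map_hom_le[OF is_hom_mev_right])
        ultimately show "degree (sp l) = degree (uni 0 l)" "sp l \<noteq> 0"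
          using c1(2) by (auto intro: le_antisym le_degree)
      qed
      have dr: "ev r \<noteq> 0" "degree (ev r) < degree (sp l)"
      proof -
        show "ev r \<noteq> 0" using \<alpha> cev[of r "degree r"] by auto
        show "degree (ev r) < degree (sp l)"
          using gr(4) \<open>r \<noteq> 0\<close> degree_map_hom_le[OF is_hom_mev_right, of \<alpha> r] dl by (simp add: ev_def)
      qed
      have "ev ([:of_int c1:] ^ n * uni 0 hj) = ev (g * uni 0 l + r)"
        using gr(3) c1(1) by (simp add: l_def poly_const_pow)
      then have e1: "ev [:of_int c1:] ^ n * sp hj = ev g * sp l + ev r"
        by (simp add: is_homD(3,4)[OF ev] is_hom_power[OF ev] sp_ev)
      define H where "H = map_poly sp h"
      have cH: "coeff H i = sp (coeff h i)" for i unfolding H_def by (rule coeff_map_hom[OF sp])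
      have lH: "lead_coeff H = sp l"
        unfolding H_def l_def by (rule lead_coeff_map_hom(2)[OF sp]) (use dl(2) in \<open>simp add: l_def\<close>)
      then have H0: "H \<noteq> 0" using dl(2) by auto
      obtain e Q where Q: "smult (l ^ e) (uni k (f i0)) = Q * h" using q[OF i0(1)] l_def by auto
      have "map_poly sp (smult (l ^ e) (uni k (f i0))) = map_poly sp (Q * h)" using Q by simp
      then have "smult (lead_coeff H ^ e) (map_poly sp (uni k (f i0))) = map_poly sp Q * H"
        unfolding map_poly_smult_hom[OF sp] is_homD(4)[OF is_hom_map_poly[OF sp]]
          is_hom_power[OF sp] H_def[symmetric] lH .
      \<comment> \<open>Gauss's lemma applies over \<open>int poly\<close>. As \<open>f i0\<close>
        has the constant leading coefficient \<open>c0\<close>, it makes \<open>sp l\<close> divide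
        a multiple of the specialised remainder, whose degree is too small for that.\<close>
      from lead_coeff_dvd_by_content[OF this H0, of j]
      have "sp l dvd lead_coeff (map_poly sp (uni k (f i0))) * sp hj"
        unfolding lH unfolding cH hj_def .
      moreover have "lead_coeff (map_poly sp (uni k (f i0))) = of_int c0"
        using lead_coeff_map_hom(2)[OF sp, of "uni k (f i0)"] i0(3)
        unfolding i0(2) is_hom_of_int[OF sp] by simp
      ultimately have "sp l dvd of_int c0 * sp hj" by simp
      then have "sp l dvd of_int c0 * (ev [:of_int c1:] ^ n * sp hj)"
        by (metis dvd_mult2 mult.assoc mult.commute)
      then have "sp l dvd of_int c0 * ev g * sp l + of_int c0 * ev r"
        unfolding e1 by (simp add: algebra_simps)
      then have "sp l dvd of_int c0 * ev r" by (simp add: dvd_add_right_iff)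
      moreover have "of_int c0 * ev r = smult c0 (ev r)" by (simp add: of_int_poly)
      ultimately have "sp l dvd smult c0 (ev r)" by simp
      from dvd_imp_degree_le[OF this] show False using dr i0(3) by simp
    qed
    have "poly (smult (lead_coeff (uni 0 l) ^ n) (uni 0 hj)) (mvar 0) = poly (g * uni 0 l) (mvar 0)"
      using gr(3) r0 by simp
    then have "of_int (c1 ^ n) * hj = poly g (mvar 0) * l"
      using c1(1) by (simp add: poly_uni l_def)
    then show ?thesis using ev0[OF gr(1)] hj_def by blast
  qed
  then obtain n g where ng: "\<And>j. g j \<in> D" "\<And>j. of_int (c1 ^ n j) * coeff h j = g j * l"
    by metis
  define E where "E = (\<Sum>j\<le>degree h. n j)"
  define N where "N = c1 ^ E"
  \<comment> \<open>This is \<open>c1 ^ E * h / l\<close>; the exponents \<open>E - n j\<close>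
    bring the different powers of \<open>c1\<close> to a common denominator.\<close>
  define h1 where "h1 = (\<Sum>j\<le>degree h. monom (of_int (c1 ^ (E - n j)) * g j) j)"
  have "coeff h1 i \<in> D" for i
    unfolding h1_def coeff_sum
    by (rule subring_sum[OF D]) (auto intro!: subringD(2,6)[OF D] ng(1) subring_of_int[OF D] subring_power[OF D])
  then have h1D: "h1 \<in> poly_over D" by (simp add: poly_over_def)
  have Nh: "smult (of_int N) h = smult l h1"
  proof (rule poly_eqI)
    fix j
    have h1j: "coeff h1 j = (if j \<le> degree h then of_int (c1 ^ (E - n j)) * g j else 0)"
      by (simp add: h1_def coeff_sum)
    show "coeff (smult (of_int N) h) j = coeff (smult l h1) j"
    proof (cases "j \<le> degree h")
      case True
      then have "n j \<le> E" unfolding E_def by (intro member_le_sum) auto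
      then have "N = c1 ^ (E - n j) * c1 ^ n j" by (simp add: N_def flip: power_add)
      then have "of_int N * coeff h j = of_int (c1 ^ (E - n j)) * (of_int (c1 ^ n j) * coeff h j)"
        by (simp only: of_int_mult mult.assoc)
      also have "\<dots> = l * (of_int (c1 ^ (E - n j)) * g j)" unfolding ng(2) by (simp only: ac_simps)
      finally show ?thesis using True by (simp add: h1j)
    qed (simp add: h1j coeff_eq_0)
  qed
  have N0: "N \<noteq> 0" "(of_int N :: int mpoly) \<noteq> 0" using c1(2) by (auto simp: N_def)
  have dh1: "degree h1 = degree h"
    using arg_cong[OF Nh, of degree] N0 l0 by simp
  have "l * of_int N = l * lead_coeff h1"
    using arg_cong[OF Nh, of "\<lambda>p. coeff p (degree h)"] by (simp add: dh1 l_def mult.commute)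
  then have lh1: "lead_coeff h1 = of_int N" using l0 by simp
  have h10: "h1 \<noteq> 0" using dh1 h(2) by auto
  define G where "G = poly h1 (mvar k)"
  have G: "G \<in> mpolys (Suc k)" unfolding G_def by (rule poly_over_mvar_in) (use h1D in \<open>simp add: D_def\<close>)
  have uG: "uni k G = h1" unfolding G_def by (rule uni_poly) (use h1D in \<open>simp add: D_def\<close>)
  have "\<not> mconst G"
  proof
    assume "mconst G"
    then have "G \<in> mpolys k" using mpolys_mono[of 0 k] by (auto simp: mconst_iff)
    from uni_const[OF this] show False using uG dh1 h(2) by simp
  qed
  moreover have "\<exists>N q. N \<noteq> 0 \<and> q \<in> mpolys (Suc k) \<and> of_int N * f i = G * q" if i: "i \<in> I" for i
  proof -
    obtain e Q where Q: "Q \<in> poly_over D" "smult (l ^ e) (uni k (f i)) = Q * h"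
      using q[OF i] l_def D_def by auto
    have "uni k (f i) \<in> poly_over D" using uni_in_poly_over[OF f[OF i]] by (simp add: D_def)
    from pseudo_division[OF D h1D h10 this]
    obtain b Q' r where b: "Q' \<in> poly_over D" "smult (lead_coeff h1 ^ b) (uni k (f i)) = Q' * h1 + r"
      "r = 0 \<or> degree r < degree h1" by blast
    have r0: "r = 0"
    proof (rule ccontr)
      assume r: "r \<noteq> 0"
      let ?N = "of_int N :: int mpoly"
      \<comment> \<open>After multiplication by \<open>N * l ^ e\<close> both terms are multiples of
        \<open>h1\<close>, because \<open>N * h = l * h1\<close>; a nonzero remainder has too small
        a degree to be one.\<close>
      have "smult (?N * l ^ e) r = smult (?N * l ^ e) (smult (?N ^ b) (uni k (f i)) - Q' * h1)"
        using b(2) lh1 by simp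
      also have "\<dots> = smult (?N * ?N ^ b) (smult (l ^ e) (uni k (f i))) - smult (?N * l ^ e) (Q' * h1)"
        by (simp add: smult_diff_right ac_simps)
      also have "\<dots> = smult (?N ^ b) (Q * smult ?N h) - smult (?N * l ^ e) (Q' * h1)"
        unfolding Q(2) by (simp add: ac_simps)
      also have "\<dots> = (smult (?N ^ b * l) Q - smult (?N * l ^ e) Q') * h1"
        unfolding Nh by (simp add: algebra_simps)
      finally have *: "smult (?N * l ^ e) r = (smult (?N ^ b * l) Q - smult (?N * l ^ e) Q') * h1" .
      moreover have "smult (?N * l ^ e) r \<noteq> 0" using r N0 l0 by simp
      ultimately have "degree h1 \<le> degree (smult (?N * l ^ e) r)"
        by (metis degree_mult_right_le mult.commute mult_zero_left)
      then show False using b(3) r N0 l0 by simp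
    qed
    have "poly (smult (of_int N ^ b) (uni k (f i))) (mvar k) = poly (Q' * h1) (mvar k)"
      using b(2) r0 lh1 by simp
    then have "of_int (N ^ b) * f i = G * poly Q' (mvar k)"
      by (simp add: poly_uni G_def mult.commute)
    moreover have "poly Q' (mvar k) \<in> mpolys (Suc k)"
      by (rule poly_over_mvar_in) (use b(1) in \<open>simp add: D_def\<close>)
    moreover have "N ^ b \<noteq> 0" using N0 by simp
    ultimately show ?thesis by blast
  qed
  ultimately show ?thesis unfolding has_common_factor_def
    by (intro bexI[OF _ G] conjI ballI) simp_all
qed

section \<open>Invertible changes of variables\<close>

lemma mev_inverse_substitution:
  assumes "f \<in> mpolys k" "\<And>j. j < k \<Longrightarrow> mev (s j) s' = mvar j"
  shows "mev (mev f s) s' = f"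
  unfolding mev_mev using mev_cong[OF assms(1), of "\<lambda>j. mev (s j) s'" mvar] assms(2)
  by (simp add: mev_id)

lemma has_common_factor_substitution:
  assumes "\<And>j. j < k \<Longrightarrow> s j \<in> mpolys k" "\<And>j. j < k \<Longrightarrow> s' j \<in> mpolys k"
    and "\<And>j. j < k \<Longrightarrow> mev (s j) s' = mvar j" "\<And>j. j < k \<Longrightarrow> mev (s' j) s = mvar j"
    and f: "\<And>i. i \<in> I \<Longrightarrow> f i \<in> mpolys k"
    and "has_common_factor k I (\<lambda>i. mev (f i) s)"
  shows "has_common_factor k I f"
proof -
  from assms(6) obtain g where g: "g \<in> mpolys k" "\<not> mconst g"
    "\<forall>i\<in>I. \<exists>N q. N \<noteq> 0 \<and> q \<in> mpolys k \<and> of_int N * mev (f i) s = g * q"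
    unfolding has_common_factor_def by (elim bexE conjE) (rule that; assumption)
  have "\<not> mconst (mev g s')"
  proof
    assume "mconst (mev g s')"
    then obtain c where "mev g s' = of_int c"
      using mpolys_0_const[of "mev g s'"] that unfolding mconst_iff by simp
    then have "g = of_int c" using mev_inverse_substitution[OF g(1), of s' s] assms(4) by simp
    then show False using g(2) subring_of_int[OF subring_mpolys[of 0]] by (auto simp: mconst_iff)
  qed
  moreover have G: "mev g s' \<in> mpolys k" by (rule subring_mev[OF subring_mpolys g(1) assms(2)])
  moreover have "\<exists>N q. N \<noteq> 0 \<and> q \<in> mpolys k \<and> of_int N * f i = mev g s' * q" if i: "i \<in> I" for i
  proof -
    obtain N q where N: "N \<noteq> 0" "q \<in> mpolys k" "of_int N * mev (f i) s = g * q"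
      using bspec[OF g(3) i] by (elim exE conjE) (rule that; assumption)
    have "mev (of_int N * mev (f i) s) s' = mev (g * q) s'" using N(3) by simp
    then have "of_int N * f i = mev g s' * mev q s'"
      using mev_inverse_substitution[OF f[OF i], of s s'] assms(3) by (simp add: mev_mult)
    moreover have "mev q s' \<in> mpolys k" by (rule subring_mev[OF subring_mpolys N(2) assms(2)])
    ultimately show ?thesis using N(1) by (intro exI[of _ N] exI[of _ "mev q s'"] conjI)
  qed
  ultimately show ?thesis unfolding has_common_factor_def
    by (intro bexI[OF _ G] conjI ballI) simp_all
qed

text \<open>Reduces to \<open>common_factor_of_monic\<close>: a shift of the \<open>X_j\<close> with
  \<open>0 < j < k\<close> by \<open>c j * X_0\<close> makes the leading coefficient of
  \<open>h\<close> monic in \<open>X_0\<close> up to a constant. It does not touch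
  \<open>X_k\<close>, so it acts coefficientwise on polynomials in \<open>X_k\<close>.\<close>

lemma common_factor_of_elimination_failure:
  assumes k: "k \<ge> 1" and h: "h \<in> poly_over (mpolys k)" "degree h > 0"
    and f: "\<And>i. i \<in> I \<Longrightarrow> f i \<in> mpolys (Suc k)"
    and q: "\<And>i. i \<in> I \<Longrightarrow> \<exists>e q. q \<in> poly_over (mpolys k) \<and> smult (lead_coeff h ^ e) (uni k (f i)) = q * h"
    and i0: "i0 \<in> I" "lead_coeff (uni k (f i0)) = of_int c0" "c0 \<noteq> 0"
  shows "has_common_factor (Suc k) I f"
proof -
  define l where "l = lead_coeff h"
  have l: "l \<in> mpolys k" "l \<noteq> 0" using h by (auto simp: l_def poly_over_def)
  obtain c where c: "c 0 = 1" "top_at l c \<noteq> 0" using exists_top_at_nonzero[OF l] by blast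
  \<comment> \<open>The sign parameter \<open>e\<close> makes \<open>s (- e)\<close> the inverse of
    \<open>s e\<close>. The variable \<open>X_0\<close> stays, in accordance with
    \<open>c 0 = 1\<close>.\<close>
  define s where "s e j = (if 0 < j \<and> j < k then mvar j + of_int (e * c j) * mvar 0 else mvar j)"
    for e j
  have sk: "s e j \<in> mpolys k" if "j < k" for e j
    using that unfolding s_def
    by (auto intro!: subringD(4,6)[OF subring_mpolys] subring_of_int[OF subring_mpolys] mvar_in_mpolys
        simp del: of_int_mult)
  have sk': "s e j \<in> mpolys (Suc k)" if "j < Suc k" for e j
    using that sk[of j e] mpolys_mono[of k "Suc k"] mvar_in_mpolys[of k "Suc k"]
    by (cases "j = k") (auto simp: s_def)
  have inv: "mev (s e j) (s (- e)) = mvar j" for e j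
    using k by (auto simp: s_def mev_add mev_mult mev_diff)
  let ?S = "\<lambda>p. mev p (s 1)"
  have S: "is_hom ?S" by (rule is_hom_mev_right)
  have SP: "is_hom (map_poly ?S)" by (rule is_hom_map_poly[OF S])
  have Sinj: "?S p = 0 \<Longrightarrow> p = 0" for p
    using inv mev_mev[of p "s 1" "s (-1)"] by (simp add: mev_id)
  have cS: "coeff (map_poly ?S p) i = ?S (coeff p i)" for p i by (rule coeff_map_hom[OF S])
  have degS: "degree (map_poly ?S p) = degree p" for p
    by (cases "p = 0") (auto intro!: degree_map_poly dest: Sinj)
  have lcS: "lead_coeff (map_poly ?S p) = ?S (lead_coeff p)" for p by (simp add: degS cS)
  have us: "uni k (s 1 j) = (if j = k then [:0, 1:] else [:s 1 j:])" for j
  proof -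
    have "uni k (mvar j) = (if j = k then [:0, 1:] else [:mvar j:])" for j
      by (simp add: uni_def)
    moreover have "uni k (of_int a) = [:of_int a:]" for a
      by (simp add: uni_def of_int_poly)
    ultimately show ?thesis using k
      by (auto simp: s_def is_homD(3,4)[OF is_hom_uni] simp del: of_int_mult)
  qed
  have uS: "uni k (?S p) = map_poly ?S (uni k p)" for p
  proof -
    have "uni k (?S p) = mev p (\<lambda>j. uni k (s 1 j))" by (rule is_hom_mev[OF is_hom_uni])
    moreover have "map_poly ?S (uni k p) =
        mev p (\<lambda>j. map_poly ?S (if j = k then [:0, 1:] else [:mvar j:]))"
      unfolding uni_def by (rule is_hom_mev[OF SP])
    moreover have "map_poly ?S (if j = k then [:0, 1:] else [:mvar j:]) = uni k (s 1 j)" for j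
      unfolding us by (simp add: map_poly_pCons)
    ultimately show ?thesis by simp
  qed
  have SD: "?S p \<in> mpolys k" if "p \<in> mpolys k" for p
    by (rule subring_mev[OF subring_mpolys that sk])
  have "has_common_factor (Suc k) I (\<lambda>i. ?S (f i))"
  proof (rule common_factor_of_monic[OF k, where h = "map_poly ?S h" and ?i0.0 = i0])
    show "map_poly ?S h \<in> poly_over (mpolys k)" using h(1) SD by (auto simp: poly_over_def cS)
    show "0 < degree (map_poly ?S h)" using h(2) by (simp add: degS)
    show "?S (f i) \<in> mpolys (Suc k)" if "i \<in> I" for i
      by (rule subring_mev[OF subring_mpolys f[OF that] sk'])
    show "\<exists>e q. q \<in> poly_over (mpolys k) \<and>
        smult (lead_coeff (map_poly ?S h) ^ e) (uni k (?S (f i))) = q * map_poly ?S h" if i: "i \<in> I" for i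
    proof -
      obtain e q where eq: "q \<in> poly_over (mpolys k)" "smult (lead_coeff h ^ e) (uni k (f i)) = q * h"
        using q[OF i] by blast
      have "map_poly ?S (smult (lead_coeff h ^ e) (uni k (f i))) = map_poly ?S (q * h)" using eq(2) by simp
      then have "smult (lead_coeff (map_poly ?S h) ^ e) (uni k (?S (f i))) = map_poly ?S q * map_poly ?S h"
        unfolding map_poly_smult_hom[OF S] is_homD(4)[OF SP] uS lcS mev_power .
      moreover have "map_poly ?S q \<in> poly_over (mpolys k)" using eq(1) SD by (auto simp: poly_over_def cS)
      ultimately show ?thesis by blast
    qed
    show "lead_coeff (uni k (?S (f i0))) = of_int c0" unfolding uS lcS i0(2) by simp
    have "uni 0 (?S l) = mev l (\<lambda>j. uni 0 (s 1 j))" by (rule is_hom_mev[OF is_hom_uni])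
    also have "\<dots> = mev l (\<lambda>j. [:if j = 0 then 0 else mvar j, of_int (c j):])"
    proof (rule mev_cong[OF l(1)])
      fix j assume "j < k"
      have "uni 0 (mvar j) = (if j = 0 then [:0, 1:] else [:mvar j:])" for j by (simp add: uni_def)
      moreover have "uni 0 (of_int a) = [:of_int a:]" for a by (simp add: uni_def of_int_poly)
      ultimately show "uni 0 (s 1 j) = [:if j = 0 then 0 else mvar j, of_int (c j):]"
        using c(1) \<open>j < k\<close> by (auto simp: s_def is_homD(3,4)[OF is_hom_uni] simp del: of_int_mult)
    qed
    finally have "degree (uni 0 (?S l)) \<le> total_deg l"
      "coeff (uni 0 (?S l)) (total_deg l) = of_int (top_at l c)"
      using mev_linear[of l "\<lambda>j. if j = 0 then 0 else mvar j" c] by auto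
    then have "lead_coeff (uni 0 (?S l)) = of_int (top_at l c)"
      using c(2) by (metis le_antisym le_degree of_int_eq_0_iff)
    then show "lead_coeff (uni 0 (lead_coeff (map_poly ?S h))) = of_int (top_at l c)"
      unfolding lcS l_def .
  qed (use i0 c in auto)
  then show ?thesis
  proof (rule has_common_factor_substitution[where s' = "s (-1)", rotated -1])
    show "mev (s (- 1) j) (s 1) = mvar j" for j using inv[of "-1"] by simp
    show "mev (s 1 j) (s (- 1)) = mvar j" for j by (rule inv)
    show "f i \<in> mpolys (Suc k)" if "i \<in> I" for i using that by (rule f)
  qed (fact sk')+
qed

section \<open>Elimination from two polynomials\<close>

lemma mev_of_nat [simp]: "mev (of_nat n) a = of_nat n"
  using mev_of_int[of "int n" a] by simp

lemma fundamental_theorem_degree: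
  fixes p :: "complex poly"
  assumes "degree p > 0" shows "\<exists>z. poly p z = 0"
  using fundamental_theorem_of_algebra[of p] assms by (simp add: constant_degree)

text \<open>
  At a point where the eliminant of the whole family does not vanish, \<open>f 0\<close> has at most \<open>degree f 0\<close>
  roots, and each of them is a root of \<open>\<Sum>i<m. t ^ i * f i\<close> for fewer than \<open>m\<close> values of \<open>t\<close>.
\<close>

lemma elimination_by_combination:
  fixes f :: "nat \<Rightarrow> int mpoly"
  assumes m: "m \<ge> 1" and f: "\<And>i. i < m \<Longrightarrow> f i \<in> mpolys (Suc k)"
    and c0: "lead_coeff (uni k (f 0)) = of_int c0" "c0 \<noteq> 0"
    and R: "(\<Sum>i<m. U i * f i) = R" "R \<in> mpolys k" "R \<noteq> 0"
  shows "\<exists>(w :: nat \<Rightarrow> int) U V R. R \<in> mpolys k \<and> R \<noteq> 0 \<and> U * f 0 + V * (\<Sum>i<m. of_int (w i) * f i) = R"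
proof (rule ccontr)
  assume neg: "\<not> ?thesis"
  define d where "d = degree (uni k (f 0))"
  define g where "g t = (\<Sum>i<m. of_int (int t ^ i) * f i)" for t :: nat
  have f00: "f 0 \<noteq> 0" using c0 by (auto simp: uni_def)
  have gk: "g t \<in> mpolys (Suc k)" for t unfolding g_def
    by (rule subring_sum[OF subring_mpolys])
      (auto intro!: subringD(6)[OF subring_mpolys] subring_of_int[OF subring_mpolys] f simp del: of_int_power)
  have "\<exists>h \<in> poly_over (mpolys k). degree h > 0 \<and>
      (\<forall>i\<in>{0, 1 :: nat}. \<exists>e q. q \<in> poly_over (mpolys k) \<and>
        smult (lead_coeff h ^ e) (uni k (if i = 0 then f 0 else g t)) = q * h)" for t
  proof -
    have n1: "\<not> (\<exists>U R. R \<in> mpolys k \<and> R \<noteq> 0 \<and> (\<Sum>i\<in>{0, 1 :: nat}. U i * (if i = 0 then f 0 else g t)) = R)"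
    proof
      assume "\<exists>U R. R \<in> mpolys k \<and> R \<noteq> 0 \<and> (\<Sum>i\<in>{0, 1 :: nat}. U i * (if i = 0 then f 0 else g t)) = R"
      then obtain U R where UR: "R \<in> mpolys k" "R \<noteq> 0"
        "(\<Sum>i\<in>{0, 1 :: nat}. U i * (if i = 0 then f 0 else g t)) = R"
        by (elim exE conjE) (rule that; assumption)
      have "U 0 * f 0 + U 1 * (\<Sum>i<m. of_int (int t ^ i) * f i) = R"
        using UR(3) by (simp add: g_def)
      show False
        by (rule notE[OF neg], rule exI[of _ "\<lambda>i. int t ^ i"], rule exI[of _ "U 0"],
            rule exI[of _ "U 1"], rule exI[of _ R]) (intro conjI UR(1,2); fact)
    qed
    have "(if i = 0 then f 0 else g t) \<in> mpolys (Suc k)" for i :: nat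
      using f[of 0] m gk by simp
    from elimination_or_common_divisor[of "{0, 1 :: nat}" 0 "\<lambda>i. if i = 0 then f 0 else g t" k, OF _ _ _ this]
    show ?thesis using f00 by (simp only: n1 simp_thms) simp
  qed
  then obtain h where h: "\<And>t. h t \<in> poly_over (mpolys k)" "\<And>t. degree (h t) > 0"
    and hd: "\<And>t i. i \<in> {0, 1 :: nat} \<Longrightarrow> \<exists>e q. q \<in> poly_over (mpolys k) \<and>
        smult (lead_coeff (h t) ^ e) (uni k (if i = 0 then f 0 else g t)) = q * h t"
    by metis
  \<comment> \<open>One more than the number of \<open>t\<close> for which \<open>g t\<close> can
    share a root with \<open>f 0\<close>: at most \<open>d\<close> roots, each for at most
    \<open>m\<close> values of \<open>t\<close>.\<close>
  define M where "M = d * m + 1"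
  define P where "P = R * (\<Prod>t<M. lead_coeff (h t))"
  have "lead_coeff (h t) \<in> mpolys k" "lead_coeff (h t) \<noteq> 0" for t
    using h[of t] by (auto simp: poly_over_def)
  then have "P \<in> mpolys k" "P \<noteq> 0"
    using R(2,3) by (auto simp: P_def intro!: subringD(6)[OF subring_mpolys] subring_prod[OF subring_mpolys])
  \<comment> \<open>At this point the eliminant of the family and the leading coefficients of all
    the factors \<open>h t\<close> survive, so that every \<open>h t\<close> keeps its degree and
    has a complex root.\<close>
  then obtain \<alpha> :: "nat \<Rightarrow> int" where \<alpha>: "mev P \<alpha> \<noteq> 0" using mpoly_nonvanishing by blast
  define b where "b z = (\<lambda>j. if j = k then z else of_int (\<alpha> j) :: complex)" for z
  have bk: "mev p (b z) = of_int (mev p \<alpha>)" if "p \<in> mpolys k" for p z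
  proof -
    have "is_hom (of_int :: int \<Rightarrow> complex)" by (simp add: is_hom_def)
    from is_hom_mev[OF this, of p \<alpha>] show ?thesis
      using mev_cong[OF that, of "b z" "\<lambda>j. of_int (\<alpha> j)"] by (simp add: b_def)
  qed
  have nz: "mev R (b z) \<noteq> 0" "t < M \<Longrightarrow> mev (lead_coeff (h t)) (b z) \<noteq> 0" for z t
    using \<alpha> R(2) \<open>\<And>t. lead_coeff (h t) \<in> mpolys k\<close>
    by (auto simp: bk P_def mev_mult mev_prod)
  define \<psi> where "\<psi> z p = poly (map_poly (\<lambda>c. mev c (b z)) p) z" for z p
  have \<psi>: "is_hom (\<psi> z)" for z
    unfolding \<psi>_def by (rule is_hom_comp[OF is_hom_poly is_hom_map_poly[OF is_hom_mev_right]])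
  have \<psi>u: "\<psi> z (uni k p) = mev p (b z)" for z p
    unfolding \<psi>_def using mev_uni[of p "b z" k] by (simp add: b_def)
  have \<psi>s: "\<psi> z (smult c p) = mev c (b z) * \<psi> z p" for z c p
    unfolding \<psi>_def map_poly_smult_hom[OF is_hom_mev_right] by simp
  have mapb: "map_poly (\<lambda>c. mev c (b z)) p = map_poly (\<lambda>c. mev c (b 0)) p"
    if "p \<in> poly_over (mpolys k)" for p z
    by (rule poly_eqI) (use that in \<open>auto simp: coeff_map_hom[OF is_hom_mev_right] bk poly_over_def\<close>)
  have "\<exists>z. mev (f 0) (b z) = 0 \<and> mev (g t) (b z) = 0" if t: "t < M" for t
  proof -
    have "degree (map_poly (\<lambda>c. mev c (b 0)) (h t)) > 0"
      using lead_coeff_map_hom(1)[OF is_hom_mev_right, of "h t" "b 0"] nz(2)[OF t] h(2) by simp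
    then obtain z where "poly (map_poly (\<lambda>c. mev c (b 0)) (h t)) z = 0"
      using fundamental_theorem_degree by blast
    then have z: "\<psi> z (h t) = 0" unfolding \<psi>_def mapb[OF h(1), where z = z] .
    have "mev (if i = 0 then f 0 else g t) (b z) = 0" if i: "i \<in> {0, 1 :: nat}" for i
    proof -
      obtain e q where eq: "smult (lead_coeff (h t) ^ e) (uni k (if i = 0 then f 0 else g t)) = q * h t"
        using hd[OF i, of t] by (elim exE conjE) (rule that; assumption)
      have "mev (lead_coeff (h t) ^ e) (b z) * mev (if i = 0 then f 0 else g t) (b z) = \<psi> z q * \<psi> z (h t)"
        using arg_cong[OF eq, of "\<psi> z"] by (simp only: \<psi>s \<psi>u is_homD(4)[OF \<psi>])
      then have "mev (lead_coeff (h t) ^ e) (b z) * mev (if i = 0 then f 0 else g t) (b z) = 0"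
        by (simp only: z mult_zero_right)
      then show ?thesis using nz(2)[OF t] by (simp add: mev_power)
    qed
    from this[of 0] this[of 1] show ?thesis by auto
  qed
  then obtain z where z: "\<And>t. t < M \<Longrightarrow> mev (f 0) (b (z t)) = 0" "\<And>t. t < M \<Longrightarrow> mev (g t) (b (z t)) = 0"
    by metis
  define Z where "Z = {y. mev (f 0) (b y) = 0}"
  define p0 where "p0 = map_poly (\<lambda>c. mev c (b 0)) (uni k (f 0))"
  have "mev (f 0) (b y) = poly p0 y" for y
    using \<psi>u[of y "f 0"] mapb[OF uni_in_poly_over[OF f], of 0 y] m by (simp add: \<psi>_def p0_def)
  moreover have "p0 \<noteq> 0" "degree p0 \<le> d"
    using lead_coeff_map_hom[OF is_hom_mev_right, of "uni k (f 0)" "b 0"] c0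
    unfolding p0_def d_def by auto
  ultimately have Z: "finite Z" "card Z \<le> d"
    using poly_roots_finite[of p0] card_poly_roots_bound[of p0] by (auto simp: Z_def)
  \<comment> \<open>As a polynomial in \<open>t\<close>, \<open>W y\<close> gives the value of
    \<open>g t\<close> at the point over \<open>y\<close>. It is nonzero, because the value of
    \<open>R\<close> there is a combination of its coefficients and does not vanish.\<close>
  define W where "W y = (\<Sum>i<m. monom (mev (f i) (b y)) i)" for y
  have W0: "W y \<noteq> 0" for y
  proof
    assume "W y = 0"
    have "mev (f i) (b y) = 0" if "i < m" for i
    proof -
      have "coeff (W y) i = mev (f i) (b y)" using that by (simp add: W_def coeff_sum)
      with \<open>W y = 0\<close> show ?thesis by simp
    qed
    then have "mev R (b y) = 0" unfolding R(1)[symmetric] by (simp add: mev_sum mev_mult)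
    then show False using nz(1) by blast
  qed
  have dW: "degree (W y) < m" for y
  proof -
    have "degree (W y) \<le> m - 1" unfolding W_def
      by (rule degree_sum_le) (auto intro: order_trans[OF degree_monom_le])
    then show ?thesis using m by simp
  qed
  have T: "{..<M} \<subseteq> (\<Union>y\<in>Z. {t. poly (W y) (of_nat t) = 0})"
  proof
    fix t assume "t \<in> {..<M}"
    then have t: "t < M" by simp
    have "poly (W (z t)) (of_nat t) = mev (g t) (b (z t))"
      by (simp add: W_def g_def mev_sum mev_mult mev_power poly_sum poly_monom mult.commute)
    then show "t \<in> (\<Union>y\<in>Z. {t. poly (W y) (of_nat t) = 0})" using z[OF t] by (auto simp: Z_def)
  qed
  have Tc: "finite {t::nat. poly (W y) (of_nat t) = 0}" "card {t::nat. poly (W y) (of_nat t) = 0} \<le> m" for y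
  proof -
    have "of_nat ` {t::nat. poly (W y) (of_nat t) = 0} \<subseteq> {x. poly (W y) x = 0}" by auto
    moreover have i: "inj_on (of_nat :: nat \<Rightarrow> complex) {t::nat. poly (W y) (of_nat t) = 0}"
      by (simp add: inj_on_def)
    ultimately show "finite {t::nat. poly (W y) (of_nat t) = 0}"
      using poly_roots_finite[OF W0[of y]] by (meson finite_imageD finite_subset)
    have "card {t::nat. poly (W y) (of_nat t) = 0} \<le> card {x. poly (W y) x = 0}"
      by (rule card_inj_on_le[OF i]) (auto simp: poly_roots_finite[OF W0])
    then show "card {t::nat. poly (W y) (of_nat t) = 0} \<le> m"
      using card_poly_roots_bound[OF W0[of y]] dW[of y] by linarith
  qed
  have "M \<le> card (\<Union>y\<in>Z. {t::nat. poly (W y) (of_nat t) = 0})"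
    using card_mono[OF _ T] Z(1) Tc(1) by simp
  also have "\<dots> \<le> (\<Sum>y\<in>Z. card {t::nat. poly (W y) (of_nat t) = 0})" by (rule card_UN_le[OF Z(1)])
  also have "\<dots> \<le> (\<Sum>y\<in>Z. m)" by (rule sum_mono) (rule Tc(2))
  also have "\<dots> \<le> d * m" using Z(2) by simp
  finally show False by (simp add: M_def)
qed

section \<open>Relative primality over the rationals and the eliminant\<close>

lemma lookup_rat_mpoly: "Poly_Mapping.lookup (rat_mpoly f) t = of_int (Poly_Mapping.lookup f t)"
  by (simp add: rat_mpoly_def map.rep_eq when_def)

lemma keys_rat_mpoly: "Poly_Mapping.keys (rat_mpoly f) = Poly_Mapping.keys f"
  by (auto simp: in_keys_iff lookup_rat_mpoly)

lemma rat_mpoly_mult: "rat_mpoly (f * g) = rat_mpoly f * rat_mpoly g"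
proof -
  let ?l = "Poly_Mapping.lookup"
  have add: "rat_mpoly (\<Sum>i\<in>I. h i) = (\<Sum>i\<in>I. rat_mpoly (h i))" for I and h :: "'z \<Rightarrow> int mpoly"
    by (rule poly_mapping_eqI) (simp add: lookup_rat_mpoly lookup_sum)
  have single: "rat_mpoly (Poly_Mapping.single t c) = Poly_Mapping.single t (of_int c)" for t c
    by (rule poly_mapping_eqI) (simp add: lookup_rat_mpoly lookup_single when_def)
  have ex: "h = (\<Sum>t\<in>Poly_Mapping.keys h. Poly_Mapping.single t (?l h t))" for h :: "int mpoly"
    by (rule mpoly_expand)
  have "f * g = (\<Sum>s\<in>Poly_Mapping.keys f. \<Sum>t\<in>Poly_Mapping.keys g.
      Poly_Mapping.single (s + t) (?l f s * ?l g t))"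
    by (subst ex[of f], subst ex[of g]) (simp add: sum_product mult_single)
  then have "rat_mpoly (f * g) = (\<Sum>s\<in>Poly_Mapping.keys f. \<Sum>t\<in>Poly_Mapping.keys g.
      Poly_Mapping.single s (of_int (?l f s)) * Poly_Mapping.single t (of_int (?l g t)))"
    by (simp add: add single mult_single)
  also have "\<dots> = rat_mpoly f * rat_mpoly g"
    by (subst (3) ex[of f], subst (3) ex[of g]) (simp add: add single sum_product)
  finally show ?thesis .
qed

lemma no_common_factor_of_relatively_prime:
  assumes "relatively_prime_over_rat k m F" shows "\<not> has_common_factor k {..<m} F"
proof
  assume "has_common_factor k {..<m} F"
  then obtain g where g: "g \<in> mpolys k" "\<not> mconst g"
    "\<forall>i\<in>{..<m}. \<exists>N q. N \<noteq> 0 \<and> q \<in> mpolys k \<and> of_int N * F i = g * q"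
    unfolding has_common_factor_def by (elim bexE conjE) (rule that; assumption)
  have mem: "rat_mpoly p \<in> mpolys k" if "p \<in> mpolys k" for p
    using that by (simp add: mpolys_def keys_rat_mpoly)
  have dvd: "\<exists>h\<in>mpolys k. rat_mpoly (F i) = rat_mpoly g * h" if "i < m" for i
  proof -
    obtain N q where N: "N \<noteq> 0" "q \<in> mpolys k" "of_int N * F i = g * q"
      using bspec[OF g(3), of i] \<open>i < m\<close> by auto
    define c where "c = (Poly_Mapping.single 0 (1 / of_int N) :: rat mpoly)"
    have "rat_mpoly (of_int N) = Poly_Mapping.single 0 (of_int N)"
      by (rule poly_mapping_eqI) (simp add: lookup_rat_mpoly lookup_of_int lookup_single when_def)
    then have c1: "c * rat_mpoly (of_int N) = 1" using N(1) by (simp add: c_def mult_single del: single_of_int)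
    have eq: "rat_mpoly (of_int N) * rat_mpoly (F i) = rat_mpoly g * rat_mpoly q"
      unfolding rat_mpoly_mult[symmetric] N(3) ..
    have "rat_mpoly (F i) = c * rat_mpoly (of_int N) * rat_mpoly (F i)" by (simp only: c1 mult_1)
    also have "\<dots> = c * (rat_mpoly g * rat_mpoly q)" by (simp only: mult.assoc eq)
    also have "\<dots> = rat_mpoly g * (c * rat_mpoly q)" by (simp only: ac_simps)
    finally have "rat_mpoly (F i) = rat_mpoly g * (c * rat_mpoly q)" .
    moreover have "Poly_Mapping.keys (c * rat_mpoly q) \<subseteq> Poly_Mapping.keys q"
      using keys_mult[of c "rat_mpoly q"] by (auto simp: c_def keys_rat_mpoly split: if_splits)
    then have "c * rat_mpoly q \<in> mpolys k" using N(2) by (auto simp: mpolys_def)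
    ultimately show ?thesis by (rule rev_bexI[rotated])
  qed
  have nc: "\<not> mconst (rat_mpoly g)" using g(2) by (simp add: mconst_def keys_rat_mpoly)
  have "\<exists>g\<in>mpolys k. \<not> mconst g \<and> (\<forall>i<m. \<exists>h\<in>mpolys k. rat_mpoly (F i) = g * h)"
    by (rule bexI[OF _ mem[OF g(1)]]) (intro conjI nc allI impI dvd)
  then show False using assms unfolding relatively_prime_over_rat_def by (rule notE[rotated])
qed

text \<open>Property P enters only through this lemma: at (1, ..., 1) the leading form is a nonempty
  sum of positive coefficients.\<close>

lemma top_at_ones_pos:
  assumes "\<And>t. t \<in> Poly_Mapping.keys f \<Longrightarrow> monom_deg t = total_deg f \<Longrightarrow> Poly_Mapping.lookup f t > 0"
    and "f \<noteq> 0"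
  shows "top_at f (\<lambda>_. 1) > 0"
proof -
  have "total_deg f \<in> monom_deg ` Poly_Mapping.keys f"
    unfolding total_deg_def using assms(2) Max_in[of "monom_deg ` Poly_Mapping.keys f"] by simp
  then have "{t\<in>Poly_Mapping.keys f. monom_deg t = total_deg f} \<noteq> {}" by auto
  then show ?thesis unfolding top_at_def monom_eval_def
    by (intro sum_pos) (use assms(1) in auto)
qed

text \<open>The shift by the last variable gives \<open>F 0\<close> the constant leading coefficient
  \<open>c0\<close>. Without an eliminant of the whole family the shifted system would have a common
  factor, and the inverse shift would carry it back to \<open>F\<close>;
  \<open>elimination_by_combination\<close> then passes to two polynomials.\<close>

theorem exists_eliminant:
  fixes F :: "nat \<Rightarrow> int mpoly"
  assumes k: "k \<ge> 1" and m: "m \<ge> 1" and F: "\<And>i. i < m \<Longrightarrow> F i \<in> mpolys (Suc k)"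
    and P: "property_P m F" and F0: "\<not> mconst (F 0)" and rp: "relatively_prime_over_rat (Suc k) m F"
  defines "s \<equiv> \<lambda>j. if j < k then mvar j + mvar k else mvar j"
  shows "\<exists>(w :: nat \<Rightarrow> int) U V R. R \<in> mpolys k \<and> R \<noteq> 0 \<and>
    U * mev (F 0) s + V * mev (\<Sum>i<m. of_int (w i) * F i) s = R"
proof -
  have F00: "F 0 \<noteq> 0" using F0 by (auto simp: mconst_def)
  define c0 where "c0 = top_at (F 0) (\<lambda>_. 1)"
  have c0: "c0 > 0" unfolding c0_def
    by (rule top_at_ones_pos[OF _ F00]) (use P m in \<open>auto simp: property_P_def\<close>)
  define s' where "s' j = (if j < k then mvar j - mvar k else mvar j)" for j
  have sk: "s j \<in> mpolys (Suc k)" "s' j \<in> mpolys (Suc k)" if "j < Suc k" for j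
    using that by (auto simp: s_def s'_def intro!: subringD(4,5)[OF subring_mpolys] mvar_in_mpolys)
  have inv: "mev (s j) s' = mvar j" "mev (s' j) s = mvar j" for j
    by (auto simp: s_def s'_def mev_add mev_diff)
  have Fs: "mev (F i) s \<in> mpolys (Suc k)" if "i < m" for i
    by (rule subring_mev[OF subring_mpolys F[OF that] sk(1)])
  have uF: "uni k (mev (F 0) s) = mev (F 0) (\<lambda>j. [:if j < k then mvar j else 0, of_int 1:])"
  proof -
    have "uni k (mev (F 0) s) = mev (F 0) (\<lambda>j. uni k (s j))" by (rule is_hom_mev[OF is_hom_uni])
    also have "\<dots> = mev (F 0) (\<lambda>j. [:if j < k then mvar j else 0, of_int 1:])"
    proof (rule mev_cong[OF F])
      show "uni k (s j) = [:if j < k then mvar j else 0, of_int 1:]" if "j < Suc k" for j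
        using that by (auto simp: s_def is_homD(3)[OF is_hom_uni]) (auto simp: uni_def less_Suc_eq)
    qed (use m in simp)
    finally show ?thesis .
  qed
  have "degree (uni k (mev (F 0) s)) \<le> total_deg (F 0)"
    "coeff (uni k (mev (F 0) s)) (total_deg (F 0)) = of_int c0"
    unfolding uF using mev_linear[of "F 0" "\<lambda>j. if j < k then mvar j else 0" "\<lambda>_. 1"]
    by (auto simp: c0_def)
  then have lc: "lead_coeff (uni k (mev (F 0) s)) = of_int c0"
    using c0 by (metis le_antisym le_degree of_int_eq_0_iff less_irrefl)
  then have Fs0: "mev (F 0) s \<noteq> 0" using c0 by (auto simp: uni_def)
  have "\<not> has_common_factor (Suc k) {..<m} F" by (rule no_common_factor_of_relatively_prime[OF rp])
  then have nc: "\<not> has_common_factor (Suc k) {..<m} (\<lambda>i. mev (F i) s)"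
    using has_common_factor_substitution[of "Suc k" s s' "{..<m}" F] sk inv F by auto
  have "\<exists>U R. R \<in> mpolys k \<and> R \<noteq> 0 \<and> (\<Sum>i<m. U i * mev (F i) s) = R"
  proof (rule ccontr)
    assume "\<not> ?thesis"
    with elimination_or_common_divisor[of "{..<m}" 0 "\<lambda>i. mev (F i) s" k] Fs0 Fs m
    obtain h where h: "h \<in> poly_over (mpolys k)" "degree h > 0"
      "\<forall>i\<in>{..<m}. \<exists>e q. q \<in> poly_over (mpolys k) \<and> smult (lead_coeff h ^ e) (uni k (mev (F i) s)) = q * h"
      by auto
    have "has_common_factor (Suc k) {..<m} (\<lambda>i. mev (F i) s)"
      by (rule common_factor_of_elimination_failure[OF k h(1,2), where ?i0.0 = 0 and ?c0.0 = c0])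
        (use h(3) Fs lc c0 m in auto)
    with nc show False ..
  qed
  then obtain U R where UR: "R \<in> mpolys k" "R \<noteq> 0" "(\<Sum>i<m. U i * mev (F i) s) = R"
    by (elim exE conjE) (rule that; assumption)
  have "mev (\<Sum>i<m. of_int (w i) * F i) s = (\<Sum>i<m. of_int (w i) * mev (F i) s)" for w :: "nat \<Rightarrow> int"
    by (simp add: mev_sum mev_mult)
  then show ?thesis
    using elimination_by_combination[of m "\<lambda>i. mev (F i) s" k c0, OF m Fs lc _ UR(3,1,2)] c0 by auto
qed

subsection \<open>Sums over sets of primes\<close>

lemma harm_le: "n \<ge> 1 \<Longrightarrow> harm n \<le> 1 + ln (real n)"
proof (induction n rule: dec_induct)
  case (step n)
  have "ln (real n) - ln (real (Suc n)) \<le> (real n - real (Suc n)) / real (Suc n)"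
    using step by (intro ln_diff_le) auto
  also have "\<dots> = - inverse (real (Suc n))" by (simp add: field_simps)
  finally show ?case using step by (simp add: harm_Suc)
qed (simp add: harm_def)

lemma prime_nat_bounds:
  fixes p :: nat
  assumes "prime p"
  shows "Suc 0 \<le> p" "Suc 0 < p" "0 < p" "0 \<le> ln (real p)" "real p \<ge> 1" "real p > 0" "real p \<ge> 2"
  using prime_ge_2_nat[OF assms] by auto

lemma prod_primes_ge_1:
  fixes M :: "nat set"
  assumes "\<And>p. p \<in> M \<Longrightarrow> prime p" shows "\<Prod>M \<ge> 1"
  by (rule prod_ge_1) (use assms in \<open>auto simp: prime_nat_bounds\<close>)

lemma ln_ge_two_thirds: "x \<ge> 2 \<Longrightarrow> ln x \<ge> (2/3 :: real)"
  using ln2_ge_two_thirds ln_le_cancel_iff[of 2 x] by linarith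

definition primes_upto :: "real \<Rightarrow> nat set" where
  "primes_upto x = {p. prime p \<and> real p \<le> x}"

lemma finite_primes_upto [simp]: "finite (primes_upto x)"
proof (rule finite_subset)
  show "primes_upto x \<subseteq> {..nat \<lfloor>x\<rfloor>}"
    by (auto simp: primes_upto_def le_nat_floor)
qed simp

lemma sum_ln_prime_factors_le:
  assumes "N \<ge> 1" shows "(\<Sum>p\<in>prime_factors N. ln (real p)) \<le> ln (real N)"
proof -
  have p: "real p > 0" if "p \<in> prime_factors N" for p
    using that prime_gt_0_nat by (simp add: in_prime_factors_imp_prime)
  have "(\<Prod>p\<in>prime_factors N. p) \<le> (\<Prod>p\<in>prime_factors N. p ^ multiplicity p N)"
  proof (rule prod_mono, safe)
    fix p assume p: "p \<in> prime_factors N"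
    then have "p \<ge> 1" "multiplicity p N \<ge> 1"
      by (auto simp: prime_factors_multiplicity prime_nat_bounds Suc_leI)
    then show "p \<le> p ^ multiplicity p N" using power_increasing[of 1 "multiplicity p N" p] by simp
  qed
  also have "\<dots> = N" using prod_prime_factors[of N] assms by simp
  finally have "real (\<Prod>p\<in>prime_factors N. p) \<le> real N" by (rule of_nat_mono)
  then have "(\<Prod>p\<in>prime_factors N. real p) \<le> real N" by simp
  moreover have "(\<Prod>p\<in>prime_factors N. real p) > 0" by (intro prod_pos) (use p in auto)
  ultimately have "ln (\<Prod>p\<in>prime_factors N. real p) \<le> ln (real N)" by simp
  then show ?thesis by (subst (asm) ln_prod) (use p in auto)
qed

text \<open>
  Multiplying \<open>\<Sum>p. ln p / p\<close> by \<open>harm n\<close> and collecting the terms with the same product of indices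
  bounds it by \<open>\<Sum>N\<le>n\<^sup>2. ln N / N\<close>, without any estimate for the number of primes.
\<close>

lemma sum_ln_over_primes_nat:
  fixes n :: nat
  assumes n: "n \<ge> 2"
  shows "(\<Sum>p | prime p \<and> p \<le> n. ln (real p) / real p) \<le> 7 * ln (real n)"
proof -
  define P where "P = {p. prime p \<and> p \<le> n}"
  have P: "finite P" unfolding P_def by (rule finite_subset[of _ "{..n}"]) auto
  define S where "S = (\<Sum>p\<in>P. ln (real p) / real p)"
  define g :: "nat \<times> nat \<Rightarrow> nat" where "g = (\<lambda>(p, k). p * k)"
  define h :: "nat \<times> nat \<Rightarrow> real" where "h = (\<lambda>(p, k). ln (real p) / real (p * k))"
  have ln2: "ln (real n) \<ge> 2/3" using ln_ge_two_thirds[of "real n"] n by simp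
  have "S * harm n = (\<Sum>p\<in>P. \<Sum>k\<in>{1..n}. h (p, k))"
    by (simp add: S_def harm_def sum_product h_def field_simps)
  also have "\<dots> = (\<Sum>x\<in>P \<times> {1..n}. h x)" by (simp add: sum.cartesian_product)
  also have "\<dots> = (\<Sum>N\<in>{1..n\<^sup>2}. \<Sum>x\<in>{x \<in> P \<times> {1..n}. g x = N}. h x)"
  proof (rule sum.group[symmetric])
    show "g ` (P \<times> {1..n}) \<subseteq> {1..n\<^sup>2}"
      by (auto simp: g_def P_def power2_eq_square prime_nat_bounds Suc_leI intro!: mult_le_mono)
  qed (use P in auto)
  also have "\<dots> \<le> (\<Sum>N\<in>{1..n\<^sup>2}. ln (real (n\<^sup>2)) * inverse (real N))"
  proof (rule sum_mono)
    fix N assume N: "N \<in> {1..n\<^sup>2}"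
    let ?A = "{x \<in> P \<times> {1..n}. g x = N}"
    \<comment> \<open>For fixed \<open>N = p * k\<close> the prime determines \<open>k\<close>, so
      the terms with product \<open>N\<close> are indexed by distinct prime factors of
      \<open>N\<close>.\<close>
    have inj: "inj_on fst ?A" by (auto simp: inj_on_def g_def P_def)
    have "(\<Sum>x\<in>?A. h x) = (\<Sum>x\<in>?A. ln (real (fst x)) / real N)"
      by (rule sum.cong) (auto simp: h_def g_def)
    also have "\<dots> = (\<Sum>p\<in>fst ` ?A. ln (real p) / real N)" by (rule sum.reindex_cong[OF inj, symmetric]) auto
    also have "\<dots> \<le> (\<Sum>p\<in>prime_factors N. ln (real p) / real N)"
    proof (rule sum_mono2)
      show "fst ` ?A \<subseteq> prime_factors N"
        using N by (auto simp: g_def P_def prime_factors_dvd)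
      show "0 \<le> ln (real p) / real N" if "p \<in> prime_factors N - fst ` ?A" for p
        using that prime_nat_bounds(4)[OF in_prime_factors_imp_prime[of p N]]
        by (auto intro!: divide_nonneg_nonneg)
    qed simp
    also have "\<dots> = (\<Sum>p\<in>prime_factors N. ln (real p)) / real N" by (simp add: sum_divide_distrib)
    also have "\<dots> \<le> ln (real N) / real N"
      using sum_ln_prime_factors_le[of N] N by (intro divide_right_mono) auto
    also have "\<dots> \<le> ln (real (n\<^sup>2)) * inverse (real N)"
      unfolding divide_inverse by (rule mult_right_mono, subst ln_le_cancel_iff)
       (use N n in \<open>auto simp del: of_nat_power\<close>)
    finally show "(\<Sum>x\<in>?A. h x) \<le> ln (real (n\<^sup>2)) * inverse (real N)" .
  qed
  also have "\<dots> = ln (real (n\<^sup>2)) * harm (n\<^sup>2)" by (simp add: harm_def sum_distrib_left)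
  also have "\<dots> \<le> ln (real (n\<^sup>2)) * (1 + ln (real (n\<^sup>2)))"
    using n by (intro mult_left_mono harm_le) auto
  also have "ln (real (n\<^sup>2)) = 2 * ln (real n)" using n by (simp add: ln_realpow)
  finally have 1: "S * harm n \<le> 2 * ln (real n) * (1 + 2 * ln (real n))" .
  have S0: "S \<ge> 0" unfolding S_def P_def
    by (intro sum_nonneg divide_nonneg_nonneg) (auto simp: prime_nat_bounds)
  have "ln (real n) \<le> ln (real n + 1)" using n by simp
  also have "\<dots> \<le> harm n" by (rule ln_le_harm)
  finally have "ln (real n) \<le> harm n" .
  then have "S * ln (real n) \<le> S * harm n" using S0 by (rule mult_left_mono)
  also note 1
  finally have "S * ln (real n) \<le> (2 * (1 + 2 * ln (real n))) * ln (real n)" by (simp only: ac_simps)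
  then have "S \<le> 2 * (1 + 2 * ln (real n))" by (rule mult_right_le_imp_le) (use ln2 in simp)
  \<comment> \<open>With L = ln n, the inequality 2 + 4 L <= 7 L amounts to L >= 2/3, which holds
    from n = 2 on.\<close>
  also have "\<dots> \<le> 7 * ln (real n)" using ln2 by simp
  finally show ?thesis by (simp add: S_def P_def)
qed

lemma sum_ln_over_primes:
  assumes "x \<ge> 2" shows "(\<Sum>p\<in>primes_upto x. ln (real p) / real p) \<le> 7 * ln x"
proof -
  define n where "n = nat \<lfloor>x\<rfloor>"
  have n: "n \<ge> 2" "real n \<le> x" using assms by (auto simp: n_def le_nat_floor)
  have "primes_upto x = {p. prime p \<and> p \<le> n}"
    using n(2) by (auto simp: primes_upto_def n_def le_nat_floor)
  then have "(\<Sum>p\<in>primes_upto x. ln (real p) / real p) \<le> 7 * ln (real n)"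
    using sum_ln_over_primes_nat[OF n(1)] by simp
  also have "\<dots> \<le> 7 * ln x" using n by simp
  finally show ?thesis .
qed

lemma sum_powr_le:
  fixes \<epsilon> :: real
  assumes \<epsilon>: "\<epsilon> > 0"
  shows "(\<Sum>n\<in>{1..N}. real n powr - (1 + \<epsilon>)) \<le> 1 + 1 / \<epsilon>"
proof (cases "N = 0")
  case False
  then have "N \<ge> 1" by simp
  \<comment> \<open>The induction needs the exact integral of
    \<open>t powr - (1 + \<epsilon>)\<close> from 1 to \<open>N\<close>, not only its limit
    \<open>1 / \<epsilon>\<close>.\<close>
  then have "(\<Sum>n\<in>{1..N}. real n powr - (1 + \<epsilon>)) \<le> 1 + (1 - real N powr - \<epsilon>) / \<epsilon>"
  proof (induction N rule: dec_induct)
    case (step N)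
    define a b where "a = real N" and "b = real (Suc N)"
    have ab: "a > 0" "b = a + 1" using step by (auto simp: a_def b_def)
    have "ln a - ln b \<le> (a - b) / b" using ab by (intro ln_diff_le) auto
    then have "1 / b \<le> ln b - ln a" using ab by (simp add: field_simps)
    then have "1 + \<epsilon> * (1 / b) \<le> 1 + \<epsilon> * (ln b - ln a)"
      using \<epsilon> by (intro add_left_mono mult_left_mono) auto
    also have "\<dots> \<le> exp (\<epsilon> * (ln b - ln a))" by (rule exp_ge_add_one_self)
    also have "\<dots> = a powr - \<epsilon> * b powr \<epsilon>" using ab by (simp add: powr_def algebra_simps flip: exp_add)
    finally have "(1 + \<epsilon> * (1 / b)) * b powr - \<epsilon> \<le> a powr - \<epsilon> * b powr \<epsilon> * b powr - \<epsilon>"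
      by (intro mult_right_mono) auto
    also have "\<dots> = a powr - \<epsilon>" using ab by (simp flip: powr_add add: mult.assoc)
    finally have "b powr - \<epsilon> + \<epsilon> * (b powr - \<epsilon> / b) \<le> a powr - \<epsilon>" by (simp add: algebra_simps)
    moreover have "b powr - \<epsilon> / b = b powr - (1 + \<epsilon>)"
      using ab powr_add[of b "- \<epsilon>" "-1"] by (simp add: powr_minus divide_inverse algebra_simps)
    ultimately have "b powr - (1 + \<epsilon>) \<le> (a powr - \<epsilon> - b powr - \<epsilon>) / \<epsilon>" using \<epsilon> by (simp add: field_simps)
    then show ?case using step.IH \<epsilon> by (simp add: a_def b_def diff_divide_distrib add_divide_distrib)
  qed simp
  also have "\<dots> \<le> 1 + 1 / \<epsilon>" using \<epsilon> by (simp add: divide_right_mono)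
  finally show ?thesis .
qed (use \<epsilon> in simp)

section \<open>Euler products over square-free numbers\<close>

lemma prime_factors_prod_primes:
  fixes M :: "nat set"
  assumes "finite M" "\<And>p. p \<in> M \<Longrightarrow> prime p"
  shows "prime_factors (\<Prod>M) = M"
  using assms
proof (induction M rule: finite_induct)
  case (insert p M)
  have "\<Prod>M \<ge> 1" by (rule prod_primes_ge_1) (use insert in auto)
  then have "\<Prod>M \<noteq> 0" by linarith
  then have "prime_factors (p * \<Prod>M) = prime_factors p \<union> prime_factors (\<Prod>M)"
    using insert by (intro prime_factors_product) (auto simp: prime_nat_bounds)
  then show ?case using insert by (simp add: prime_prime_factors)
qed simp

lemma prod_one_plus:
  fixes f :: "'a \<Rightarrow> 'b::comm_semiring_1"
  assumes "finite A" shows "(\<Prod>x\<in>A. 1 + f x) = (\<Sum>M\<in>Pow A. prod f M)"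
  using prod_add[OF assms, of f "\<lambda>_. 1"] by (simp add: add.commute)

text \<open>Expanded, the product is a sum of \<open>n powr - (1 + \<epsilon>)\<close> over distinct
  square-free n, hence part of the zeta series at \<open>1 + \<epsilon>\<close>.\<close>

lemma prod_one_plus_powr_le:
  fixes \<epsilon> :: real
  assumes \<epsilon>: "\<epsilon> > 0" and P: "finite P" "\<And>p. p \<in> P \<Longrightarrow> prime p"
  shows "(\<Prod>p\<in>P. 1 + real p powr - (1 + \<epsilon>)) \<le> 1 + 1 / \<epsilon>"
proof -
  have pr: "finite M" "\<And>p. p \<in> M \<Longrightarrow> prime p" if "M \<subseteq> P" for M
    using that P finite_subset by auto
  have pos: "\<Prod>M \<ge> (1::nat)" if "M \<subseteq> P" for M
    by (rule prod_primes_ge_1) (rule pr(2)[OF that])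
  have inj: "inj_on (\<lambda>M. \<Prod>M) (Pow P)"
    by (rule inj_on_inverseI[where g = prime_factors]) (use prime_factors_prod_primes pr in auto)
  have "(\<Prod>p\<in>P. 1 + real p powr - (1 + \<epsilon>)) = (\<Sum>M\<in>Pow P. \<Prod>p\<in>M. real p powr - (1 + \<epsilon>))"
    by (rule prod_one_plus[OF P(1)])
  also have "\<dots> = (\<Sum>M\<in>Pow P. real (\<Prod>M) powr - (1 + \<epsilon>))"
    by (intro sum.cong refl) (simp add: prod_powr_distrib)
  also have "\<dots> = (\<Sum>n\<in>(\<lambda>M. \<Prod>M) ` Pow P. real n powr - (1 + \<epsilon>))" by (simp add: sum.reindex[OF inj])
  also have "\<dots> \<le> (\<Sum>n\<in>{1..\<Prod>P}. real n powr - (1 + \<epsilon>))"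
  proof (rule sum_mono2)
    show "(\<lambda>M. \<Prod>M) ` Pow P \<subseteq> {1..\<Prod>P}"
    proof safe
      fix M assume M: "M \<subseteq> P"
      have "\<Prod>M dvd \<Prod>P" by (rule prod_dvd_prod_subset[OF P(1) M])
      then show "\<Prod>M \<in> {1..\<Prod>P}" using pos[OF M] pos[of P] dvd_imp_le[of "\<Prod>M" "\<Prod>P"] by auto
    qed
  qed auto
  also have "\<dots> \<le> 1 + 1 / \<epsilon>" by (rule sum_powr_le[OF \<epsilon>])
  finally show ?thesis .
qed

lemma prod_one_plus_mult_le:
  fixes f :: "'a \<Rightarrow> real"
  assumes "\<And>x. x \<in> A \<Longrightarrow> f x \<ge> 0"
  shows "(\<Prod>x\<in>A. 1 + real C * f x) \<le> (\<Prod>x\<in>A. 1 + f x) ^ C"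
proof -
  have "(\<Prod>x\<in>A. 1 + real C * f x) \<le> (\<Prod>x\<in>A. (1 + f x) ^ C)"
    using assms by (intro prod_mono conjI Bernoulli_inequality add_nonneg_nonneg mult_nonneg_nonneg)
      (auto intro: order_trans[of _ 0])
  then show ?thesis by (simp add: prod_power_distrib)
qed

text \<open>Compares \<open>1 / p\<close> with \<open>p powr - s\<close> at \<open>s = 1 + 1 / ln x\<close>.\<close>

lemma prod_one_plus_inverse_primes_le:
  assumes "x \<ge> 2"
  shows "(\<Prod>p\<in>primes_upto x. 1 + 1 / real p) \<le> exp 14 * (1 + ln x)"
proof -
  define \<epsilon> where "\<epsilon> = 1 / ln x"
  have lx: "ln x > 0" and \<epsilon>: "\<epsilon> > 0" using assms by (auto simp: \<epsilon>_def)
  have "(\<Prod>p\<in>primes_upto x. 1 + 1 / real p) \<le>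
      (\<Prod>p\<in>primes_upto x. (1 + real p powr - (1 + \<epsilon>)) * exp (2 * \<epsilon> * (ln (real p) / real p)))"
  proof (rule prod_mono, safe)
    fix p assume "p \<in> primes_upto x"
    then have p: "real p \<ge> 2" "real p \<le> x" by (auto simp: primes_upto_def dest: prime_ge_2_nat)
    define t where "t = \<epsilon> * ln (real p)"
    have t: "0 \<le> t" "t \<le> 1" using p lx by (auto simp: t_def \<epsilon>_def field_simps)
    have "exp t \<le> 1 + t + t\<^sup>2" by (rule exp_bound[OF t])
    also have "\<dots> \<le> 1 + 2 * t" using t by (simp add: power2_eq_square mult_left_le)
    finally have e: "exp t \<le> 1 + 2 * t" .
    have "1 / real p = real p powr - (1 + \<epsilon>) * exp t"
      using p by (simp add: t_def powr_def algebra_simps flip: exp_add) (simp add: exp_minus inverse_eq_divide)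
    also have "\<dots> \<le> real p powr - (1 + \<epsilon>) * (1 + 2 * t)" using e by (intro mult_left_mono) auto
    also have "\<dots> = real p powr - (1 + \<epsilon>) + 2 * t * real p powr - (1 + \<epsilon>)" by (simp add: algebra_simps)
    also have "\<dots> \<le> real p powr - (1 + \<epsilon>) + 2 * t * real p powr - 1"
      using p t \<epsilon> by (intro add_left_mono mult_left_mono powr_mono) auto
    also have "2 * t * real p powr - 1 = 2 * \<epsilon> * (ln (real p) / real p)"
      using p by (simp add: t_def powr_minus divide_inverse)
    finally have "1 + 1 / real p \<le> 1 + (real p powr - (1 + \<epsilon>) + 2 * \<epsilon> * (ln (real p) / real p))"
      by simp
    also have "\<dots> \<le> (1 + real p powr - (1 + \<epsilon>)) * (1 + 2 * \<epsilon> * (ln (real p) / real p))"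
    proof -
      have "0 \<le> real p powr - (1 + \<epsilon>) * (2 * \<epsilon> * (ln (real p) / real p))"
        using p \<epsilon> by (intro mult_nonneg_nonneg) auto
      then show ?thesis by (simp only: distrib_left distrib_right mult_1 mult_1_right)
    qed
    also have "\<dots> \<le> (1 + real p powr - (1 + \<epsilon>)) * exp (2 * \<epsilon> * (ln (real p) / real p))"
      by (intro mult_left_mono exp_ge_add_one_self) (auto simp: add_nonneg_nonneg)
    finally show "1 + 1 / real p \<le> (1 + real p powr - (1 + \<epsilon>)) * exp (2 * \<epsilon> * (ln (real p) / real p))" .
  qed (simp add: add_nonneg_nonneg)
  also have "\<dots> = (\<Prod>p\<in>primes_upto x. 1 + real p powr - (1 + \<epsilon>)) *
      exp (2 * \<epsilon> * (\<Sum>p\<in>primes_upto x. ln (real p) / real p))"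
    by (simp add: prod.distrib exp_sum sum_distrib_left)
  \<comment> \<open>As \<open>\<epsilon> * ln x = 1\<close>, passing from \<open>1 / p\<close> to
    \<open>p powr - (1 + \<epsilon>)\<close> costs the constant factor
    \<open>exp 14\<close>.\<close>
  also have "\<dots> \<le> (1 + 1 / \<epsilon>) * exp (2 * \<epsilon> * (7 * ln x))"
    using sum_ln_over_primes[OF assms] \<epsilon>
    by (intro mult_mono prod_one_plus_powr_le prod_nonneg finite_primes_upto)
      (auto simp: add_nonneg_nonneg primes_upto_def)
  also have "\<dots> = exp 14 * (1 + ln x)" using lx by (simp add: \<epsilon>_def)
  finally show ?thesis .
qed

text \<open>An upper Mertens estimate: the sum over square-free numbers with prime factors up to
  \<open>x\<close> is an Euler product with factors \<open>1 + C / p\<close>. The 3 in the constant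
  comes from \<open>1 + ln x \<le> 3 * ln x\<close>, that is, from
  \<open>1/2 \<le> ln x\<close>.\<close>

lemma sum_prime_sets_le:
  "\<exists>K>0. \<forall>x\<ge>2. (\<Sum>M\<in>Pow (primes_upto x). \<Prod>p\<in>M. real C / real p) \<le> K * ln x ^ C"
proof (intro exI[of _ "(exp 14 * 3) ^ C"] conjI allI impI)
  fix x :: real assume x: "x \<ge> 2"
  have "1/2 \<le> ln x" using ln_ge_two_thirds[OF x] by simp
  have "(\<Sum>M\<in>Pow (primes_upto x). \<Prod>p\<in>M. real C / real p) = (\<Prod>p\<in>primes_upto x. 1 + real C * (1 / real p))"
    by (simp add: prod_one_plus)
  also have "\<dots> \<le> (\<Prod>p\<in>primes_upto x. 1 + 1 / real p) ^ C" by (rule prod_one_plus_mult_le) simp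
  also have "\<dots> \<le> (exp 14 * (1 + ln x)) ^ C"
    by (intro power_mono prod_one_plus_inverse_primes_le x prod_nonneg) (simp add: add_nonneg_nonneg)
  also have "\<dots> \<le> (exp 14 * (3 * ln x)) ^ C" using \<open>1/2 \<le> ln x\<close> by (intro power_mono mult_left_mono) auto
  finally show "(\<Sum>M\<in>Pow (primes_upto x). \<Prod>p\<in>M. real C / real p) \<le> (exp 14 * 3) ^ C * ln x ^ C"
    by (simp add: power_mult_distrib mult.assoc)
qed simp

section \<open>Logarithmic averages over square-free numbers\<close>

definition small_prime_sets :: "real \<Rightarrow> nat set set" where
  "small_prime_sets x = {M. finite M \<and> (\<forall>p\<in>M. prime p) \<and> real (\<Prod>M) \<le> x}"

lemma small_prime_setsD:
  assumes "M \<in> small_prime_sets x"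
  shows "finite M" "\<And>p. p \<in> M \<Longrightarrow> prime p" "real (\<Prod>M) \<le> x" "M \<subseteq> primes_upto x" "\<Prod>M \<ge> 1"
proof -
  show M: "finite M" "\<And>p. p \<in> M \<Longrightarrow> prime p" "real (\<Prod>M) \<le> x"
    using assms by (auto simp: small_prime_sets_def)
  show 1: "\<Prod>M \<ge> 1" using M(2) by (rule prod_primes_ge_1)
  show "M \<subseteq> primes_upto x"
  proof
    fix p assume p: "p \<in> M"
    then have "p dvd \<Prod>M" using M(1) by (rule dvd_prodI[rotated])
    then have "p \<le> \<Prod>M" using 1 by (intro dvd_imp_le) auto
    then have "real p \<le> real (\<Prod>M)" by (rule of_nat_mono)
    with M(3) have "real p \<le> x" by linarith
    with M(2)[OF p] show "p \<in> primes_upto x" by (simp add: primes_upto_def)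
  qed
qed

lemma finite_small_prime_sets [simp]: "finite (small_prime_sets x)"
  by (rule finite_subset[of _ "Pow (primes_upto x)"]) (use small_prime_setsD(4) in auto)

lemma sum_small_prime_sets_le:
  "\<exists>K>0. \<forall>x\<ge>2. (\<Sum>M\<in>small_prime_sets x. \<Prod>p\<in>M. real C / real p) \<le> K * ln x ^ C"
proof -
  obtain K where K: "K > 0" "\<And>x. x \<ge> 2 \<Longrightarrow> (\<Sum>M\<in>Pow (primes_upto x). \<Prod>p\<in>M. real C / real p) \<le> K * ln x ^ C"
    using sum_prime_sets_le by blast
  have "(\<Sum>M\<in>small_prime_sets x. \<Prod>p\<in>M. real C / real p) \<le> (\<Sum>M\<in>Pow (primes_upto x). \<Prod>p\<in>M. real C / real p)" for x
    by (rule sum_mono2) (auto intro!: prod_nonneg dest: small_prime_setsD(4))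
  with K show ?thesis by (intro exI[of _ K]) (auto intro: order_trans)
qed

text \<open>With n the product of \<open>M\<close>, \<open>ln n\<close> is split into the
  contributions of its primes. Removing \<open>p\<close> from \<open>M\<close> costs the factor
  \<open>C / p\<close>, so on average \<open>ln n\<close> is at most the sum of
  \<open>C * ln p / p\<close> over the primes below \<open>P\<close>, which is O(ln P).\<close>

lemma sum_smooth_log_le:
  assumes "C \<ge> 1"
  shows "\<exists>K>0. \<forall>P. prime P \<longrightarrow> (\<Sum>M\<in>Pow {p. prime p \<and> p < P}. (\<Prod>p\<in>M. real C / real p) *
    (1 + (\<Sum>p\<in>M. ln (real p)) / ln (real P))) \<le> K * ln (real P) ^ C"
proof -
  obtain K where K: "K > 0" "\<And>x. x \<ge> 2 \<Longrightarrow> (\<Sum>M\<in>Pow (primes_upto x). \<Prod>p\<in>M. real C / real p) \<le> K * ln x ^ C"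
    using sum_prime_sets_le by blast
  show ?thesis
  proof (intro exI[of _ "K * (1 + 7 * real C)"] conjI allI impI)
    fix P :: nat assume P: "prime P"
    then have P2: "real P \<ge> 2" using prime_ge_2_nat[OF P] by simp
    then have lP: "ln (real P) > 0" by simp
    define Q where "Q = {p. prime p \<and> p < P}"
    have Q: "finite Q" "Q \<subseteq> primes_upto (real P)"
      unfolding Q_def primes_upto_def by (auto intro: finite_subset[of _ "{..P}"])
    define w where "w M = (\<Prod>p\<in>M. real C / real p)" for M
    have w0: "w M \<ge> 0" for M unfolding w_def by (intro prod_nonneg) auto
    define V where "V = (\<Sum>M\<in>Pow Q. w M)"
    have "V \<le> (\<Sum>M\<in>Pow (primes_upto (real P)). w M)" unfolding V_def
      by (rule sum_mono2) (use Q w0 in auto)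
    also have "\<dots> \<le> K * ln (real P) ^ C" using K(2)[OF P2] by (simp add: w_def)
    finally have V: "V \<le> K * ln (real P) ^ C" .
    have V0: "V \<ge> 0" unfolding V_def by (intro sum_nonneg w0)
    have "(\<Sum>M\<in>Pow Q. w M * (\<Sum>p\<in>M. ln (real p))) = (\<Sum>M\<in>Pow Q. \<Sum>p\<in>Q. if p \<in> M then w M * ln (real p) else 0)"
    proof (rule sum.cong)
      fix M assume "M \<in> Pow Q"
      then have "Q \<inter> M = M" by auto
      then show "w M * (\<Sum>p\<in>M. ln (real p)) = (\<Sum>p\<in>Q. if p \<in> M then w M * ln (real p) else 0)"
        using Q(1) by (simp add: sum_distrib_left flip: sum.inter_restrict)
    qed simp
    also have "\<dots> = (\<Sum>p\<in>Q. \<Sum>M\<in>Pow Q. if p \<in> M then w M * ln (real p) else 0)" by (rule sum.swap)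
    also have "\<dots> \<le> (\<Sum>p\<in>Q. (real C * V) * (ln (real p) / real p))"
    proof (rule sum_mono)
      fix p assume p: "p \<in> Q"
      then have lp: "ln (real p) \<ge> 0" by (auto simp: Q_def prime_nat_bounds)
      have "(\<Sum>M\<in>Pow Q. if p \<in> M then w M * ln (real p) else 0) = (\<Sum>M\<in>{M\<in>Pow Q. p \<in> M}. w M * ln (real p))"
        by (rule sum.inter_filter[symmetric]) (use Q(1) in simp)
      also have "\<dots> = (\<Sum>M\<in>Pow (Q - {p}). w (insert p M) * ln (real p))"
        by (rule sum.reindex_bij_witness[where j = "\<lambda>M. M - {p}" and i = "insert p"])
          (use p in \<open>auto simp: insert_absorb\<close>)
      also have "\<dots> = (\<Sum>M\<in>Pow (Q - {p}). w M * (real C * (ln (real p) / real p)))"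
      proof (rule sum.cong)
        fix M assume "M \<in> Pow (Q - {p})"
        then have "finite M" "p \<notin> M" using Q(1) finite_subset by auto
        then show "w (insert p M) * ln (real p) = w M * (real C * (ln (real p) / real p))"
          by (simp add: w_def)
      qed simp
      also have "\<dots> \<le> (\<Sum>M\<in>Pow Q. w M * (real C * (ln (real p) / real p)))"
        by (rule sum_mono2) (use Q(1) w0 lp in \<open>auto intro!: mult_nonneg_nonneg\<close>)
      also have "\<dots> = V * (real C * (ln (real p) / real p))" unfolding V_def by (rule sum_distrib_right[symmetric])
      also have "\<dots> = (real C * V) * (ln (real p) / real p)" by simp
      finally show "(\<Sum>M\<in>Pow Q. if p \<in> M then w M * ln (real p) else 0) \<le> (real C * V) * (ln (real p) / real p)" .
    qed
    also have "\<dots> = (real C * V) * (\<Sum>p\<in>Q. ln (real p) / real p)" by (simp add: sum_distrib_left)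
    also have "\<dots> \<le> (real C * V) * (7 * ln (real P))"
    proof (rule mult_left_mono)
      have "(\<Sum>p\<in>Q. ln (real p) / real p) \<le> (\<Sum>p\<in>primes_upto (real P). ln (real p) / real p)"
        by (rule sum_mono2) (use Q in \<open>auto simp: primes_upto_def prime_nat_bounds intro!: divide_nonneg_nonneg\<close>)
      also have "\<dots> \<le> 7 * ln (real P)" by (rule sum_ln_over_primes[OF P2])
      finally show "(\<Sum>p\<in>Q. ln (real p) / real p) \<le> 7 * ln (real P)" .
    qed (use V0 in auto)
    finally have L: "(\<Sum>M\<in>Pow Q. w M * (\<Sum>p\<in>M. ln (real p))) \<le> (real C * V) * (7 * ln (real P))" .
    have "(\<Sum>M\<in>Pow Q. w M * (1 + (\<Sum>p\<in>M. ln (real p)) / ln (real P))) =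
        V + (\<Sum>M\<in>Pow Q. w M * (\<Sum>p\<in>M. ln (real p))) / ln (real P)"
      unfolding V_def distrib_left mult_1_right times_divide_eq_right sum.distrib
        sum_divide_distrib[symmetric] ..
    also have "\<dots> \<le> V + (real C * V) * (7 * ln (real P)) / ln (real P)"
      using L lP by (intro add_left_mono divide_right_mono) auto
    also have "\<dots> = V * (1 + 7 * real C)" using lP by (simp add: algebra_simps)
    also have "\<dots> \<le> K * ln (real P) ^ C * (1 + 7 * real C)" using V by (intro mult_right_mono) auto
    finally show "(\<Sum>M\<in>Pow {p. prime p \<and> p < P}. (\<Prod>p\<in>M. real C / real p) *
        (1 + (\<Sum>p\<in>M. ln (real p)) / ln (real P))) \<le> K * (1 + 7 * real C) * ln (real P) ^ C"
      by (simp add: w_def Q_def mult_ac)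
  qed (use K in auto)
qed

text \<open>With \<open>P\<close> the largest prime of \<open>M\<close>, the ratio is 1 + ln n' / ln
  P, where n' is composed of primes below \<open>P\<close>; of the bound on the product only
  \<open>P \<le> x\<close> is retained. The sum over n' is O((ln P)^C). One of these factors
  \<open>ln P\<close> is summed together with \<open>1 / P\<close> and gives O(ln x), so the
  exponent \<open>C\<close> is not exceeded.\<close>

lemma sum_log_ratio_le:
  assumes C: "C \<ge> 1"
  shows "\<exists>K>0. \<forall>x\<ge>2. (\<Sum>M\<in>small_prime_sets x - {{}}. (\<Prod>p\<in>M. real C / real p) *
    (ln (real (\<Prod>M)) / ln (real (Max M)))) \<le> K * ln x ^ C"
proof -
  obtain K where K: "K > 0" "\<And>P. prime P \<Longrightarrow> (\<Sum>M\<in>Pow {p. prime p \<and> p < P}. (\<Prod>p\<in>M. real C / real p) *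
    (1 + (\<Sum>p\<in>M. ln (real p)) / ln (real P))) \<le> K * ln (real P) ^ C"
    using sum_smooth_log_le[OF C] by blast
  define g where "g M = (\<Prod>p\<in>M. real C / real p) * (ln (real (\<Prod>M)) / ln (real (Max M)))" for M :: "nat set"
  show ?thesis
  proof (intro exI[of _ "7 * real C * K"] conjI allI impI)
    fix x :: real assume x: "x \<ge> 2"
    define Q where "Q P = {p. prime p \<and> p < P}" for P :: nat
    have Q: "finite (Q P)" for P unfolding Q_def by (auto intro: finite_subset[of _ "{..P}"])
    define h where "h M = (Max M, M - {Max M})" for M :: "nat set"
    have M: "finite M" "Max M \<in> M" "M \<subseteq> primes_upto x" if "M \<in> small_prime_sets x - {{}}" for M
      using that small_prime_setsD[of M x] Max_in[of M] by auto
    have inj: "inj_on h (small_prime_sets x - {{}})"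
      by (rule inj_on_inverseI[where g = "\<lambda>y. insert (fst y) (snd y)"])
        (use M in \<open>auto simp: h_def insert_absorb\<close>)
    have eq: "g (insert P M) = real C / real P * ((\<Prod>p\<in>M. real C / real p) * (1 + (\<Sum>p\<in>M. ln (real p)) / ln (real P)))"
      if P: "P \<in> primes_upto x" and MQ: "M \<in> Pow (Q P)" for P M
    proof -
      have f: "finite M" "P \<notin> M" using MQ Q finite_subset[of M "Q P"] by (auto simp: Q_def)
      have p0: "real p > 0" if "p \<in> M" for p using that MQ by (auto simp: Q_def prime_nat_bounds)
      have P0: "real P > 1" using P by (auto simp: primes_upto_def prime_nat_bounds)
      have "Max (insert P M) = P"
        by (rule Max_eqI) (use f MQ in \<open>auto simp: Q_def\<close>)
      moreover have "ln (real (\<Prod>(insert P M))) = ln (real P) + (\<Sum>p\<in>M. ln (real p))"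
        using f p0 P0 by (simp add: ln_mult prod_pos) (subst ln_prod, auto)
      ultimately show ?thesis using f P0 by (simp add: g_def add_divide_distrib)
    qed
    have nn: "g (insert P M) \<ge> 0" if "P \<in> primes_upto x" "M \<in> Pow (Q P)" for P M
    proof -
      have "ln (real p) \<ge> 0" if "p \<in> M" for p using that \<open>M \<in> Pow (Q P)\<close> by (auto simp: Q_def prime_nat_bounds)
      moreover have "ln (real P) \<ge> 0" using that by (auto simp: primes_upto_def prime_nat_bounds)
      ultimately show ?thesis unfolding eq[OF that]
        by (intro mult_nonneg_nonneg prod_nonneg add_nonneg_nonneg divide_nonneg_nonneg sum_nonneg) auto
    qed
    have "(\<Sum>M\<in>small_prime_sets x - {{}}. g M) = (\<Sum>M\<in>small_prime_sets x - {{}}. g (insert (fst (h M)) (snd (h M))))"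
      by (rule sum.cong) (use M in \<open>auto simp: h_def insert_absorb\<close>)
    also have "\<dots> = (\<Sum>y\<in>h ` (small_prime_sets x - {{}}). g (insert (fst y) (snd y)))"
      by (simp add: sum.reindex[OF inj])
    also have "\<dots> \<le> (\<Sum>y\<in>Sigma (primes_upto x) (\<lambda>P. Pow (Q P)). g (insert (fst y) (snd y)))"
    proof (rule sum_mono2)
      show "h ` (small_prime_sets x - {{}}) \<subseteq> Sigma (primes_upto x) (\<lambda>P. Pow (Q P))"
      proof
        fix y assume "y \<in> h ` (small_prime_sets x - {{}})"
        then obtain M where y: "y = h M" and Mx: "M \<in> small_prime_sets x - {{}}" by auto
        have "p < Max M" if "p \<in> M - {Max M}" for p
          using that Max_ge[OF M(1)[OF Mx], of p] by auto
        then show "y \<in> Sigma (primes_upto x) (\<lambda>P. Pow (Q P))"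
          using M[OF Mx] by (auto simp: y h_def Q_def primes_upto_def)
      qed
    qed (use Q nn in auto)
    also have "\<dots> = (\<Sum>P\<in>primes_upto x. \<Sum>M\<in>Pow (Q P). g (insert P M))"
      using Q by (subst sum.Sigma) (auto simp: case_prod_beta)
    also have "\<dots> \<le> (\<Sum>P\<in>primes_upto x. (real C * K * ln x ^ (C - 1)) * (ln (real P) / real P))"
    proof (rule sum_mono)
      fix P assume P: "P \<in> primes_upto x"
      then have P': "prime P" "real P \<le> x" "real P \<ge> 1" by (auto simp: primes_upto_def prime_nat_bounds)
      have "(\<Sum>M\<in>Pow (Q P). g (insert P M)) = real C / real P *
          (\<Sum>M\<in>Pow (Q P). (\<Prod>p\<in>M. real C / real p) * (1 + (\<Sum>p\<in>M. ln (real p)) / ln (real P)))"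
        unfolding sum_distrib_left by (rule sum.cong) (use eq[OF P] in auto)
      also have "\<dots> \<le> real C / real P * (K * ln (real P) ^ C)"
        unfolding Q_def by (rule mult_left_mono[OF K(2)[OF P'(1)]]) simp
      also have "ln (real P) ^ C = ln (real P) ^ (C - 1) * ln (real P)"
        using C by (intro power_minus_mult[symmetric]) simp
      also have "real C / real P * (K * (ln (real P) ^ (C - 1) * ln (real P))) =
          (real C * K * ln (real P) ^ (C - 1)) * (ln (real P) / real P)" by simp
      also have "\<dots> \<le> (real C * K * ln x ^ (C - 1)) * (ln (real P) / real P)"
        using P' K by (intro mult_right_mono mult_left_mono power_mono) auto
      finally show "(\<Sum>M\<in>Pow (Q P). g (insert P M)) \<le> (real C * K * ln x ^ (C - 1)) * (ln (real P) / real P)" .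
    qed
    also have "\<dots> = (real C * K * ln x ^ (C - 1)) * (\<Sum>P\<in>primes_upto x. ln (real P) / real P)"
      by (simp add: sum_distrib_left)
    also have "\<dots> \<le> (real C * K * ln x ^ (C - 1)) * (7 * ln x)"
      using x K by (intro mult_left_mono sum_ln_over_primes) auto
    also have "\<dots> = 7 * real C * K * (ln x ^ (C - 1) * ln x)" by simp
    also have "ln x ^ (C - 1) * ln x = ln x ^ C"
      using C by (intro power_minus_mult) simp
    finally show "(\<Sum>M\<in>small_prime_sets x - {{}}. (\<Prod>p\<in>M. real C / real p) *
        (ln (real (\<Prod>M)) / ln (real (Max M)))) \<le> 7 * real C * K * ln x ^ C"
      by (simp add: g_def)
  qed (use K C in auto)
qed

lemma sum_large_prime_sets_le:
  "\<exists>K>0. \<forall>x\<ge>3. \<forall>P. finite P \<longrightarrow> (\<forall>p\<in>P. prime p) \<longrightarrow>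
     (\<Sum>M\<in>{M\<in>Pow P. real (\<Prod>M) > x}. \<Prod>p\<in>M. real C / real p ^ 2) \<le> K * ln x ^ C / x"
proof (intro exI[of _ "exp 1 * 2 ^ C"] conjI allI impI)
  fix x :: real and P :: "nat set"
  assume x: "x \<ge> 3" and P: "finite P" "\<forall>p\<in>P. prime p"
  have lx: "ln x \<ge> 1" using x exp_le by (subst ln_ge_iff) auto
  define \<epsilon> where "\<epsilon> = 1 / ln x"
  have \<epsilon>: "\<epsilon> > 0" "\<epsilon> \<le> 1" using lx by (auto simp: \<epsilon>_def)
  have "(\<Sum>M\<in>{M\<in>Pow P. real (\<Prod>M) > x}. \<Prod>p\<in>M. real C / real p ^ 2) \<le>
      (\<Sum>M\<in>{M\<in>Pow P. real (\<Prod>M) > x}. x powr (\<epsilon> - 1) * (\<Prod>p\<in>M. real C * real p powr - (1 + \<epsilon>)))"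
  proof (rule sum_mono)
    fix M assume "M \<in> {M\<in>Pow P. real (\<Prod>M) > x}"
    then have M: "M \<subseteq> P" "real (\<Prod>M) > x" by auto
    define m where "m = real (\<Prod>M)"
    have m: "m > x" "m > 0" using M x by (auto simp: m_def)
    have "(\<Prod>p\<in>M. real C / real p ^ 2) = real C ^ card M / m ^ 2"
      by (simp add: prod_dividef m_def prod_power_distrib)
    also have "\<dots> = real C ^ card M * (m powr (\<epsilon> - 1) * m powr - (1 + \<epsilon>))"
      using m by (simp add: powr_minus divide_inverse powr_numeral flip: powr_add)
    also have "\<dots> \<le> real C ^ card M * (x powr (\<epsilon> - 1) * m powr - (1 + \<epsilon>))"
      using m x \<epsilon> by (intro mult_left_mono mult_right_mono powr_mono2') auto
    also have "\<dots> = x powr (\<epsilon> - 1) * (\<Prod>p\<in>M. real C * real p powr - (1 + \<epsilon>))"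
      by (simp add: prod.distrib m_def prod_powr_distrib)
    finally show "(\<Prod>p\<in>M. real C / real p ^ 2) \<le> x powr (\<epsilon> - 1) * (\<Prod>p\<in>M. real C * real p powr - (1 + \<epsilon>))" .
  qed
  also have "\<dots> \<le> (\<Sum>M\<in>Pow P. x powr (\<epsilon> - 1) * (\<Prod>p\<in>M. real C * real p powr - (1 + \<epsilon>)))"
    by (rule sum_mono2) (use P in \<open>auto intro!: mult_nonneg_nonneg prod_nonneg\<close>)
  also have "\<dots> = x powr (\<epsilon> - 1) * (\<Prod>p\<in>P. 1 + real C * real p powr - (1 + \<epsilon>))"
    by (simp add: prod_one_plus[OF P(1)] sum_distrib_left)
  also have "\<dots> \<le> x powr (\<epsilon> - 1) * (\<Prod>p\<in>P. 1 + real p powr - (1 + \<epsilon>)) ^ C"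
    by (intro mult_left_mono prod_one_plus_mult_le) auto
  also have "\<dots> \<le> x powr (\<epsilon> - 1) * (1 + 1 / \<epsilon>) ^ C"
    using P \<epsilon> by (intro mult_left_mono power_mono prod_one_plus_powr_le prod_nonneg) (auto simp: add_nonneg_nonneg)
  also have "\<dots> \<le> x powr (\<epsilon> - 1) * (2 * ln x) ^ C"
    using lx by (intro mult_left_mono power_mono) (auto simp: \<epsilon>_def)
  also have "x powr (\<epsilon> - 1) = exp 1 / x"
    using x lx by (simp add: powr_diff) (simp add: powr_def \<epsilon>_def)
  finally show "(\<Sum>M\<in>{M\<in>Pow P. real (\<Prod>M) > x}. \<Prod>p\<in>M. real C / real p ^ 2) \<le> exp 1 * 2 ^ C * ln x ^ C / x"
    by (simp add: power_mult_distrib)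
qed simp

subsection \<open>Plane curves modulo a prime\<close>

text \<open>
  Bivariate polynomials are \<open>int poly poly\<close>; the outer variable is \<open>y\<close>, and \<open>coeff (coeff Q j) i\<close>
  belongs to \<open>x ^ i * y ^ j\<close>.
\<close>

definition total_le :: "nat \<Rightarrow> int poly poly \<Rightarrow> bool" where
  "total_le d Q \<longleftrightarrow> (\<forall>i j. coeff (coeff Q j) i \<noteq> 0 \<longrightarrow> i + j \<le> d)"

definition eval2 :: "int poly poly \<Rightarrow> int \<Rightarrow> int \<Rightarrow> int" where
  "eval2 Q x y = poly (poly Q [:y:]) x"

lemma eval2_simps [simp]:
  "eval2 (P + Q) x y = eval2 P x y + eval2 Q x y" "eval2 (P * Q) x y = eval2 P x y * eval2 Q x y"
  "eval2 (P - Q) x y = eval2 P x y - eval2 Q x y" "eval2 [:[:c:]:] x y = c"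
  "eval2 (sum F I) x y = (\<Sum>i\<in>I. eval2 (F i) x y)" "eval2 (prod F I) x y = (\<Prod>i\<in>I. eval2 (F i) x y)"
  by (simp_all add: eval2_def poly_sum poly_prod)

lemma total_leD: "total_le d Q \<Longrightarrow> d < i + j \<Longrightarrow> coeff (coeff Q j) i = 0"
  unfolding total_le_def by (meson not_less)

lemma total_le_mult:
  assumes "total_le d P" "total_le e Q" shows "total_le (d + e) (P * Q)"
  unfolding total_le_def
proof (intro allI impI)
  fix i j assume "coeff (coeff (P * Q) j) i \<noteq> 0"
  then have "(\<Sum>b\<le>j. \<Sum>a\<le>i. coeff (coeff P b) a * coeff (coeff Q (j - b)) (i - a)) \<noteq> 0"
    by (simp add: coeff_mult coeff_sum)
  then obtain b where b: "b \<le> j" "(\<Sum>a\<le>i. coeff (coeff P b) a * coeff (coeff Q (j - b)) (i - a)) \<noteq> 0"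
    by (metis (no_types, lifting) atMost_iff sum.neutral)
  then obtain a where a: "a \<le> i" "coeff (coeff P b) a * coeff (coeff Q (j - b)) (i - a) \<noteq> 0"
    by (metis (no_types, lifting) atMost_iff sum.neutral)
  then have "coeff (coeff P b) a \<noteq> 0" "coeff (coeff Q (j - b)) (i - a) \<noteq> 0" by auto
  then have "a + b \<le> d" "(i - a) + (j - b) \<le> e" using assms unfolding total_le_def by blast+
  then show "i + j \<le> d + e" using a(1) b(1) by linarith
qed

lemma total_le_mono: "total_le d P \<Longrightarrow> d \<le> e \<Longrightarrow> total_le e P"
  by (meson le_trans total_le_def)

lemma total_le_add: "total_le d P \<Longrightarrow> total_le d Q \<Longrightarrow> total_le d (P + Q)"
  by (auto simp: total_le_def) (metis add.right_neutral)

lemma total_le_0: "total_le d 0"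
  by (simp add: total_le_def)

lemma total_le_sum: "(\<And>i. i \<in> I \<Longrightarrow> total_le d (F i)) \<Longrightarrow> total_le d (sum F I)"
  by (induction I rule: infinite_finite_induct) (simp_all add: total_le_add total_le_0)

lemma total_le_const: "total_le 0 [:[:c:]:]"
  by (auto simp: total_le_def coeff_pCons split: nat.splits)

lemma total_le_1: "total_le 0 1"
  using total_le_const[of 1] by (simp add: one_pCons)

lemma total_le_prod:
  assumes "finite I" "\<And>i. i \<in> I \<Longrightarrow> total_le (d i) (F i)"
  shows "total_le (sum d I) (prod F I)"
  using assms by (induction I rule: finite_induct) (auto intro: total_le_mult total_le_1)

lemma const2_dvd_iff: "[:[:c:]:] dvd Q \<longleftrightarrow> (\<forall>i j. c dvd coeff (coeff Q j) i)" for c :: int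
  by (auto simp: const_poly_dvd_iff)

text \<open>With \<open>H = U * B - V * A\<close> the eliminant gives
  \<open>R * B - f * H = V * (A * f + B * g)\<close>, which vanishes modulo \<open>p\<close>. There
  \<open>f\<close> has degree \<open>d1\<close> in \<open>y\<close> with a unit as leading
  coefficient, while \<open>R * B\<close> has smaller degree in \<open>y\<close>, so
  \<open>H\<close> vanishes. Then \<open>B\<close> vanishes because \<open>R\<close> does not, and
  finally \<open>A\<close>.\<close>

lemma combination_divisible:
  fixes p :: int
  assumes p: "prime p"
    and f: "degree f \<le> d1" "coeff f d1 = [:c0:]" "\<not> p dvd c0"
    and R: "U * f + V * g = [:R:]" "\<not> [:p:] dvd R"
    and B: "\<And>j. j \<ge> d1 \<Longrightarrow> coeff B j = 0"
    and dvd: "[:[:p:]:] dvd A * f + B * g"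
  shows "[:[:p:]:] dvd A \<and> [:[:p:]:] dvd B"
proof -
  let ?l = "[:[:p:]:]"
  have pp: "prime_elem [:p:]" using p by (intro lift_prime_elem_poly prime_imp_prime_elem)
  then have lp: "prime_elem ?l" by (rule lift_prime_elem_poly)
  define H where "H = U * B - V * A"
  have "[:R:] * B - f * H = V * (A * f + B * g)"
    unfolding R(1)[symmetric] H_def by (simp add: algebra_simps)
  then have 1: "?l dvd [:R:] * B - f * H" using dvd by simp
  have "?l dvd H"
  proof (rule ccontr)
    assume "\<not> ?l dvd H"
    define J where "J = {j. \<not> [:p:] dvd coeff H j}"
    have "J \<subseteq> {..degree H}"
    proof
      fix i assume "i \<in> J"
      then have "coeff H i \<noteq> 0" by (auto simp: J_def)
      then show "i \<in> {..degree H}" by (simp add: le_degree)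
    qed
    then have J: "finite J" by (rule finite_subset) simp
    have "J \<noteq> {}" using \<open>\<not> ?l dvd H\<close> unfolding J_def const_poly_dvd_iff[of "[:p:]"] by blast
    \<comment> \<open>The last index at which \<open>H\<close> survives modulo \<open>p\<close>. Up
      to multiples of \<open>[:p:]\<close>, the coefficient of \<open>f * H\<close> at
      \<open>d1 + j\<close> is the product of the one of \<open>f\<close> at \<open>d1\<close> and
      the one of \<open>H\<close> at \<open>j\<close>.\<close>
    define j where "j = Max J"
    have j: "\<not> [:p:] dvd coeff H j" using Max_in[OF J \<open>J \<noteq> {}\<close>] by (simp add: j_def J_def)
    have jmax: "[:p:] dvd coeff H i" if "i > j" for i
      using Max_ge[OF J, of i] that by (fastforce simp: j_def J_def)
    have "coeff (f * H) (d1 + j) = (\<Sum>i\<le>d1 + j. coeff f i * coeff H (d1 + j - i))" by (rule coeff_mult)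
    also have "\<dots> = coeff f d1 * coeff H j + (\<Sum>i\<in>{..d1 + j} - {d1}. coeff f i * coeff H (d1 + j - i))"
      by (subst sum.remove[of _ d1]) auto
    finally have c: "coeff (f * H) (d1 + j) =
        coeff f d1 * coeff H j + (\<Sum>i\<in>{..d1 + j} - {d1}. coeff f i * coeff H (d1 + j - i))" .
    have "[:p:] dvd (\<Sum>i\<in>{..d1 + j} - {d1}. coeff f i * coeff H (d1 + j - i))"
    proof (rule dvd_sum)
      fix i assume i: "i \<in> {..d1 + j} - {d1}"
      show "[:p:] dvd coeff f i * coeff H (d1 + j - i)"
      proof (cases "i < d1")
        case True
        then show ?thesis by (intro dvd_mult jmax) auto
      next
        case False
        then have "degree f < i" using i f(1) by auto
        then show ?thesis by (simp add: coeff_eq_0)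
      qed
    qed
    moreover have "[:p:] dvd coeff (f * H) (d1 + j)"
    proof -
      have "[:p:] dvd coeff ([:R:] * B - f * H) (d1 + j)"
        using 1 unfolding const_poly_dvd_iff[of "[:p:]"] by blast
      then show ?thesis using B[of "d1 + j"] by simp
    qed
    ultimately have "[:p:] dvd coeff f d1 * coeff H j" unfolding c by (simp add: dvd_add_left_iff)
    then have "[:p:] dvd coeff f d1" using j prime_elem_dvd_multD[OF pp] by blast
    then show False using f(2,3) by (simp add: const_poly_dvd_const_poly_iff)
  qed
  then have "?l dvd f * H" by simp
  then have "?l dvd [:R:] * B" using 1 by (metis diff_add_cancel dvd_add)
  moreover have "\<not> ?l dvd [:R:]" using R(2) by (simp add: const_poly_dvd_const_poly_iff)
  ultimately have B': "?l dvd B" using prime_elem_dvd_multD[OF lp] by blast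
  then have "?l dvd A * f" using dvd by (metis dvd_add_left_iff dvd_mult2)
  moreover have "\<not> ?l dvd f"
  proof
    assume "?l dvd f"
    then have "p dvd coeff (coeff f d1) 0" by (simp add: const2_dvd_iff)
    then show False using f(2,3) by simp
  qed
  ultimately have "?l dvd A" using prime_elem_dvd_multD[OF lp] by blast
  with B' show ?thesis by blast
qed

text \<open>Index pairs are ordered as (exponent of \<open>y\<close>, exponent of \<open>x\<close>),
  following the nesting of \<open>coeff (coeff Q j) i\<close>.\<close>

definition bipoly :: "(nat \<times> nat) set \<Rightarrow> (nat \<times> nat \<Rightarrow> int) \<Rightarrow> int poly poly" where
  "bipoly I e = (\<Sum>(j, i)\<in>I. monom (monom (e (j, i)) i) j)"

lemma coeff_bipoly:
  assumes "finite I"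
  shows "coeff (coeff (bipoly I e) j) i = (if (j, i) \<in> I then e (j, i) else 0)"
proof -
  have "coeff (coeff (bipoly I e) j) i = (\<Sum>x\<in>I. coeff (coeff (case x of (b, a) \<Rightarrow> monom (monom (e (b, a)) a) b) j) i)"
    by (simp add: bipoly_def coeff_sum)
  also have "\<dots> = (\<Sum>x\<in>I. if x = (j, i) then e (j, i) else 0)"
    by (rule sum.cong) (auto split: if_splits)
  also have "\<dots> = (if (j, i) \<in> I then e (j, i) else 0)" using assms by simp
  finally show ?thesis .
qed

text \<open>Modulo \<open>p\<close> this vanishes at every point of the grid except
  \<open>s\<close>, where it is a unit. A unit in place of the value 1 avoids inverses modulo
  \<open>p\<close>.\<close>

definition lagrange2 :: "int \<Rightarrow> int \<times> int \<Rightarrow> int poly poly" where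
  "lagrange2 p s = (\<Prod>a\<in>{0..<p} - {fst s}. [:[:- a, 1:]:]) * (\<Prod>b\<in>{0..<p} - {snd s}. [:[:- b:], 1:])"

lemma total_le_lagrange2:
  assumes "p \<ge> 0" shows "total_le (2 * nat p) (lagrange2 p s)"
proof -
  have 1: "total_le 1 [:[:- a, 1:]:]" "total_le 1 [:[:- a:], 1:]" for a
    by (auto simp: total_le_def coeff_pCons coeff_1 split: nat.splits if_splits)
  have c: "card ({0..<p} - {a}) \<le> nat p" for a
    using card_Diff1_le[of "{0..<p}" a] by simp
  have "total_le (\<Sum>a\<in>{0..<p} - {fst s}. 1) (\<Prod>a\<in>{0..<p} - {fst s}. [:[:- a, 1:]:])"
    "total_le (\<Sum>b\<in>{0..<p} - {snd s}. 1) (\<Prod>b\<in>{0..<p} - {snd s}. [:[:- b:], 1:])"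
    using 1 by (intro total_le_prod; simp)+
  then have "total_le (nat p) (\<Prod>a\<in>{0..<p} - {fst s}. [:[:- a, 1:]:])"
    "total_le (nat p) (\<Prod>b\<in>{0..<p} - {snd s}. [:[:- b:], 1:])"
    using c by (auto intro: total_le_mono)
  from total_le_mult[OF this] show ?thesis by (simp add: lagrange2_def mult_2)
qed

lemma eq_of_dvd_diff:
  fixes a b p :: int
  assumes "a \<in> {0..<p}" "b \<in> {0..<p}" "p dvd a - b" shows "a = b"
  using assms by (metis atLeastLessThan_iff mod_eq_dvd_iff mod_pos_pos_trivial)

lemma eval2_lagrange2:
  assumes p: "prime p" and s: "s \<in> {0..<p} \<times> {0..<p}" and t: "t \<in> {0..<p} \<times> {0..<p}"
  shows "p dvd eval2 (lagrange2 p s) (fst t) (snd t) \<longleftrightarrow> s \<noteq> t"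
proof -
  have e: "eval2 (lagrange2 p s) x y = (\<Prod>a\<in>{0..<p} - {fst s}. x - a) * (\<Prod>b\<in>{0..<p} - {snd s}. y - b)" for x y
    by (simp add: lagrange2_def) (simp add: eval2_def)
  have d: "p dvd (\<Prod>a\<in>{0..<p} - {u}. v - a) \<longleftrightarrow> u \<noteq> v" if u: "u \<in> {0..<p}" and v: "v \<in> {0..<p}" for u v
  proof
    assume "p dvd (\<Prod>a\<in>{0..<p} - {u}. v - a)"
    then have "\<exists>a\<in>{0..<p} - {u}. p dvd v - a" using p by (simp add: prime_dvd_prod_iff)
    then obtain a where a: "a \<in> {0..<p} - {u}" "p dvd v - a" by blast
    then have "v = a" using v by (intro eq_of_dvd_diff[of _ p]) auto
    then show "u \<noteq> v" using a by auto
  next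
    assume "u \<noteq> v"
    then show "p dvd (\<Prod>a\<in>{0..<p} - {u}. v - a)" using v by (subst prod_zero) auto
  qed
  show ?thesis unfolding e using d[of "fst s" "fst t"] d[of "snd s" "snd t"] s t
    by (auto simp: prime_dvd_mult_iff[OF p] prod_eq_iff)
qed

text \<open>
  If \<open>N\<close> is large, the polynomials \<open>A * f + B * g + I\<close> with \<open>deg A \<le> N - d1\<close>, \<open>deg B \<le> N - d2\<close>,
  \<open>deg\<^sub>y B < d1\<close> and \<open>I\<close> interpolating arbitrary values on \<open>S\<close> are distinct modulo \<open>p\<close>; counting
  the polynomials of degree at most \<open>N\<close> modulo \<open>p\<close> bounds the size of \<open>S\<close>.
\<close>

lemma plane_bezout:
  fixes p :: int
  assumes p: "prime p"
    and f: "degree f \<le> d1" "coeff f d1 = [:c0:]" "\<not> p dvd c0" "total_le d1 f"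
    and g: "total_le d2 g"
    and R: "U * f + V * g = [:R:]" "\<not> [:p:] dvd R"
    and S: "S \<subseteq> {0..<p} \<times> {0..<p}"
    and zero: "\<And>s. s \<in> S \<Longrightarrow> p dvd eval2 f (fst s) (snd s)" "\<And>s. s \<in> S \<Longrightarrow> p dvd eval2 g (fst s) (snd s)"
  shows "card S \<le> d1 * d2"
proof -
  let ?l = "[:[:p:]:]"
  have p1: "p > 1" using p by (simp add: prime_gt_1_int)
  have fS: "finite S" using S by (rule finite_subset) simp
  \<comment> \<open>\<open>2 * nat p\<close> accommodates the interpolation polynomials;
    \<open>d1 + d2\<close> keeps the natural subtractions in \<open>TA\<close> and \<open>TB\<close>
    exact.\<close>
  define N where "N = 2 * nat p + d1 + d2"
  define TA where "TA = (SIGMA j:{..N - d1}. {..N - d1 - j})"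
  define TB where "TB = (SIGMA j:{..<d1}. {..N - d2 - j})"
  define TN where "TN = (SIGMA j:{..N}. {..N - j})"
  have fin: "finite TA" "finite TB" "finite TN" by (auto simp: TA_def TB_def TN_def)
  define ip where "ip w = (\<Sum>s\<in>S. [:[:w s:]:] * lagrange2 p s)" for w
  define \<Phi> where "\<Phi> = (\<lambda>(a, b, w). bipoly TA a * f + bipoly TB b * g + ip w)"
  define \<Psi> where "\<Psi> x = restrict (\<lambda>(j, i). coeff (coeff (\<Phi> x) j) i mod p) TN" for x
  define D where "D = (TA \<rightarrow>\<^sub>E {0..<p}) \<times> (TB \<rightarrow>\<^sub>E {0..<p}) \<times> (S \<rightarrow>\<^sub>E {0..<p})"
  have tot: "total_le N (\<Phi> x)" for x
  proof -
    obtain a b w where x: "x = (a, b, w)" by (cases x) auto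
    have "total_le (N - d1) (bipoly TA a)"
      by (auto simp: total_le_def coeff_bipoly fin TA_def split: if_splits)
    moreover have "total_le (N - d2) (bipoly TB b)"
      by (auto simp: total_le_def coeff_bipoly fin TB_def N_def split: if_splits)
    moreover have "total_le N (ip w)" unfolding ip_def
    proof (rule total_le_sum)
      fix s
      have "total_le (0 + 2 * nat p) ([:[:w s:]:] * lagrange2 p s)"
        using p1 by (intro total_le_mult total_le_const total_le_lagrange2) simp
      then show "total_le N ([:[:w s:]:] * lagrange2 p s)" by (rule total_le_mono) (simp add: N_def)
    qed
    ultimately have "total_le N (bipoly TA a * f)" "total_le N (bipoly TB b * g)" "total_le N (ip w)"
      using total_le_mult[OF _ f(4), of "N - d1" "bipoly TA a"] total_le_mult[OF _ g, of "N - d2" "bipoly TB b"]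
      by (auto simp: N_def add_ac)
    then show ?thesis unfolding x \<Phi>_def by (simp add: total_le_add)
  qed
  have inj: "inj_on \<Psi> D"
  proof (rule inj_onI)
    fix x x' assume x: "x \<in> D" and x': "x' \<in> D" and eq: "\<Psi> x = \<Psi> x'"
    obtain a b w where xx: "x = (a, b, w)" by (cases x) auto
    obtain a' b' w' where xx': "x' = (a', b', w')" by (cases x') auto
    have mem: "a \<in> TA \<rightarrow>\<^sub>E {0..<p}" "b \<in> TB \<rightarrow>\<^sub>E {0..<p}" "w \<in> S \<rightarrow>\<^sub>E {0..<p}"
      "a' \<in> TA \<rightarrow>\<^sub>E {0..<p}" "b' \<in> TB \<rightarrow>\<^sub>E {0..<p}" "w' \<in> S \<rightarrow>\<^sub>E {0..<p}"
      using x x' by (auto simp: D_def xx xx')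
    have d: "?l dvd \<Phi> x - \<Phi> x'"
      unfolding const2_dvd_iff
    proof (intro allI)
      fix i j
      show "p dvd coeff (coeff (\<Phi> x - \<Phi> x') j) i"
      proof (cases "(j, i) \<in> TN")
        case True
        have "\<Psi> x (j, i) = \<Psi> x' (j, i)" using eq by simp
        then have "coeff (coeff (\<Phi> x) j) i mod p = coeff (coeff (\<Phi> x') j) i mod p"
          using True by (simp add: \<Psi>_def)
        then show ?thesis by (simp add: mod_eq_dvd_iff)
      next
        case False
        then have "N < i + j" by (auto simp: TN_def)
        then show ?thesis using total_leD[OF tot, of i j] by simp
      qed
    qed
    \<comment> \<open>At a point of \<open>S\<close> both \<open>f\<close> and \<open>g\<close>
      vanish modulo \<open>p\<close>, so the value of \<open>\<Phi> x\<close> there is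
      \<open>w s\<close> times a unit and determines \<open>w s\<close>.\<close>
    have w: "w = w'"
    proof (rule PiE_ext[OF mem(3,6)])
      fix s assume s: "s \<in> S"
      have ev: "p dvd eval2 (ip v) (fst s) (snd s) - v s * eval2 (lagrange2 p s) (fst s) (snd s)" for v
      proof -
        have "eval2 (ip v) (fst s) (snd s) = (\<Sum>t\<in>S. v t * eval2 (lagrange2 p t) (fst s) (snd s))"
          by (simp add: ip_def del: mult_pCons_left)
        also have "\<dots> = v s * eval2 (lagrange2 p s) (fst s) (snd s) +
            (\<Sum>t\<in>S - {s}. v t * eval2 (lagrange2 p t) (fst s) (snd s))"
          by (rule sum.remove[OF fS s])
        finally have "eval2 (ip v) (fst s) (snd s) = v s * eval2 (lagrange2 p s) (fst s) (snd s) +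
            (\<Sum>t\<in>S - {s}. v t * eval2 (lagrange2 p t) (fst s) (snd s))" .
        moreover have "p dvd (\<Sum>t\<in>S - {s}. v t * eval2 (lagrange2 p t) (fst s) (snd s))"
        proof (rule dvd_sum)
          fix t assume "t \<in> S - {s}"
          then show "p dvd v t * eval2 (lagrange2 p t) (fst s) (snd s)"
            using eval2_lagrange2[OF p, of t s] s S by (intro dvd_mult) auto
        qed
        ultimately show ?thesis by simp
      qed
      obtain Q where Q: "\<Phi> x - \<Phi> x' = ?l * Q" using d by blast
      have "p dvd eval2 (\<Phi> x - \<Phi> x') (fst s) (snd s)" unfolding Q eval2_simps by simp
      moreover have "eval2 (\<Phi> x - \<Phi> x') (fst s) (snd s) =
          eval2 (bipoly TA a - bipoly TA a') (fst s) (snd s) * eval2 f (fst s) (snd s) +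
          eval2 (bipoly TB b - bipoly TB b') (fst s) (snd s) * eval2 g (fst s) (snd s) +
          (eval2 (ip w) (fst s) (snd s) - eval2 (ip w') (fst s) (snd s))"
        by (simp add: xx xx' \<Phi>_def algebra_simps)
      ultimately have d0: "p dvd eval2 (ip w) (fst s) (snd s) - eval2 (ip w') (fst s) (snd s)"
        using zero[OF s] by (simp add: dvd_add_right_iff)
      have "p dvd (eval2 (ip w) (fst s) (snd s) - eval2 (ip w') (fst s) (snd s)) -
          (eval2 (ip w) (fst s) (snd s) - w s * eval2 (lagrange2 p s) (fst s) (snd s)) +
          (eval2 (ip w') (fst s) (snd s) - w' s * eval2 (lagrange2 p s) (fst s) (snd s))"
        by (rule dvd_add[OF dvd_diff[OF d0 ev] ev])
      then have "p dvd (w s - w' s) * eval2 (lagrange2 p s) (fst s) (snd s)" by (simp add: algebra_simps)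
      then have "p dvd w s - w' s"
        using eval2_lagrange2[OF p, of s s] s S by (auto simp: prime_dvd_mult_iff[OF p])
      then show "w s = w' s" using mem s by (intro eq_of_dvd_diff[of _ p]) auto
    qed
    have "\<Phi> x - \<Phi> x' = (bipoly TA a - bipoly TA a') * f + (bipoly TB b - bipoly TB b') * g"
      by (simp add: xx xx' \<Phi>_def w algebra_simps)
    with d have "?l dvd (bipoly TA a - bipoly TA a') * f + (bipoly TB b - bipoly TB b') * g" by simp
    moreover have "coeff (bipoly TB b - bipoly TB b') j = 0" if "j \<ge> d1" for j
      by (rule poly_eqI) (use that in \<open>simp add: coeff_bipoly fin, simp add: TB_def\<close>)
    ultimately have AB: "?l dvd bipoly TA a - bipoly TA a'" "?l dvd bipoly TB b - bipoly TB b'"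
      using combination_divisible[OF p f(1-3) R, of "bipoly TB b - bipoly TB b'" "bipoly TA a - bipoly TA a'"]
      by auto
    have "a = a'"
    proof (rule PiE_ext[OF mem(1,4)])
      fix t assume t: "t \<in> TA"
      then have "p dvd coeff (coeff (bipoly TA a - bipoly TA a') (fst t)) (snd t)"
        using AB(1) unfolding const2_dvd_iff by blast
      then have "p dvd a t - a' t" using t by (simp add: coeff_bipoly fin)
      then show "a t = a' t" using mem t by (intro eq_of_dvd_diff[of _ p]) auto
    qed
    moreover have "b = b'"
    proof (rule PiE_ext[OF mem(2,5)])
      fix t assume t: "t \<in> TB"
      then have "p dvd coeff (coeff (bipoly TB b - bipoly TB b') (fst t)) (snd t)"
        using AB(2) unfolding const2_dvd_iff by blast
      then have "p dvd b t - b' t" using t by (simp add: coeff_bipoly fin)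
      then show "b t = b' t" using mem t by (intro eq_of_dvd_diff[of _ p]) auto
    qed
    ultimately show "x = x'" using w by (simp add: xx xx')
  qed
  have "card D \<le> card (TN \<rightarrow>\<^sub>E {0..<p})"
  proof (rule card_inj_on_le[OF inj])
    show "\<Psi> ` D \<subseteq> TN \<rightarrow>\<^sub>E {0..<p}" using p1 by (auto simp: \<Psi>_def)
  qed (use fin in \<open>auto intro: finite_PiE\<close>)
  then have "nat p ^ (card TA + card TB + card S) \<le> nat p ^ card TN"
    using fin fS by (simp add: D_def card_cartesian_product card_PiE power_add mult.assoc)
  then have le: "card TA + card TB + card S \<le> card TN" using p1 by simp
  \<comment> \<open>The rows \<open>j \<ge> d1\<close> of the triangle \<open>TN\<close> form a copy
    of \<open>TA\<close>; each of the \<open>d1\<close> lower rows is longer by \<open>d2\<close>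
    than the same row of \<open>TB\<close>. The excess is \<open>d1 * d2\<close>.\<close>
  have "card TN = (\<Sum>j\<in>{..N}. N - j + 1)" by (simp add: TN_def)
  also have "{..N} = {..<d1} \<union> (\<lambda>j. j + d1) ` {..N - d1}"
  proof safe
    fix j assume "j \<le> N" "j \<notin> (\<lambda>j. j + d1) ` {..N - d1}"
    then show "j < d1" by (metis (no_types, lifting) atMost_iff diff_le_mono imageI le_add_diff_inverse2 not_le)
  qed (auto simp: N_def)
  also have "(\<Sum>j\<in>{..<d1} \<union> (\<lambda>j. j + d1) ` {..N - d1}. N - j + 1) =
      (\<Sum>j<d1. N - j + 1) + (\<Sum>j\<in>(\<lambda>j. j + d1) ` {..N - d1}. N - j + 1)"
    by (rule sum.union_disjoint) auto
  also have "(\<Sum>j\<in>(\<lambda>j. j + d1) ` {..N - d1}. N - j + 1) = (\<Sum>j\<le>N - d1. N - d1 - j + 1)"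
    by (subst sum.reindex) (auto simp: inj_on_def intro!: sum.cong)
  also have "\<dots> = card TA" by (simp add: TA_def)
  also have "(\<Sum>j<d1. N - j + 1) = (\<Sum>j<d1. (N - d2 - j + 1) + d2)"
    by (rule sum.cong) (auto simp: N_def)
  also have "\<dots> = (\<Sum>j<d1. N - d2 - j + 1) + d1 * d2"
    by (subst sum.distrib) (simp only: sum_constant card_lessThan of_nat_id)
  also have "(\<Sum>j<d1. N - d2 - j + 1) = card TB" by (simp add: TB_def)
  finally show ?thesis using le by simp
qed

subsection \<open>Counting points of periodic sets in boxes\<close>

definition periodic :: "nat \<Rightarrow> nat \<Rightarrow> ((nat \<Rightarrow> int) \<Rightarrow> bool) \<Rightarrow> bool" where
  "periodic k n Z \<longleftrightarrow> (\<forall>a b. (\<forall>j<k. a j mod int n = b j mod int n) \<longrightarrow> Z a = Z b)"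

definition cnt :: "nat \<Rightarrow> nat \<Rightarrow> ((nat \<Rightarrow> int) \<Rightarrow> bool) \<Rightarrow> nat" where
  "cnt k n Z = card {a \<in> {..<k} \<rightarrow>\<^sub>E {0..<int n}. Z a}"

lemma periodicD: "periodic k n Z \<Longrightarrow> (\<And>j. j < k \<Longrightarrow> a j mod int n = b j mod int n) \<Longrightarrow> Z a = Z b"
  unfolding periodic_def by blast

lemma periodic_dvd:
  assumes "periodic k n Z" "n dvd N" shows "periodic k N Z"
  unfolding periodic_def
proof (intro allI impI)
  fix a b :: "nat \<Rightarrow> int" assume eq: "\<forall>j<k. a j mod int N = b j mod int N"
  have "a j mod int n = b j mod int n" if "j < k" for j
    using eq that assms(2) by (metis int_dvd_int_iff mod_mod_cancel)
  then show "Z a = Z b" by (rule periodicD[OF assms(1)])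
qed

text \<open>The box is a disjoint union of \<open>\<Prod>j<k. r j\<close> translates of a complete
  residue system, wherever its corner \<open>lo\<close> lies.\<close>

lemma box_count:
  assumes n: "n > 0" and per: "periodic k n Z"
  shows "card {a \<in> PiE {..<k} (\<lambda>j. {lo j..<lo j + int n * int (r j)}). Z a} = (\<Prod>j<k. r j) * cnt k n Z"
proof -
  let ?n = "int n"
  let ?A = "{a \<in> PiE {..<k} (\<lambda>j. {lo j..<lo j + ?n * int (r j)}). Z a}"
  let ?B = "PiE {..<k} (\<lambda>j. {0..<int (r j)}) \<times> {a \<in> {..<k} \<rightarrow>\<^sub>E {0..<?n}. Z a}"
  define \<phi> where "\<phi> a = (restrict (\<lambda>j. (a j - lo j) div ?n) {..<k}, restrict (\<lambda>j. a j mod ?n) {..<k})"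
    for a :: "nat \<Rightarrow> int"
  \<comment> \<open>\<open>(u j - lo j) mod n\<close> is the offset, within a block starting at
    \<open>lo j\<close>, of the representative of the class of \<open>u j\<close>.\<close>
  define \<psi> where "\<psi> = (\<lambda>(q, u). restrict (\<lambda>j. lo j + ?n * q j + (u j - lo j) mod ?n) {..<k})"
  have np: "?n > 0" using n by simp
  have "bij_betw \<phi> ?A ?B"
  proof (rule bij_betw_byWitness[where f' = \<psi>])
    show "\<forall>a\<in>?A. \<psi> (\<phi> a) = a"
    proof
      fix a assume a: "a \<in> ?A"
      show "\<psi> (\<phi> a) = a"
      proof (rule extensionalityI[where A = "{..<k}"])
        fix j assume j: "j \<in> {..<k}"
        have "\<psi> (\<phi> a) j = lo j + (?n * ((a j - lo j) div ?n) + (a j - lo j) mod ?n)"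
          using j by (simp add: \<psi>_def \<phi>_def mod_diff_left_eq)
        then show "\<psi> (\<phi> a) j = a j" by simp
      qed (use a in \<open>auto simp: \<psi>_def \<phi>_def PiE_def\<close>)
    qed
    show "\<forall>y\<in>?B. \<phi> (\<psi> y) = y"
    proof
      fix y assume y: "y \<in> ?B"
      obtain q u where qu: "y = (q, u)" by (cases y)
      have q: "q \<in> PiE {..<k} (\<lambda>j. {0..<int (r j)})" and u: "u \<in> {..<k} \<rightarrow>\<^sub>E {0..<?n}"
        using y qu by auto
      have "restrict (\<lambda>j. (\<psi> y j - lo j) div ?n) {..<k} = q"
      proof (rule extensionalityI[where A = "{..<k}"])
        fix j assume "j \<in> {..<k}"
        then show "restrict (\<lambda>j. (\<psi> y j - lo j) div ?n) {..<k} j = q j"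
          using np by (simp add: \<psi>_def qu div_add1_eq)
      qed (use q in \<open>auto simp: PiE_def\<close>)
      moreover have "restrict (\<lambda>j. \<psi> y j mod ?n) {..<k} = u"
      proof (rule extensionalityI[where A = "{..<k}"])
        fix j assume j: "j \<in> {..<k}"
        have "\<psi> y j mod ?n = (lo j + ?n * q j + (u j - lo j)) mod ?n"
          using j by (simp add: \<psi>_def qu mod_add_right_eq)
        also have "\<dots> = (u j + ?n * q j) mod ?n" by (simp add: algebra_simps)
        also have "\<dots> = u j" using u j by (simp add: PiE_def Pi_def)
        finally show "restrict (\<lambda>j. \<psi> y j mod ?n) {..<k} j = u j" using j by simp
      qed (use u in \<open>auto simp: PiE_def\<close>)
      ultimately show "\<phi> (\<psi> y) = y" by (simp add: \<phi>_def qu)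
    qed
    show "\<phi> ` ?A \<subseteq> ?B"
    proof
      fix y assume "y \<in> \<phi> ` ?A"
      then obtain a where a: "a \<in> ?A" "y = \<phi> a" by blast
      have "Z (restrict (\<lambda>j. a j mod ?n) {..<k}) = Z a" by (rule periodicD[OF per]) simp
      moreover have "0 \<le> (a j - lo j) div ?n \<and> (a j - lo j) div ?n < int (r j)" if "j < k" for j
      proof -
        have "lo j \<le> a j" "a j < lo j + ?n * int (r j)" using a(1) that by (auto simp: PiE_def Pi_def)
        moreover have "(a j - lo j) div ?n < int (r j)"
        proof (rule ccontr)
          assume "\<not> ?thesis"
          then have "?n * int (r j) \<le> ?n * ((a j - lo j) div ?n)" using np by (intro mult_left_mono) auto
          also have "\<dots> \<le> a j - lo j"
            using mult_div_mod_eq[of ?n "a j - lo j"] pos_mod_sign[OF np, of "a j - lo j"] by linarith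
          finally show False using \<open>a j < lo j + ?n * int (r j)\<close> by linarith
        qed
        ultimately show ?thesis using np by (simp add: pos_imp_zdiv_nonneg_iff)
      qed
      ultimately show "y \<in> ?B" using a np by (auto simp: \<phi>_def PiE_def)
    qed
    show "\<psi> ` ?B \<subseteq> ?A"
    proof
      fix a assume "a \<in> \<psi> ` ?B"
      then obtain q u where a: "a = \<psi> (q, u)" and q: "q \<in> PiE {..<k} (\<lambda>j. {0..<int (r j)})"
        and u: "u \<in> {..<k} \<rightarrow>\<^sub>E {0..<?n}" "Z u" by auto
      have "Z a = Z u"
      proof (rule periodicD[OF per])
        fix j assume j: "j < k"
        have "a j mod ?n = (lo j + ?n * q j + (u j - lo j)) mod ?n"
          using j by (simp add: a \<psi>_def mod_add_right_eq)
        also have "\<dots> = (u j + ?n * q j) mod ?n" by (simp add: algebra_simps)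
        finally show "a j mod ?n = u j mod ?n" by simp
      qed
      moreover have "lo j \<le> a j \<and> a j < lo j + ?n * int (r j)" if j: "j < k" for j
      proof -
        have qj: "0 \<le> q j" "q j + 1 \<le> int (r j)" using q j by (auto simp: PiE_def Pi_def)
        have m: "0 \<le> (u j - lo j) mod ?n" "(u j - lo j) mod ?n < ?n" using np by auto
        have "?n * (q j + 1) \<le> ?n * int (r j)" using qj np by (intro mult_left_mono) auto
        moreover have "0 \<le> ?n * q j" using qj np by simp
        ultimately show ?thesis using m j by (simp add: a \<psi>_def distrib_left)
      qed
      moreover have "a \<in> extensional {..<k}" by (simp add: a \<psi>_def)
      ultimately show "a \<in> ?A" using u(2) by (auto simp: PiE_def)
    qed
  qed
  then have "card ?A = card ?B" by (rule bij_betw_same_card)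
  then show ?thesis by (simp add: card_cartesian_product card_PiE cnt_def)
qed

text \<open>The Chinese remainder theorem, applied in each coordinate.\<close>

lemma cnt_crt:
  assumes nm: "n > 0" "m > 0" "coprime n m" and Z: "periodic k n Z" and W: "periodic k m W"
  shows "cnt k (n * m) (\<lambda>a. Z a \<and> W a) = cnt k n Z * cnt k m W"
proof -
  let ?A = "{a \<in> {..<k} \<rightarrow>\<^sub>E {0..<int (n * m)}. Z a \<and> W a}"
  let ?B = "{a \<in> {..<k} \<rightarrow>\<^sub>E {0..<int n}. Z a} \<times> {a \<in> {..<k} \<rightarrow>\<^sub>E {0..<int m}. W a}"
  have cop: "coprime (int n) (int m)" using nm by simp
  have "\<exists>x. x \<in> {0..<int (n * m)} \<and> x mod int n = u mod int n \<and> x mod int m = v mod int m" for u v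
  proof -
    obtain y where y: "[int n * y = 1] (mod int m)" using cong_solve_coprime_int[OF cop] by blast
    define x where "x = u + int n * y * (v - u)"
    have "[x = u + 1 * (v - u)] (mod int m)" unfolding x_def by (intro cong_add cong_mult y cong_refl)
    then have "x mod int m = v mod int m" by (simp add: cong_def)
    moreover have "x mod int n = u mod int n" by (simp add: x_def mult.assoc)
    ultimately show ?thesis using nm
      by (intro exI[of _ "x mod int (n * m)"]) (auto simp: mod_mod_cancel)
  qed
  then obtain X where X: "\<And>u v. X u v \<in> {0..<int (n * m)}" "\<And>u v. X u v mod int n = u mod int n"
    "\<And>u v. X u v mod int m = v mod int m" by metis
  have uniq: "x = y" if "x \<in> {0..<int (n * m)}" "y \<in> {0..<int (n * m)}"
    "x mod int n = y mod int n" "x mod int m = y mod int m" for x y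
  proof -
    have "int n * int m dvd x - y" using that cop by (intro divides_mult) (auto simp: mod_eq_dvd_iff)
    then have "x mod int (n * m) = y mod int (n * m)" by (simp add: mod_eq_dvd_iff)
    with that show ?thesis by simp
  qed
  define \<phi> where "\<phi> a = (restrict (\<lambda>j. a j mod int n) {..<k}, restrict (\<lambda>j. a j mod int m) {..<k})"
    for a :: "nat \<Rightarrow> int"
  define \<psi> where "\<psi> = (\<lambda>(u, v). restrict (\<lambda>j. X (u j) (v j)) {..<k})"
  have "bij_betw \<phi> ?A ?B"
  proof (rule bij_betw_byWitness[where f' = \<psi>])
    show "\<forall>a\<in>?A. \<psi> (\<phi> a) = a"
    proof
      fix a assume a: "a \<in> ?A"
      show "\<psi> (\<phi> a) = a"
      proof (rule extensionalityI[where A = "{..<k}"])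
        fix j assume j: "j \<in> {..<k}"
        show "\<psi> (\<phi> a) j = a j"
          by (rule uniq) (use j a X in \<open>auto simp: \<psi>_def \<phi>_def\<close>)
      qed (use a in \<open>auto simp: \<psi>_def \<phi>_def PiE_def\<close>)
    qed
    show "\<forall>y\<in>?B. \<phi> (\<psi> y) = y"
    proof
      fix y assume y: "y \<in> ?B"
      then obtain u v where uv: "y = (u, v)" "u \<in> {..<k} \<rightarrow>\<^sub>E {0..<int n}" "v \<in> {..<k} \<rightarrow>\<^sub>E {0..<int m}" by auto
      have "restrict (\<lambda>j. \<psi> y j mod int n) {..<k} = u"
        by (rule extensionalityI[where A = "{..<k}"]) (use uv X in \<open>auto simp: \<psi>_def PiE_def Pi_def\<close>)
      moreover have "restrict (\<lambda>j. \<psi> y j mod int m) {..<k} = v"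
        by (rule extensionalityI[where A = "{..<k}"]) (use uv X in \<open>auto simp: \<psi>_def PiE_def Pi_def\<close>)
      ultimately show "\<phi> (\<psi> y) = y" by (simp add: \<phi>_def uv)
    qed
    have "Z (restrict (\<lambda>j. a j mod int n) {..<k}) = Z a" "W (restrict (\<lambda>j. a j mod int m) {..<k}) = W a" for a
      by (rule periodicD[OF Z], simp) (rule periodicD[OF W], simp)
    then show "\<phi> ` ?A \<subseteq> ?B" using nm by (auto simp: \<phi>_def)
    have "Z (\<psi> (u, v)) = Z u" "W (\<psi> (u, v)) = W v" for u v
      by (rule periodicD[OF Z], simp add: \<psi>_def X) (rule periodicD[OF W], simp add: \<psi>_def X)
    then show "\<psi> ` ?B \<subseteq> ?A" using X(1) by (auto simp: \<psi>_def)
  qed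
  then have "card ?A = card ?B" by (rule bij_betw_same_card)
  then show ?thesis by (simp add: card_cartesian_product cnt_def)
qed

lemma periodic_prime_set:
  assumes "finite M" "\<And>p. p \<in> M \<Longrightarrow> periodic k p (Z p)"
  shows "periodic k (\<Prod>M) (\<lambda>a. \<forall>p\<in>M. Z p a)"
proof -
  have "periodic k (\<Prod>M) (Z p)" if "p \<in> M" for p
    by (rule periodic_dvd[OF assms(2)[OF that]]) (rule dvd_prodI[OF assms(1) that])
  then show ?thesis unfolding periodic_def by blast
qed

lemma cnt_prime_set:
  assumes "finite M" "\<And>p. p \<in> M \<Longrightarrow> prime p" "\<And>p. p \<in> M \<Longrightarrow> periodic k p (Z p)"
  shows "cnt k (\<Prod>M) (\<lambda>a. \<forall>p\<in>M. Z p a) = (\<Prod>p\<in>M. cnt k p (Z p))"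
  using assms
proof (induction M rule: finite_induct)
  case empty
  then show ?case by (simp add: cnt_def card_PiE)
next
  case (insert p M)
  have pos: "p > 0" "\<Prod>M > 0"
    using insert by (auto intro!: prod_pos simp: prime_gt_0_nat)
  have "coprime p (\<Prod>M)"
    using insert by (intro prod_coprime_right primes_coprime) auto
  from cnt_crt[OF pos this insert.prems(2) periodic_prime_set[of M k Z]]
  have "cnt k (p * \<Prod>M) (\<lambda>a. Z p a \<and> (\<forall>p\<in>M. Z p a)) = cnt k p (Z p) * cnt k (\<Prod>M) (\<lambda>a. \<forall>p\<in>M. Z p a)"
    using insert by auto
  then show ?case using insert by simp
qed

lemma mev_cong_mod:
  fixes a b :: "nat \<Rightarrow> int"
  assumes "f \<in> mpolys k" "\<And>j. j < k \<Longrightarrow> a j mod n = b j mod n"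
  shows "mev f a mod n = mev f b mod n"
proof -
  have "[a j = b j] (mod n)" if "t \<in> Poly_Mapping.keys f" "j \<in> Poly_Mapping.keys t" for t j
    using assms that unfolding mpolys_def cong_def by blast
  then have "[mev f a = mev f b] (mod n)" unfolding mev_def monom_eval_def
    by (intro cong_sum cong_mult cong_prod cong_pow cong_refl) simp
  then show ?thesis by (simp add: cong_def)
qed

text \<open>\<open>N_F\<close> and the count in the theorem run over natural numbers, while the
  changes of coordinates need integers.\<close>

lemma card_nat_box:
  fixes k :: nat and Q :: "(nat \<Rightarrow> int) \<Rightarrow> bool"
  assumes "\<And>a b. (\<And>j. j < k \<Longrightarrow> a j = b j) \<Longrightarrow> Q a = Q b"
  shows "card {a \<in> {..<k} \<rightarrow>\<^sub>E {1..X::nat}. Q (\<lambda>j. int (a j))} = card {a \<in> {..<k} \<rightarrow>\<^sub>E {1..<1 + int X}. Q a}"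
proof (rule bij_betw_same_card)
  let ?A = "{a \<in> {..<k} \<rightarrow>\<^sub>E {1..X}. Q (\<lambda>j. int (a j))}"
  let ?B = "{a \<in> {..<k} \<rightarrow>\<^sub>E {1..<1 + int X}. Q a}"
  define \<phi> where "\<phi> a = restrict (\<lambda>j. int (a j)) {..<k}" for a :: "nat \<Rightarrow> nat"
  define \<psi> where "\<psi> a = restrict (\<lambda>j. nat (a j)) {..<k}" for a :: "nat \<Rightarrow> int"
  show "bij_betw \<phi> ?A ?B"
  proof (rule bij_betw_byWitness[where f' = \<psi>])
    show "\<forall>a\<in>?A. \<psi> (\<phi> a) = a"
      by (auto simp: \<phi>_def \<psi>_def PiE_def extensional_def fun_eq_iff)
    show "\<forall>a\<in>?B. \<phi> (\<psi> a) = a"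
    proof
      fix a assume a: "a \<in> ?B"
      show "\<phi> (\<psi> a) = a"
        by (rule extensionalityI[where A = "{..<k}"]) (use a in \<open>auto simp: \<phi>_def \<psi>_def PiE_def Pi_def\<close>)
    qed
    have "Q (\<phi> a) = Q (\<lambda>j. int (a j))" for a by (rule assms) (simp add: \<phi>_def)
    then show "\<phi> ` ?A \<subseteq> ?B" by (auto simp: \<phi>_def PiE_def Pi_def)
    show "\<psi> ` ?B \<subseteq> ?A"
    proof
      fix y assume "y \<in> \<psi> ` ?B"
      then obtain a where a: "a \<in> ?B" "y = \<psi> a" by blast
      have r: "1 \<le> a j \<and> a j < 1 + int X" if "j < k" for j using a(1) that by (auto simp: PiE_def Pi_def)
      have "Q (\<lambda>j. int (\<psi> a j)) = Q a"
        by (rule assms) (use r in \<open>force simp: \<psi>_def\<close>)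
      then show "y \<in> ?A" using a r by (force simp: \<psi>_def PiE_def Pi_def)
    qed
  qed
qed

subsection \<open>Adapted coordinates\<close>

lemma total_le_mev:
  assumes f: "f \<in> mpolys k" and a: "\<And>j. j < k \<Longrightarrow> total_le 1 (a j)"
  shows "total_le (total_deg f) (mev f a)"
  unfolding mev_def
proof (rule total_le_sum)
  fix t assume t: "t \<in> Poly_Mapping.keys f"
  have pow: "total_le n (a j ^ n)" if "j \<in> Poly_Mapping.keys t" for j n
  proof (induction n)
    case (Suc n)
    have "j < k" using f t that by (auto simp: mpolys_def)
    from total_le_mult[OF a[OF this] Suc] show ?case by simp
  qed (simp add: total_le_1)
  have "total_le (monom_deg t) (monom_eval a t)"
    unfolding monom_deg_def monom_eval_def by (rule total_le_prod) (use pow in auto)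
  moreover have "total_le 0 (of_int (Poly_Mapping.lookup f t))"
    using total_le_const[of "Poly_Mapping.lookup f t"] by (simp add: of_int_poly)
  ultimately have "total_le (0 + monom_deg t) (of_int (Poly_Mapping.lookup f t) * monom_eval a t)"
    by (intro total_le_mult)
  then show "total_le (total_deg f) (of_int (Poly_Mapping.lookup f t) * monom_eval a t)"
    by (rule total_le_mono) (simp add: monom_deg_le_total_deg[OF t])
qed

lemma is_hom_eval2: "is_hom (\<lambda>Q. eval2 Q x y)"
  unfolding is_hom_def by (simp add: eval2_def)

lemma total_deg_combination_le:
  fixes F :: "nat \<Rightarrow> int mpoly"
  assumes "\<And>i. i < m \<Longrightarrow> total_deg (F i) \<le> d"
  shows "total_deg (\<Sum>i<m. of_int (w i) * F i) \<le> d"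
proof -
  have "monom_deg t \<le> d" if t: "t \<in> Poly_Mapping.keys (\<Sum>i<m. of_int (w i) * F i)" for t
  proof -
    obtain i where i: "i < m" "t \<in> Poly_Mapping.keys (of_int (w i) * F i)"
      using t Poly_Mapping.keys_sum[of "\<lambda>i. of_int (w i) * F i" "{..<m}"] by auto
    have "Poly_Mapping.keys (of_int (w i) * F i) \<subseteq> Poly_Mapping.keys (F i)"
    proof
      fix u assume "u \<in> Poly_Mapping.keys (of_int (w i) * F i)"
      then obtain a b where ab: "u = a + b" "a \<in> Poly_Mapping.keys (of_int (w i) :: int mpoly)"
        "b \<in> Poly_Mapping.keys (F i)"
        using keys_mult[of "of_int (w i)" "F i"] by auto
      have "Poly_Mapping.keys (of_int (w i) :: int mpoly) \<subseteq> {0}"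
        unfolding mpoly_of_int by simp
      with ab show "u \<in> Poly_Mapping.keys (F i)" by auto
    qed
    with i have "monom_deg t \<le> total_deg (F i)" by (intro monom_deg_le_total_deg) auto
    with assms[OF i(1)] show ?thesis by linarith
  qed
  then show ?thesis unfolding total_deg_def by (subst Max_le_iff) auto
qed

text \<open>Lagrange's bound modulo \<open>p\<close>, obtained as Bezout's bound for the curve q(y)
  = 0 and the line x = 0, with x itself as eliminant.\<close>

lemma roots_mod_prime_le:
  fixes q :: "int poly" and p :: int
  assumes p: "prime p" and q: "degree q \<le> n" "\<not> p dvd coeff q n"
  shows "card {y \<in> {0..<p}. p dvd poly q y} \<le> n"
proof -
  define f where "f = map_poly (\<lambda>c. [:c:]) q"
  have cf: "coeff f j = [:coeff q j:]" for j unfolding f_def by (simp add: coeff_map_poly)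
  have df: "degree f \<le> n" by (rule degree_le) (use q(1) in \<open>auto simp: cf coeff_eq_0\<close>)
  have ev: "eval2 f x y = poly q y" for x y
  proof -
    have "poly f [:y:] = [:poly q y:]"
      unfolding f_def by (induction q) (auto simp: map_poly_pCons)
    then show ?thesis by (simp add: eval2_def)
  qed
  have evx: "eval2 [:[:0, 1:]:] x y = x" for x y by (simp add: eval2_def)
  have "card ((\<lambda>y. (0 :: int, y)) ` {y \<in> {0..<p}. p dvd poly q y}) \<le> n * 1"
  proof (rule plane_bezout[OF p df, where ?c0.0 = "coeff q n" and g = "[:[:0, 1:]:]" and U = 0 and V = 1 and R = "[:0, 1:]"])
    show "total_le n f"
      using df le_degree[of f] by (auto simp: total_le_def cf coeff_pCons split: nat.splits)
        (metis cf coeff_eq_0 le_less_trans not_le pCons_eq_0_iff)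
    show "total_le 1 [:[:0, 1:]:]" by (auto simp: total_le_def coeff_pCons split: nat.splits)
    show "\<not> [:p:] dvd [:0, 1:]"
    proof
      assume "[:p:] dvd [:0, 1:]"
      then have "p dvd coeff [:0, 1:] 1" unfolding const_poly_dvd_iff by blast
      then show False using p by (simp add: not_prime_unit)
    qed
    show "(\<lambda>y. (0 :: int, y)) ` {y \<in> {0..<p}. p dvd poly q y} \<subseteq> {0..<p} \<times> {0..<p}"
      using p by (auto simp: prime_gt_0_int)
  qed (use q in \<open>auto simp: cf ev evx\<close>)
  moreover have "inj_on (\<lambda>y. (0::int, y)) {y \<in> {0..<p}. p dvd poly q y}" by (simp add: inj_on_def)
  ultimately show ?thesis by (simp add: card_image)
qed

text \<open>
  There are \<open>Suc k\<close> variables here; \<open>k\<close> is the index of the last one. In \<open>coord\<close> the shift by \<open>e k\<close>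
  makes \<open>F 0\<close> monic in \<open>e k\<close>, and the shift by \<open>c j * e 0\<close> in \<open>bcoord\<close> makes \<open>R\<close> monic in \<open>e 0\<close>,
  up to constants.
\<close>

locale gcd_system =
  fixes k m d :: nat and F :: "nat \<Rightarrow> int mpoly" and w :: "nat \<Rightarrow> int" and U V R :: "int mpoly"
    and c :: "nat \<Rightarrow> int"
  assumes k: "k \<ge> 1" and m: "m \<ge> 2" and d: "d \<ge> 1"
    and F: "i < m \<Longrightarrow> F i \<in> mpolys (Suc k)" and deg: "i < m \<Longrightarrow> total_deg (F i) \<le> d"
    and top0: "top_at (F 0) (\<lambda>_. 1) \<noteq> 0"
    and R: "R \<in> mpolys k" and c0: "c 0 = 1" and topR: "top_at R c \<noteq> 0"
    and elim: "U * mev (F 0) (\<lambda>j. if j < k then mvar j + mvar k else mvar j) +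
      V * mev (\<Sum>i<m. of_int (w i) * F i) (\<lambda>j. if j < k then mvar j + mvar k else mvar j) = R"
begin

definition G :: "int mpoly" where "G = (\<Sum>i<m. of_int (w i) * F i)"
text \<open>The leading coefficient of \<open>F 0\<close> in the coordinate \<open>e k\<close>, as
  \<open>C1\<close> is that of \<open>R\<close> in \<open>e 0\<close>. The Bezout bound will hold at
  the primes dividing neither.\<close>

definition C0 :: int where "C0 = top_at (F 0) (\<lambda>_. 1)"
definition C1 :: int where "C1 = top_at R c"
definition n1 :: nat where "n1 = total_deg (F 0)"

definition bcoord :: "(nat \<Rightarrow> 'b::comm_ring_1) \<Rightarrow> nat \<Rightarrow> 'b" where
  "bcoord e j = (if j < k then (if j = 0 then 0 else e j) + of_int (c j) * e 0 else e j)"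

definition coord :: "(nat \<Rightarrow> 'b::comm_ring_1) \<Rightarrow> nat \<Rightarrow> 'b" where
  "coord e j = (if j < k then bcoord e j + e k else e j)"

text \<open>The inverse of \<open>coord\<close>: as \<open>c 0 = 1\<close>, the equation at 0 reads
  \<open>a 0 = e 0 + e k\<close>, and the others follow. Its coefficients are integers, so the
  change of coordinates is also invertible modulo every n.\<close>

definition coord_inv :: "(nat \<Rightarrow> int) \<Rightarrow> nat \<Rightarrow> int" where
  "coord_inv a j = (if j = 0 then a 0 - a k else if j < k then a j - a k - c j * (a 0 - a k) else a j)"

definition fT :: "(nat \<Rightarrow> 'b::comm_ring_1) \<Rightarrow> 'b" where "fT e = mev (F 0) (coord e)"
definition gT :: "(nat \<Rightarrow> 'b::comm_ring_1) \<Rightarrow> 'b" where "gT e = mev G (coord e)"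
text \<open>The eliminant in the new coordinates; it depends on \<open>e 0\<close>, ...,
  \<open>e (k - 1)\<close> only, see \<open>RT_cong\<close>.\<close>

definition RT :: "(nat \<Rightarrow> 'b::comm_ring_1) \<Rightarrow> 'b" where "RT e = mev R (bcoord e)"

lemma F0: "F 0 \<in> mpolys (Suc k)" by (rule F) (use m in simp)

lemma G: "G \<in> mpolys (Suc k)" unfolding G_def
  by (intro subring_sum[OF subring_mpolys] subringD(6)[OF subring_mpolys] subring_of_int[OF subring_mpolys] F) simp

lemma n1_le: "n1 \<le> d" unfolding n1_def by (rule deg) (use m in simp)

lemma elimination: "mev U (bcoord e) * fT e + mev V (bcoord e) * gT e = RT e"
proof -
  let ?s = "\<lambda>j. if j < k then mvar j + mvar k else mvar j"
  have "mev (?s j) (bcoord e) = coord e j" for j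
    by (auto simp: coord_def mev_add) (simp_all add: bcoord_def)
  then have "mev (mev p ?s) (bcoord e) = mev p (coord e)" for p unfolding mev_mev by simp
  then show ?thesis
    using arg_cong[OF elim, of "\<lambda>p. mev p (bcoord e)"]
    by (simp add: mev_add mev_mult fT_def gT_def RT_def G_def)
qed

lemma coord_coord_inv: "coord (coord_inv a) j = a j"
  using k c0 by (auto simp: coord_def bcoord_def coord_inv_def)

lemma fT_coord_inv: "fT (coord_inv a) = mev (F 0) a"
  unfolding fT_def by (rule arg_cong[where f = "mev (F 0)"]) (auto simp: coord_coord_inv)

lemma gT_coord_inv: "gT (coord_inv a) = (\<Sum>i<m. w i * mev (F i) a)"
proof -
  have "gT (coord_inv a) = mev G a"
    unfolding gT_def by (rule arg_cong[where f = "mev G"]) (auto simp: coord_coord_inv)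
  then show ?thesis by (simp add: G_def mev_sum mev_mult)
qed

lemma bcoord_cong: "(\<And>j. j < k \<Longrightarrow> e j = e' j) \<Longrightarrow> j < k \<Longrightarrow> bcoord e j = bcoord e' j"
  using k by (simp add: bcoord_def)

lemma RT_cong: "(\<And>j. j < k \<Longrightarrow> e j = e' j) \<Longrightarrow> RT e = RT e'"
  unfolding RT_def by (rule mev_cong[OF R bcoord_cong])

text \<open>\<open>fT\<close> as a polynomial in the coordinate \<open>e k\<close>. Its coefficient
  \<open>C0\<close> at \<open>n1\<close> is the same for all \<open>e\<close>, which bounds the
  number of roots uniformly.\<close>

definition fy :: "(nat \<Rightarrow> int) \<Rightarrow> int poly" where
  "fy e = mev (F 0) (\<lambda>j. [:if j < k then bcoord e j else 0, of_int 1:])"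

lemma fy: "degree (fy e) \<le> n1" "coeff (fy e) n1 = C0"
  using mev_linear[of "F 0" "\<lambda>j. if j < k then bcoord e j else 0" "\<lambda>_. 1"]
  by (auto simp: fy_def n1_def C0_def)

lemma poly_fy: "poly (fy e) (e k) = fT e"
proof -
  have "poly (fy e) (e k) = mev (F 0) (\<lambda>j. poly [:if j < k then bcoord e j else 0, of_int 1:] (e k))"
    unfolding fy_def by (rule is_hom_mev[OF is_hom_poly])
  also have "\<dots> = fT e" unfolding fT_def
    by (rule mev_cong[OF F0]) (auto simp: coord_def less_Suc_eq)
  finally show ?thesis .
qed

lemma fy_cong: "(\<And>j. j < k \<Longrightarrow> e j = e' j) \<Longrightarrow> fy e = fy e'"
  unfolding fy_def by (intro arg_cong[where f = "mev (F 0)"] ext) (simp add: bcoord_cong[of e e'])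

lemma fy_roots_le:
  assumes "prime p"
  shows "card {y \<in> {0..<int p}. int p dvd poly (fy e) y} \<le> (if int p dvd C0 then p else n1)"
proof (cases "int p dvd C0")
  case True
  have "card {y \<in> {0..<int p}. int p dvd poly (fy e) y} \<le> card {0..<int p}"
    by (rule card_mono) auto
  with True show ?thesis by simp
next
  case False
  then show ?thesis using roots_mod_prime_le[of "int p" "fy e" n1] fy assms by simp
qed

text \<open>With all coordinates but \<open>e 0\<close> and \<open>e k\<close> fixed,
  \<open>fT\<close> and \<open>gT\<close> are plane curves of degrees at most \<open>n1\<close> and
  \<open>d\<close>. The restricted eliminant is a polynomial in \<open>e 0\<close> with leading
  coefficient \<open>C1\<close>, so it does not vanish modulo \<open>p\<close>.\<close>

lemma slice_le:
  fixes p :: nat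
  assumes p: "prime p" "\<not> int p dvd C0" "\<not> int p dvd C1"
  shows "card {s \<in> {0..<int p} \<times> {0..<int p}. int p dvd fT (e(0 := fst s, k := snd s)) \<and>
    int p dvd gT (e(0 := fst s, k := snd s))} \<le> n1 * d" (is "card ?S \<le> _")
proof -
  \<comment> \<open>The point with \<open>y\<close> in place of \<open>e k\<close> and
    \<open>x\<close> in place of \<open>e 0\<close>; \<open>E'\<close> describes the base
    coordinates, which do not involve \<open>y\<close>.\<close>
  define E :: "nat \<Rightarrow> int poly poly" where
    "E j = (if j = k then [:0, 1:] else if j = 0 then [:[:0, 1:]:] else [:[:e j:]:])" for j
  define E' :: "nat \<Rightarrow> int poly" where "E' j = (if j = 0 then [:0, 1:] else [:e j:])" for j
  have bE: "bcoord E j = [:bcoord E' j:]" if "j < k" for j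
    using that k by (auto simp: bcoord_def E_def E'_def of_int_poly)
  have bE': "bcoord E' j = [:if j = 0 then 0 else e j, of_int (c j):]" if "j < k" for j
    using that c0 by (auto simp: bcoord_def E'_def of_int_poly)
  have cE: "coord E j = [:if j < k then bcoord E' j else 0, of_int 1:]" if "j < Suc k" for j
    using that k bE by (auto simp: coord_def less_Suc_eq E_def)
  have fE: "fT E = mev (F 0) (\<lambda>j. [:if j < k then bcoord E' j else 0, of_int 1:])"
    unfolding fT_def by (rule mev_cong[OF F0 cE])
  have lin: "degree (fT E) \<le> n1" "coeff (fT E) n1 = [:C0:]"
    unfolding fE using mev_linear[of "F 0" "\<lambda>j. if j < k then bcoord E' j else 0" "\<lambda>_. 1"]
    by (auto simp: n1_def C0_def of_int_poly)
  have t1: "total_le 1 (coord E j)" if "j < Suc k" for j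
    unfolding cE[OF that] using bE'[of j]
    by (auto simp: total_le_def coeff_pCons coeff_1 split: nat.splits if_splits)
  have tf: "total_le n1 (fT E)" unfolding fT_def n1_def by (rule total_le_mev[OF F0 t1])
  have tg: "total_le d (gT E)" unfolding gT_def
    by (rule total_le_mono[OF total_le_mev[OF G t1]]) (auto simp: G_def intro: total_deg_combination_le deg)
  define Rx where "Rx = mev R (\<lambda>j. [:if j = 0 then 0 else e j, of_int (c j):])"
  have RE: "RT E = [:Rx:]"
  proof -
    have "RT E = mev R (\<lambda>j. [:bcoord E' j:])" unfolding RT_def by (rule mev_cong[OF R bE])
    also have "\<dots> = [:mev R (bcoord E'):]" by (rule is_hom_mev[OF is_hom_const, symmetric])
    also have "mev R (bcoord E') = Rx" unfolding Rx_def by (rule mev_cong[OF R bE'])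
    finally show ?thesis .
  qed
  have "coeff Rx (total_deg R) = C1"
    unfolding Rx_def C1_def using mev_linear(2)[of R "\<lambda>j. if j = 0 then 0 else e j" c] by simp
  then have Rp: "\<not> [:int p:] dvd Rx" using p(3) by (auto simp: const_poly_dvd_iff intro!: exI[of _ "total_deg R"])
  have ev: "eval2 (fT E) x y = fT (e(0 := x, k := y))" "eval2 (gT E) x y = gT (e(0 := x, k := y))" for x y
  proof -
    have "eval2 (coord E j) x y = coord (e(0 := x, k := y)) j" if "j < Suc k" for j
      using that k by (auto simp: coord_def bcoord_def E_def eval2_def of_int_poly)
    then have "mev f (\<lambda>j. eval2 (coord E j) x y) = mev f (coord (e(0 := x, k := y)))"
      if "f \<in> mpolys (Suc k)" for f
      by (rule mev_cong[OF that])
    then show "eval2 (fT E) x y = fT (e(0 := x, k := y))" "eval2 (gT E) x y = gT (e(0 := x, k := y))"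
      unfolding fT_def gT_def is_hom_mev[OF is_hom_eval2] using F0 G by auto
  qed
  show ?thesis
    by (rule plane_bezout[OF _ lin p(2) tf tg elimination[of E, unfolded RE] Rp])
      (use p(1) in \<open>auto simp: ev\<close>)
qed

section \<open>Common zeros modulo n\<close>

definition Z :: "nat \<Rightarrow> (nat \<Rightarrow> int) \<Rightarrow> bool" where
  "Z p a \<longleftrightarrow> (\<forall>i<m. int p dvd mev (F i) a)"

text \<open>A relaxation of \<open>Z\<close>, in the new coordinates, to the two polynomials to
  which Bezout's bound applies; it serves for upper bounds.\<close>

definition Z' :: "nat \<Rightarrow> (nat \<Rightarrow> int) \<Rightarrow> bool" where
  "Z' p e \<longleftrightarrow> int p dvd fT e \<and> int p dvd gT e"

lemma Z'_coord_inv: "Z p a \<Longrightarrow> Z' p (coord_inv a)"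
  using m unfolding Z_def Z'_def fT_coord_inv gT_coord_inv by (auto intro!: dvd_sum)

lemma periodic_Z: "periodic (Suc k) n (Z n)"
  unfolding periodic_def
proof (intro allI impI)
  fix a b :: "nat \<Rightarrow> int" assume *: "\<forall>j<Suc k. a j mod int n = b j mod int n"
  have "mev (F i) a mod int n = mev (F i) b mod int n" if "i < m" for i
    by (rule mev_cong_mod[OF F[OF that]]) (use * in auto)
  then show "Z n a = Z n b" unfolding Z_def dvd_eq_mod_eq_0 by auto
qed

lemma coord_mod:
  fixes e e' :: "nat \<Rightarrow> int"
  assumes "\<And>j. j < Suc k \<Longrightarrow> e j mod n = e' j mod n" "j < Suc k"
  shows "coord e j mod n = coord e' j mod n"
proof -
  have "[e j = e' j] (mod n)" if "j < Suc k" for j using assms(1)[OF that] by (simp add: cong_def)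
  then have "[coord e j = coord e' j] (mod n)"
    using assms(2) unfolding coord_def bcoord_def by (auto intro!: cong_add cong_mult)
  then show ?thesis by (simp add: cong_def)
qed

lemma coord_inv_mod:
  fixes a b :: "nat \<Rightarrow> int"
  assumes "\<And>j. j < Suc k \<Longrightarrow> coord_inv a j mod n = coord_inv b j mod n" "j < Suc k"
  shows "a j mod n = b j mod n"
  using coord_mod[of "coord_inv a" n "coord_inv b" j] assms by (simp add: coord_coord_inv)

lemma periodic_Z': "periodic (Suc k) n (Z' n)"
  unfolding periodic_def
proof (intro allI impI)
  fix a b :: "nat \<Rightarrow> int" assume *: "\<forall>j<Suc k. a j mod int n = b j mod int n"
  have "mev f (coord a) mod int n = mev f (coord b) mod int n" if "f \<in> mpolys (Suc k)" for f
    by (rule mev_cong_mod[OF that coord_mod]) (use * in auto)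
  from this[OF F0] this[OF G] show "Z' n a = Z' n b"
    unfolding Z'_def fT_def gT_def dvd_eq_mod_eq_0 by auto
qed

lemma cnt_Z_le:
  assumes p: "p > 0" shows "cnt (Suc k) p (Z p) \<le> cnt (Suc k) p (Z' p)"
  unfolding cnt_def
proof (rule card_inj_on_le)
  let ?f = "\<lambda>a. restrict (\<lambda>j. coord_inv a j mod int p) {..<Suc k}"
  show "inj_on ?f {a \<in> {..<Suc k} \<rightarrow>\<^sub>E {0..<int p}. Z p a}"
  proof (rule inj_onI)
    fix a b assume a: "a \<in> {a \<in> {..<Suc k} \<rightarrow>\<^sub>E {0..<int p}. Z p a}"
      and b: "b \<in> {a \<in> {..<Suc k} \<rightarrow>\<^sub>E {0..<int p}. Z p a}" and eq: "?f a = ?f b"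
    have "coord_inv a j mod int p = coord_inv b j mod int p" if "j < Suc k" for j
      using fun_cong[OF eq, of j] that by simp
    then have *: "a j mod int p = b j mod int p" if "j < Suc k" for j using that by (rule coord_inv_mod)
    have ab: "a \<in> {..<Suc k} \<rightarrow>\<^sub>E {0..<int p}" "b \<in> {..<Suc k} \<rightarrow>\<^sub>E {0..<int p}" using a b by blast+
    show "a = b"
    proof (rule PiE_ext[OF ab])
      fix j assume j: "j \<in> {..<Suc k}"
      then have "a j \<in> {0..<int p}" "b j \<in> {0..<int p}" using ab by (blast dest: PiE_mem)+
      then have "a j mod int p = a j" "b j mod int p = b j" by simp_all
      moreover have "a j mod int p = b j mod int p" using j by (intro *) simp
      ultimately show "a j = b j" by linarith
    qed
  qed
  show "?f ` {a \<in> {..<Suc k} \<rightarrow>\<^sub>E {0..<int p}. Z p a} \<subseteq> {a \<in> {..<Suc k} \<rightarrow>\<^sub>E {0..<int p}. Z' p a}"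
  proof
    fix e assume "e \<in> ?f ` {a \<in> {..<Suc k} \<rightarrow>\<^sub>E {0..<int p}. Z p a}"
    then obtain a where a: "Z p a" "e = ?f a" by auto
    have "Z' p e = Z' p (coord_inv a)" by (rule periodicD[OF periodic_Z']) (simp add: a)
    then show "e \<in> {a \<in> {..<Suc k} \<rightarrow>\<^sub>E {0..<int p}. Z' p a}" using a Z'_coord_inv p by auto
  qed
qed (auto intro: finite_PiE finite_subset[of _ "{..<Suc k} \<rightarrow>\<^sub>E {0..<int p}"])

text \<open>One slice for each of the \<open>p ^ (k - 1)\<close> choices of the middle
  coordinates.\<close>

lemma cnt_Z'_le:
  fixes p :: nat
  assumes p: "prime p" "\<not> int p dvd C0" "\<not> int p dvd C1"
  shows "cnt (Suc k) p (Z' p) \<le> n1 * d * p ^ (k - 1)"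
proof -
  let ?B = "{1..<k} \<rightarrow>\<^sub>E {0..<int p}"
  define S where "S e = {s \<in> {0..<int p} \<times> {0..<int p}. int p dvd fT (e(0 := fst s, k := snd s)) \<and>
    int p dvd gT (e(0 := fst s, k := snd s))}" for e :: "nat \<Rightarrow> int"
  define \<phi> where "\<phi> e = (restrict e {1..<k}, (e 0, e k))" for e :: "nat \<Rightarrow> int"
  have fin: "finite (S e)" for e unfolding S_def by (rule finite_subset[of _ "{0..<int p} \<times> {0..<int p}"]) auto
  have "cnt (Suc k) p (Z' p) \<le> card (Sigma ?B S)"
    unfolding cnt_def
  proof (rule card_inj_on_le)
    show "inj_on \<phi> {a \<in> {..<Suc k} \<rightarrow>\<^sub>E {0..<int p}. Z' p a}"
    proof (rule inj_onI)
      fix a b assume a: "a \<in> {a \<in> {..<Suc k} \<rightarrow>\<^sub>E {0..<int p}. Z' p a}"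
        and b: "b \<in> {a \<in> {..<Suc k} \<rightarrow>\<^sub>E {0..<int p}. Z' p a}" and eq: "\<phi> a = \<phi> b"
      have r: "restrict a {1..<k} = restrict b {1..<k}" "a 0 = b 0" "a k = b k"
        using eq by (auto simp: \<phi>_def)
      have mid: "a j = b j" if "j \<in> {1..<k}" for j using fun_cong[OF r(1), of j] that by simp
      have ab: "a \<in> {..<Suc k} \<rightarrow>\<^sub>E {0..<int p}" "b \<in> {..<Suc k} \<rightarrow>\<^sub>E {0..<int p}" using a b by blast+
      show "a = b"
      proof (rule PiE_ext[OF ab])
        fix j assume "j \<in> {..<Suc k}"
        then consider "j = 0" | "j = k" | "j \<in> {1..<k}" by fastforce
        then show "a j = b j" using r(2,3) mid by cases auto
      qed
    qed
    show "\<phi> ` {a \<in> {..<Suc k} \<rightarrow>\<^sub>E {0..<int p}. Z' p a} \<subseteq> Sigma ?B S"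
    proof
      fix y assume "y \<in> \<phi> ` {a \<in> {..<Suc k} \<rightarrow>\<^sub>E {0..<int p}. Z' p a}"
      then obtain a where a: "a \<in> {..<Suc k} \<rightarrow>\<^sub>E {0..<int p}" "Z' p a" "y = \<phi> a" by auto
      have "Z' p ((restrict a {1..<k})(0 := a 0, k := a k)) = Z' p a"
        by (rule periodicD[OF periodic_Z']) (use k in auto)
      then show "y \<in> Sigma ?B S" using a k by (auto simp: \<phi>_def S_def Z'_def PiE_def Pi_def)
    qed
    show "finite (Sigma ?B S)" using fin by (auto intro: finite_PiE)
  qed
  also have "\<dots> = (\<Sum>e\<in>?B. card (S e))" using fin by (intro card_SigmaI) (auto intro: finite_PiE)
  also have "\<dots> \<le> (\<Sum>e\<in>?B. n1 * d)" unfolding S_def by (intro sum_mono slice_le p)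
  also have "\<dots> = n1 * d * p ^ (k - 1)" by (simp add: card_PiE mult.commute)
  finally show ?thesis .
qed

end

subsection \<open>The truncated sieve\<close>

text \<open>The sum of the Moebius function over the n <= x all of whose prime factors lie in
  \<open>Q\<close>. The set \<open>Q\<close> may be infinite, as happens at common zeros of the
  system; the bound on n keeps the sum finite.\<close>

definition truncated_moebius :: "real \<Rightarrow> nat set \<Rightarrow> real" where
  "truncated_moebius x Q = (\<Sum>M\<in>{M\<in>small_prime_sets x. M \<subseteq> Q}. (- 1) ^ card M)"

lemma truncated_moebius_empty:
  assumes "x \<ge> 1" shows "truncated_moebius x {} = 1"
proof -
  have "{M\<in>small_prime_sets x. M \<subseteq> {}} = {{}}" using assms by (auto simp: small_prime_sets_def)
  then show ?thesis by (simp add: truncated_moebius_def)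
qed

text \<open>Counts every term. This serves at points where the eliminant vanishes and the primes
  dividing all values are not under control.\<close>

lemma truncated_moebius_error_trivial:
  assumes "x \<ge> 1"
  shows "\<bar>of_bool (Q = {}) - truncated_moebius x Q\<bar> \<le> real (card {M\<in>small_prime_sets x. M \<subseteq> Q})"
proof (cases "Q = {}")
  case True
  then show ?thesis using truncated_moebius_empty[OF assms] by simp
next
  case False
  have "\<bar>truncated_moebius x Q\<bar> \<le> (\<Sum>M\<in>{M\<in>small_prime_sets x. M \<subseteq> Q}. \<bar>(- 1) ^ card M\<bar>)"
    unfolding truncated_moebius_def by (rule sum_abs)
  with False show ?thesis by (simp add: power_abs)
qed

text \<open>
  With \<open>q = Max Q\<close>, the terms of \<open>M\<close> and \<open>insert q M\<close> cancel unless \<open>\<Prod>M \<le> x < q * \<Prod>M\<close>.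
\<close>

lemma truncated_moebius_error:
  assumes x: "x \<ge> 1" and Q: "finite Q" "\<And>p. p \<in> Q \<Longrightarrow> prime p"
  shows "\<bar>of_bool (Q = {}) - truncated_moebius x Q\<bar> \<le> real (card {(M, q). M \<in> small_prime_sets x \<and> M \<subseteq> Q \<and>
    q \<in> Q \<and> (\<forall>p\<in>M. p < q) \<and> x < real (q * \<Prod>M)})" (is "_ \<le> real (card ?T)")
proof (cases "Q = {}")
  case True
  then show ?thesis using truncated_moebius_empty[OF x] by simp
next
  case False
  define q where "q = Max Q"
  have q: "q \<in> Q" "\<And>p. p \<in> Q \<Longrightarrow> p \<le> q" using Q(1) False by (auto simp: q_def)
  define A where "A = {M\<in>small_prime_sets x. M \<subseteq> Q \<and> q \<notin> M}"
  define B where "B = {M\<in>A. real (q * \<Prod>M) \<le> x}"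
  define B' where "B' = {M\<in>small_prime_sets x. M \<subseteq> Q \<and> q \<in> M}"
  have fin: "finite A" "finite B" "finite B'"
    by (auto simp: A_def B_def B'_def)
  have "(\<Sum>M\<in>B'. (- 1) ^ card M :: real) = (\<Sum>M\<in>B. - ((- 1) ^ card M))"
  proof (rule sum.reindex_bij_witness[where i = "insert q" and j = "\<lambda>M. M - {q}"])
    fix M assume M: "M \<in> B'"
    then have f: "finite M" "q \<in> M" by (auto simp: B'_def small_prime_sets_def)
    then have pr: "\<Prod>M = q * \<Prod>(M - {q})" by (rule prod.remove)
    have "1 \<le> q" using Q(2)[OF q(1)] by (simp add: prime_nat_bounds)
    then have "\<Prod>(M - {q}) \<le> \<Prod>M" unfolding pr by simp
    then have "real (\<Prod>(M - {q})) \<le> real (\<Prod>M)" by (rule of_nat_mono)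
    moreover have Mx: "real (\<Prod>M) \<le> x" using M unfolding B'_def by (blast dest: small_prime_setsD(3))
    ultimately have "real (\<Prod>(M - {q})) \<le> x" by (rule order_trans)
    moreover have "real (q * \<Prod>(M - {q})) \<le> x" using Mx unfolding pr .
    ultimately show "M - {q} \<in> B" using M
      by (auto simp: B_def A_def B'_def small_prime_sets_def simp del: of_nat_prod of_nat_mult)
    show "insert q (M - {q}) = M" using f by auto
    have "card M = Suc (card (M - {q}))" using f by (metis card.remove)
    then show "- ((- 1) ^ card (M - {q})) = ((- 1) ^ card M :: real)" by simp
  next
    fix M assume M: "M \<in> B"
    then have "finite M" "q \<notin> M" by (auto simp: B_def A_def small_prime_sets_def)
    then show "insert q M \<in> B'" "insert q M - {q} = M"
      using M q(1) Q(2) by (auto simp: B_def A_def B'_def small_prime_sets_def)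
  qed
  moreover have "truncated_moebius x Q = (\<Sum>M\<in>A. (- 1) ^ card M) + (\<Sum>M\<in>B'. (- 1) ^ card M)"
    unfolding truncated_moebius_def
    by (subst sum.union_disjoint[symmetric]) (use fin in \<open>auto simp: A_def B'_def intro!: sum.cong\<close>)
  moreover have "(\<Sum>M\<in>A. (- 1) ^ card M :: real) = (\<Sum>M\<in>A - B. (- 1) ^ card M) + (\<Sum>M\<in>B. (- 1) ^ card M)"
    by (rule sum.subset_diff) (use fin in \<open>auto simp: B_def\<close>)
  ultimately have "truncated_moebius x Q = (\<Sum>M\<in>A - B. (- 1) ^ card M)" by (simp add: sum_negf)
  moreover have "\<bar>\<Sum>M\<in>A - B. (- 1) ^ card M :: real\<bar> \<le> (\<Sum>M\<in>A - B. \<bar>(- 1) ^ card M\<bar>)" by (rule sum_abs)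
  ultimately have "\<bar>of_bool (Q = {}) - truncated_moebius x Q\<bar> \<le> real (card (A - B))"
    using False by (simp add: power_abs)
  also have "card (A - B) \<le> card ?T"
  proof (rule card_inj_on_le[where f = "\<lambda>M. (M, q)"])
    show "(\<lambda>M. (M, q)) ` (A - B) \<subseteq> ?T"
      using q by (auto simp: A_def B_def le_neq_trans order_le_less)
    show "finite ?T"
      by (rule finite_subset[of _ "small_prime_sets x \<times> Q"]) (use Q in auto)
  qed (simp add: inj_on_def)
  finally show ?thesis by simp
qed

section \<open>Few large primes divide a given value\<close>

lemma small_prime_sets_ge_1:
  assumes "M \<in> small_prime_sets x" shows "1 \<le> real (\<Prod>M)"
  using of_nat_mono[OF small_prime_setsD(5)[OF assms], where ?'a = real] by simp

text \<open>A majorant of \<open>ln x / ln q\<close> for every prime \<open>q\<close> above all of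
  \<open>M\<close> with \<open>x < q * \<Prod>M\<close>. Since a value of size x^O(1) has O(ln x /
  ln q) prime factors of size at least q, it bounds the number of \<open>q\<close> that can occur
  together with \<open>M\<close>.\<close>

definition log_weight :: "nat set \<Rightarrow> real" where
  "log_weight M = 2 + (if M = {} then 0 else 2 * (ln (real (\<Prod>M)) / ln (real (Max M))))"

text \<open>With n the product of \<open>M\<close>, \<open>x < q * n\<close> gives ln x <= ln q + ln
  n. Since \<open>Max M < q\<close>, the last term is at most \<open>ln q\<close> times the ratio of
  \<open>ln n\<close> to \<open>ln (Max M)\<close>.\<close>

lemma log_weight_ge:
  assumes x: "x \<ge> 1" and M: "M \<in> small_prime_sets x"
    and q: "prime q" "\<And>p. p \<in> M \<Longrightarrow> p < q" "x < real (q * \<Prod>M)"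
  shows "ln x \<le> log_weight M * ln (real q)"
proof -
  define t where "t = real (\<Prod>M)"
  have t: "t \<ge> 1" unfolding t_def by (rule small_prime_sets_ge_1[OF M])
  have lq: "ln (real q) \<ge> 0" using prime_nat_bounds(4)[OF q(1)] .
  have "ln x \<le> ln (real q * t)" using x q(3) by (subst ln_le_cancel_iff) (auto simp: t_def)
  also have "\<dots> = ln (real q) + ln t" using t prime_nat_bounds(6)[OF q(1)] by (intro ln_mult_pos) auto
  finally have 1: "ln x \<le> ln (real q) + ln t" .
  show ?thesis
  proof (cases "M = {}")
    case True
    then show ?thesis using 1 lq by (simp add: log_weight_def t_def)
  next
    case False
    have mx: "Max M \<in> M" using False small_prime_setsD(1)[OF M] by simp
    have P: "real (Max M) \<ge> 2" using prime_nat_bounds(7)[OF small_prime_setsD(2)[OF M mx]] .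
    have lP: "ln (real (Max M)) > 0" using P by simp
    have "ln (real (Max M)) \<le> ln (real q)"
      using q(2)[OF mx] P by (subst ln_le_cancel_iff) auto
    then have 2: "2 * ln t \<le> 2 * (ln t / ln (real (Max M))) * ln (real q)"
      using lP t by (simp add: field_simps mult_left_mono)
    have "0 \<le> ln t / ln (real (Max M))" using lP t by simp
    then have 3: "log_weight M * ln (real q) = 2 * ln (real q) + 2 * (ln t / ln (real (Max M))) * ln (real q)"
      using False by (simp add: log_weight_def t_def algebra_simps)
    show ?thesis using 1 2 3 lq t ln_ge_zero[OF t] by linarith
  qed
qed

lemma log_weight_nonneg:
  assumes M: "M \<in> small_prime_sets x" shows "log_weight M \<ge> 0"
proof (cases "M = {}")
  case False
  then have mx: "Max M \<in> M" using small_prime_setsD(1)[OF M] by simp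
  have "ln (real (Max M)) \<ge> 0" using prime_nat_bounds(4)[OF small_prime_setsD(2)[OF M mx]] .
  moreover have "ln (real (\<Prod>M)) \<ge> 0" using small_prime_sets_ge_1[OF M] by simp
  ultimately show ?thesis by (simp add: log_weight_def)
qed (simp add: log_weight_def)

text \<open>The logarithms of the distinct prime divisors of \<open>N\<close> sum to at most
  \<open>ln \<bar>N\<bar>\<close>, and for each \<open>q\<close> in \<open>Q\<close> the number
  \<open>l\<close> is at most \<open>W * ln q\<close>.\<close>

lemma card_large_prime_divisors_le:
  assumes N: "N \<noteq> (0::int)" and Q: "\<And>q. q \<in> Q \<Longrightarrow> prime q \<and> int q dvd N \<and> l \<le> W * ln (real q)"
    and W: "W \<ge> 0"
  shows "finite Q" "real (card Q) * l \<le> W * ln \<bar>real_of_int N\<bar>"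
proof -
  have n: "nat \<bar>N\<bar> \<ge> 1" using N by simp
  have "q \<in> prime_factors (nat \<bar>N\<bar>)" if "q \<in> Q" for q
    using Q[OF that] n by (auto simp: prime_factors_dvd nat_abs_dvd_iff int_dvd_int_iff[symmetric] simp del: int_dvd_int_iff)
  then have sub: "Q \<subseteq> prime_factors (nat \<bar>N\<bar>)" by blast
  then show fin: "finite Q" by (rule finite_subset) simp
  have "real (card Q) * l = (\<Sum>q\<in>Q. l)" by simp
  also have "\<dots> \<le> (\<Sum>q\<in>Q. W * ln (real q))" by (rule sum_mono) (use Q in auto)
  also have "\<dots> = W * (\<Sum>q\<in>Q. ln (real q))" by (simp add: sum_distrib_left)
  also have "\<dots> \<le> W * (\<Sum>q\<in>prime_factors (nat \<bar>N\<bar>). ln (real q))"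
    using sub W prime_nat_bounds(4) by (intro mult_left_mono sum_mono2) auto
  also have "\<dots> \<le> W * ln (real (nat \<bar>N\<bar>))" by (rule mult_left_mono[OF sum_ln_prime_factors_le[OF n] W])
  finally show "real (card Q) * l \<le> W * ln \<bar>real_of_int N\<bar>" by simp
qed

lemma mev_bound:
  fixes b :: "nat \<Rightarrow> int" and Y :: real
  assumes f: "f \<in> mpolys k" and Y: "Y \<ge> 1" and b: "\<And>j. j < k \<Longrightarrow> \<bar>real_of_int (b j)\<bar> \<le> Y"
  shows "\<bar>real_of_int (mev f b)\<bar> \<le> (\<Sum>t\<in>Poly_Mapping.keys f. \<bar>real_of_int (Poly_Mapping.lookup f t)\<bar>) * Y ^ total_deg f"
proof -
  have mon: "\<bar>real_of_int (monom_eval b t)\<bar> \<le> Y ^ total_deg f" if t: "t \<in> Poly_Mapping.keys f" for t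
  proof -
    have "\<bar>real_of_int (monom_eval b t)\<bar> = (\<Prod>j\<in>Poly_Mapping.keys t. \<bar>real_of_int (b j)\<bar> ^ Poly_Mapping.lookup t j)"
      by (simp add: monom_eval_def abs_prod power_abs)
    also have "\<dots> \<le> (\<Prod>j\<in>Poly_Mapping.keys t. Y ^ Poly_Mapping.lookup t j)"
    proof (rule prod_mono, intro conjI)
      fix j assume "j \<in> Poly_Mapping.keys t"
      then have "j < k" using f t by (auto simp: mpolys_def)
      then show "\<bar>real_of_int (b j)\<bar> ^ Poly_Mapping.lookup t j \<le> Y ^ Poly_Mapping.lookup t j"
        by (simp add: power_mono b)
    qed simp
    also have "\<dots> = Y ^ monom_deg t" by (simp add: power_sum monom_deg_def)
    also have "\<dots> \<le> Y ^ total_deg f" using monom_deg_le_total_deg[OF t] Y by (intro power_increasing) auto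
    finally show ?thesis .
  qed
  have "\<bar>real_of_int (mev f b)\<bar> \<le>
      (\<Sum>t\<in>Poly_Mapping.keys f. \<bar>real_of_int (Poly_Mapping.lookup f t) * real_of_int (monom_eval b t)\<bar>)"
    by (simp add: mev_def)
  also have "\<dots> \<le> (\<Sum>t\<in>Poly_Mapping.keys f. \<bar>real_of_int (Poly_Mapping.lookup f t)\<bar> * Y ^ total_deg f)"
    unfolding abs_mult by (intro sum_mono mult_left_mono mon) auto
  finally show ?thesis by (simp add: sum_distrib_right)
qed

context gcd_system
begin

text \<open>Bezout's bound is \<open>n1 * d\<close>, which is at most \<open>d ^ 2\<close> and, as
  \<open>m \<ge> 2\<close>, at most \<open>d ^ m\<close>. This number per prime becomes the exponent
  of the logarithm.\<close>

definition C :: nat where "C = d ^ m"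

lemma C_bounds: "C \<ge> 1" "n1 * d \<le> C" "n1 \<le> C"
proof -
  show "C \<ge> 1" using d by (simp add: C_def)
  have "d ^ 2 \<le> C" unfolding C_def using d m by (intro power_increasing) auto
  moreover have "n1 * d \<le> d * d" by (rule mult_right_mono[OF n1_le]) simp
  ultimately show 1: "n1 * d \<le> C" unfolding power2_eq_square by linarith
  have "n1 * 1 \<le> n1 * d" using d by (intro mult_left_mono) auto
  then show "n1 \<le> C" using 1 by linarith
qed

lemma C0: "C0 \<noteq> 0" and C1: "C1 \<noteq> 0"
  using top0 topR by (auto simp: C0_def C1_def)

definition bad :: "nat set" where "bad = {p. prime p \<and> int p dvd C0 * C1}"
text \<open>At a bad prime only the trivial bound \<open>p ^ Suc k\<close> is available, which
  exceeds the generic bound at most by a factor \<open>p ^ 2\<close>. A square-free number contains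
  each bad prime at most once, so \<open>KB\<close> absorbs all these losses.\<close>

definition KB :: real where "KB = (\<Prod>p\<in>bad. real p ^ 2)"

lemma finite_bad: "finite bad"
proof (rule finite_subset)
  show "bad \<subseteq> {..nat \<bar>C0 * C1\<bar>}"
  proof
    fix p assume "p \<in> bad"
    then have "\<bar>int p\<bar> \<le> \<bar>C0 * C1\<bar>" using C0 C1 by (intro dvd_imp_le_int) (auto simp: bad_def)
    then show "p \<in> {..nat \<bar>C0 * C1\<bar>}" by simp
  qed
qed simp

lemma KB_ge_1: "KB \<ge> 1"
  unfolding KB_def by (intro prod_ge_1) (auto simp: bad_def prime_nat_bounds)

lemma prod_le_KB:
  fixes f g :: "nat \<Rightarrow> real"
  assumes M: "finite M" and f: "\<And>p. p \<in> M \<Longrightarrow> 0 \<le> f p"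
    "\<And>p. p \<in> M \<Longrightarrow> f p \<le> (if p \<in> bad then real p ^ 2 else 1) * g p"
    and g: "\<And>p. p \<in> M \<Longrightarrow> 0 \<le> g p"
  shows "prod f M \<le> KB * prod g M"
proof -
  have ge: "real p ^ 2 \<ge> 1" if "p \<in> bad" for p using that by (auto simp: bad_def prime_nat_bounds)
  have "prod f M \<le> (\<Prod>p\<in>M. (if p \<in> bad then real p ^ 2 else 1) * g p)"
    using f by (intro prod_mono) auto
  also have "\<dots> = (\<Prod>p\<in>M. if p \<in> bad then real p ^ 2 else 1) * prod g M" by (rule prod.distrib)
  also have "(\<Prod>p\<in>M. if p \<in> bad then real p ^ 2 else 1) = (\<Prod>p\<in>M \<inter> bad. real p ^ 2)"
    using M by (simp add: prod.inter_restrict)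
  also have "(\<Prod>p\<in>M \<inter> bad. real p ^ 2) * prod g M \<le> KB * prod g M"
    unfolding KB_def using ge g finite_bad by (intro mult_right_mono prod_mono2 prod_nonneg) auto
  finally show ?thesis .
qed

lemma cnt_Z'_real_le:
  assumes p: "prime p"
  shows "real (cnt (Suc k) p (Z' p)) \<le> (if p \<in> bad then real p ^ 2 else 1) * (real C * real p ^ (k - 1))"
proof (cases "p \<in> bad")
  case True
  have "cnt (Suc k) p (Z' p) \<le> card ({..<Suc k} \<rightarrow>\<^sub>E {0..<int p})"
    unfolding cnt_def by (rule card_mono) (auto intro: finite_PiE)
  also have "\<dots> = p ^ Suc k" by (simp add: card_PiE)
  finally have "real (cnt (Suc k) p (Z' p)) \<le> real p ^ Suc k" by (metis of_nat_le_iff of_nat_power)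
  also have "\<dots> = real p ^ 2 * real p ^ (k - 1)"
    using k by (cases k) (auto simp: power2_eq_square)
  also have "\<dots> \<le> real p ^ 2 * (real C * real p ^ (k - 1))"
    using C_bounds(1) by (intro mult_left_mono mult_right_mono[of 1 "real C", simplified]) auto
  finally show ?thesis using True by simp
next
  case False
  then have "\<not> int p dvd C0" "\<not> int p dvd C1" using p by (auto simp: bad_def)
  from cnt_Z'_le[OF p this] have "cnt (Suc k) p (Z' p) \<le> C * p ^ (k - 1)"
    using C_bounds(2) by (meson le_trans mult_le_mono1)
  then have "real (cnt (Suc k) p (Z' p)) \<le> real (C * p ^ (k - 1))" by (rule of_nat_mono)
  then show ?thesis using False by simp
qed

lemma prod_cnt_Z'_le:
  assumes M: "finite M" "\<And>p. p \<in> M \<Longrightarrow> prime p"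
  shows "real (\<Prod>p\<in>M. cnt (Suc k) p (Z' p)) \<le> KB * (\<Prod>p\<in>M. real C * real p ^ (k - 1))"
  unfolding of_nat_prod using M cnt_Z'_real_le by (intro prod_le_KB) auto

lemma fy_roots_real_le:
  assumes p: "prime p"
  shows "real (card {y \<in> {0..<int p}. int p dvd poly (fy e) y}) \<le> (if p \<in> bad then real p ^ 2 else 1) * real C"
proof -
  have "real (card {y \<in> {0..<int p}. int p dvd poly (fy e) y}) \<le> (if int p dvd C0 then real p else real n1)"
    using fy_roots_le[OF p, of e] by (simp split: if_splits)
  also have "\<dots> \<le> (if p \<in> bad then real p ^ 2 else 1) * real C"
  proof -
    have p1: "real p \<ge> 1" using prime_nat_bounds(5)[OF p] .
    have "real p * 1 \<le> real p ^ 2 * real C"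
      using p1 C_bounds(1) by (intro mult_mono) (auto simp: power2_eq_square)
    moreover have "real n1 \<le> 1 * real C" using C_bounds(3) by simp
    moreover have "1 * real C \<le> real p ^ 2 * real C" using p1 by (intro mult_right_mono) auto
    moreover have "int p dvd C0 \<Longrightarrow> p \<in> bad" using p by (simp add: bad_def)
    ultimately show ?thesis by auto
  qed
  finally show ?thesis .
qed

text \<open>The degree bound can fail only at a prime dividing \<open>C0\<close>; such a prime is at
  most \<open>\<bar>C0\<bar>\<close>, and so is its number of residues.\<close>

lemma fy_roots_const_le:
  assumes "prime q" shows "card {y \<in> {0..<int q}. int q dvd poly (fy e) y} \<le> n1 + nat \<bar>C0\<bar>"
proof (cases "int q dvd C0")
  case True
  then have "\<bar>int q\<bar> \<le> \<bar>C0\<bar>" using C0 by (intro dvd_imp_le_int)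
  then show ?thesis using fy_roots_le[OF assms, of e] True by simp
next
  case False
  then show ?thesis using fy_roots_le[OF assms, of e] by simp
qed

lemma fT_mod:
  fixes e e' :: "nat \<Rightarrow> int"
  assumes "\<And>j. j < Suc k \<Longrightarrow> e j mod n = e' j mod n" shows "fT e mod n = fT e' mod n"
  unfolding fT_def by (rule mev_cong_mod[OF F0 coord_mod]) (use assms in auto)

lemma poly_fy_mod:
  assumes "y mod n = z mod n" shows "poly (fy e) y mod n = poly (fy e) z mod n"
proof -
  have "poly (fy e) y = fT (e(k := y))" for y
  proof -
    have "fy (e(k := y)) = fy e" by (rule fy_cong) simp
    then show ?thesis using poly_fy[of "e(k := y)"] by simp
  qed
  then show ?thesis using fT_mod[of "e(k := y)" n "e(k := z)"] assms by simp
qed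

text \<open>The Chinese remainder theorem in one variable: the root count modulo a square-free
  number is the product of the counts modulo its primes.\<close>

lemma card_fy_roots_prime_set_le:
  assumes M: "finite M" "\<And>p. p \<in> M \<Longrightarrow> prime p"
  shows "real (card {y \<in> {0..<int (\<Prod>M)}. \<forall>p\<in>M. int p dvd poly (fy e) y}) \<le> KB * real C ^ card M"
proof -
  define Y where "Y p a \<longleftrightarrow> int p dvd poly (fy e) (a 0)" for p and a :: "nat \<Rightarrow> int"
  have per: "periodic 1 p (Y p)" for p
    unfolding periodic_def
  proof (intro allI impI)
    fix a b :: "nat \<Rightarrow> int" assume "\<forall>j<1. a j mod int p = b j mod int p"
    then have "a 0 mod int p = b 0 mod int p" by simp
    from poly_fy_mod[OF this, of e] show "Y p a = Y p b" by (simp only: Y_def dvd_eq_mod_eq_0)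
  qed
  have one: "cnt 1 n (\<lambda>a. Q (a 0)) = card {y \<in> {0..<int n}. Q y}" for n Q
    unfolding cnt_def
  proof (rule bij_betw_same_card)
    show "bij_betw (\<lambda>a. a 0) {a \<in> {..<1::nat} \<rightarrow>\<^sub>E {0..<int n}. Q (a 0)} {y \<in> {0..<int n}. Q y}"
    proof (rule bij_betw_byWitness[where f' = "\<lambda>y. restrict (\<lambda>_. y) {..<1}"])
      show "\<forall>a\<in>{a \<in> {..<1::nat} \<rightarrow>\<^sub>E {0..<int n}. Q (a 0)}. restrict (\<lambda>_. a 0) {..<1} = a"
        by (auto simp: PiE_def extensional_def fun_eq_iff)
      show "\<forall>y\<in>{y \<in> {0..<int n}. Q y}. restrict (\<lambda>_. y) {..<1} (0 :: nat) = y" by simp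
      show "(\<lambda>a. a 0) ` {a \<in> {..<1::nat} \<rightarrow>\<^sub>E {0..<int n}. Q (a 0)} \<subseteq> {y \<in> {0..<int n}. Q y}"
      proof (rule image_subsetI)
        fix a assume a: "a \<in> {a \<in> {..<1::nat} \<rightarrow>\<^sub>E {0..<int n}. Q (a 0)}"
        then have "a 0 \<in> {0..<int n}" by (intro PiE_mem[of a "{..<1}" "\<lambda>_. {0..<int n}"]) simp_all
        with a show "a 0 \<in> {y \<in> {0..<int n}. Q y}" by simp
      qed
      show "(\<lambda>y. restrict (\<lambda>_. y) {..<1}) ` {y \<in> {0..<int n}. Q y} \<subseteq> {a \<in> {..<1::nat} \<rightarrow>\<^sub>E {0..<int n}. Q (a 0)}"
        by (rule image_subsetI) simp
    qed
  qed
  have "card {y \<in> {0..<int (\<Prod>M)}. \<forall>p\<in>M. int p dvd poly (fy e) y} = cnt 1 (\<Prod>M) (\<lambda>a. \<forall>p\<in>M. Y p a)"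
    unfolding Y_def by (rule one[symmetric])
  also have "\<dots> = (\<Prod>p\<in>M. cnt 1 p (Y p))" using M per by (intro cnt_prime_set) auto
  also have "\<dots> = (\<Prod>p\<in>M. card {y \<in> {0..<int p}. int p dvd poly (fy e) y})"
    unfolding Y_def by (rule prod.cong[OF refl]) (rule one)
  finally have eq: "card {y \<in> {0..<int (\<Prod>M)}. \<forall>p\<in>M. int p dvd poly (fy e) y} =
    (\<Prod>p\<in>M. card {y \<in> {0..<int p}. int p dvd poly (fy e) y})" .
  have "real (\<Prod>p\<in>M. card {y \<in> {0..<int p}. int p dvd poly (fy e) y}) \<le> KB * (\<Prod>p\<in>M. real C)"
    unfolding of_nat_prod using M fy_roots_real_le by (intro prod_le_KB) auto
  then show ?thesis unfolding eq by simp
qed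

text \<open>Chosen so that \<open>coord_inv\<close> maps \<open>Box X\<close> into the points with
  \<open>\<bar>e j\<bar> \<le> H * X\<close> for \<open>j < k\<close>.\<close>

definition H :: nat where "H = 1 + (\<Sum>j<k. nat \<bar>c j\<bar>)"

lemma H_ge: "j < k \<Longrightarrow> 1 + \<bar>c j\<bar> \<le> int H" "H \<ge> 1"
proof -
  assume "j < k"
  then have "nat \<bar>c j\<bar> \<le> (\<Sum>j<k. nat \<bar>c j\<bar>)" by (intro member_le_sum) auto
  then show "1 + \<bar>c j\<bar> \<le> int H" unfolding H_def by linarith
qed (simp add: H_def)

definition Box :: "nat \<Rightarrow> (nat \<Rightarrow> int) set" where "Box X = {..<Suc k} \<rightarrow>\<^sub>E {1..<1 + int X}"

lemma BoxD: "a \<in> Box X \<Longrightarrow> j < Suc k \<Longrightarrow> 1 \<le> a j \<and> a j \<le> int X"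
  unfolding Box_def by (drule PiE_mem[where x = j]) auto

lemma finite_Box: "finite (Box X)" unfolding Box_def by (intro finite_PiE) auto

lemma coord_inv_bound:
  assumes a: "a \<in> Box X" and j: "j < k"
  shows "\<bar>coord_inv a j\<bar> \<le> int H * int X"
proof -
  have b: "1 \<le> a j" "a j \<le> int X" "1 \<le> a 0" "a 0 \<le> int X" "1 \<le> a k" "a k \<le> int X"
    using BoxD[OF a] j by auto
  have d0: "\<bar>a 0 - a k\<bar> \<le> int X" "\<bar>a j - a k\<bar> \<le> int X" using b by auto
  have "\<bar>coord_inv a j\<bar> \<le> \<bar>a j - a k\<bar> + \<bar>c j\<bar> * \<bar>a 0 - a k\<bar>"
  proof (cases "j = 0")
    case True
    then show ?thesis by (simp add: coord_inv_def)
  next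
    case False
    then show ?thesis using j abs_triangle_ineq4[of "a j - a k" "c j * (a 0 - a k)"]
      by (simp add: coord_inv_def abs_mult)
  qed
  also have "\<dots> \<le> int X + \<bar>c j\<bar> * int X" using d0 by (intro add_mono mult_left_mono) auto
  also have "\<dots> = (1 + \<bar>c j\<bar>) * int X" by (simp add: algebra_simps)
  also have "\<dots> \<le> int H * int X" using H_ge(1)[OF j] by (intro mult_right_mono) auto
  finally show ?thesis .
qed

lemma coord_inv_k: "coord_inv a k = a k"
  using k by (simp add: coord_inv_def)

lemma coord_inv_inj:
  assumes "a \<in> Box X" "b \<in> Box X" "\<And>j. j < Suc k \<Longrightarrow> coord_inv a j = coord_inv b j"
  shows "a = b"
proof (rule PiE_ext[OF assms(1)[unfolded Box_def] assms(2)[unfolded Box_def]])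
  fix j assume "j \<in> {..<Suc k}"
  moreover have "coord (coord_inv a) j = coord (coord_inv b) j" if "j < Suc k"
    using assms(3) that k by (simp add: coord_def bcoord_def)
  ultimately show "a j = b j" by (simp add: coord_coord_inv)
qed

lemma ln_RT_le:
  "\<exists>K>0. \<forall>x\<ge>3. \<forall>e :: nat \<Rightarrow> int. (\<forall>j<k. \<bar>real_of_int (e j)\<bar> \<le> real H * x) \<longrightarrow> RT e \<noteq> 0 \<longrightarrow>
     ln \<bar>real_of_int (RT e)\<bar> \<le> K * ln x"
proof -
  define L where "L = (\<Sum>t\<in>Poly_Mapping.keys R. \<bar>real_of_int (Poly_Mapping.lookup R t)\<bar>)"
  define n where "n = total_deg R"
  define K where "K = \<bar>ln (max 1 L * (real H ^ 2) ^ n)\<bar> + real n + 1"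
  show ?thesis
  proof (intro exI[of _ K] conjI allI impI)
    fix x :: real and e :: "nat \<Rightarrow> int"
    assume x: "x \<ge> 3" and e: "\<forall>j<k. \<bar>real_of_int (e j)\<bar> \<le> real H * x" and nz: "RT e \<noteq> 0"
    have lx: "ln x \<ge> 1" using x exp_le by (subst ln_ge_iff) auto
    have H1: "real H \<ge> 1" using H_ge(2) by simp
    \<comment> \<open>One factor \<open>H\<close> bounds the \<open>e j\<close>, the other the
      passage from \<open>e\<close> to \<open>bcoord e\<close>.\<close>
    define Y where "Y = real H ^ 2 * x"
    have Y: "Y \<ge> 1" unfolding Y_def using H1 x by (intro mult_ge1_I[of _ x]) auto
    have b: "\<bar>real_of_int (bcoord e j)\<bar> \<le> Y" if j: "j < k" for j
    proof -
      have e0: "\<bar>real_of_int (e j)\<bar> \<le> real H * x" "\<bar>real_of_int (e 0)\<bar> \<le> real H * x" using e j k by auto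
      have hx: "real H * x \<ge> 0" using H1 x by simp
      have "\<bar>real_of_int (bcoord e j)\<bar> \<le> \<bar>real_of_int (e j)\<bar> + \<bar>real_of_int (c j) * real_of_int (e 0)\<bar>"
        using j by (auto simp: bcoord_def intro: abs_triangle_ineq)
      also have "\<dots> \<le> real H * x + \<bar>real_of_int (c j)\<bar> * (real H * x)"
        unfolding abs_mult using e0 by (intro add_mono mult_left_mono) auto
      also have "\<dots> = (1 + \<bar>real_of_int (c j)\<bar>) * (real H * x)" by (simp add: algebra_simps)
      also have "\<dots> \<le> real H * (real H * x)"
      proof (rule mult_right_mono[OF _ hx])
        have "real_of_int (1 + \<bar>c j\<bar>) \<le> real_of_int (int H)" using H_ge(1)[OF j] by (simp only: of_int_le_iff)
        then show "1 + \<bar>real_of_int (c j)\<bar> \<le> real H" by simp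
      qed
      finally show ?thesis by (simp add: Y_def power2_eq_square)
    qed
    have "\<bar>real_of_int (RT e)\<bar> \<le> L * Y ^ n" unfolding RT_def L_def n_def by (rule mev_bound[OF R Y b])
    also have "\<dots> \<le> max 1 L * Y ^ n" using Y by (intro mult_right_mono) auto
    also have "\<dots> = (max 1 L * (real H ^ 2) ^ n) * x ^ n" by (simp add: Y_def power_mult_distrib)
    finally have "ln \<bar>real_of_int (RT e)\<bar> \<le> ln ((max 1 L * (real H ^ 2) ^ n) * x ^ n)"
      using nz by (subst ln_le_cancel_iff) auto
    also have "\<dots> = ln (max 1 L * (real H ^ 2) ^ n) + real n * ln x"
      using x H1 by (subst ln_mult_pos) (auto simp: ln_realpow intro!: mult_pos_pos)
    also have "\<dots> \<le> \<bar>ln (max 1 L * (real H ^ 2) ^ n)\<bar> * ln x + real n * ln x"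
    proof -
      have "ln (max 1 L * (real H ^ 2) ^ n) \<le> \<bar>ln (max 1 L * (real H ^ 2) ^ n)\<bar> * 1" by simp
      also have "\<dots> \<le> \<bar>ln (max 1 L * (real H ^ 2) ^ n)\<bar> * ln x" using lx by (intro mult_left_mono) auto
      finally show ?thesis by simp
    qed
    also have "\<dots> \<le> K * ln x" using lx by (simp add: K_def distrib_right)
    finally show "ln \<bar>real_of_int (RT e)\<bar> \<le> K * ln x" .
  qed (simp add: K_def add_nonneg_pos)
qed

section \<open>Points off the hypersurface R = 0\<close>

lemma ceiling_block:
  assumes "n > 0" "y \<le> L"
  shows "(y::nat) < n * (L div n + 1)"
proof -
  have "L = n * (L div n) + L mod n" by simp
  moreover have "L mod n < n" using assms by simp
  ultimately show ?thesis using assms(2) unfolding distrib_left by linarith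
qed

text \<open>What is left of a point of the box, in the new coordinates, when its last coordinate is
  known only modulo the product of \<open>M\<close>. The zeros modulo the primes of \<open>M\<close>
  depend on no more than this.\<close>

definition E1 :: "nat \<Rightarrow> nat set \<Rightarrow> (nat \<Rightarrow> int) set" where
  "E1 X M = {e \<in> {..<Suc k} \<rightarrow>\<^sub>E UNIV. (\<forall>j<k. \<bar>e j\<bar> \<le> int H * int X) \<and> e k \<in> {0..<int (\<Prod>M)} \<and> (\<forall>p\<in>M. Z' p e)}"

text \<open>With n the product of \<open>M\<close> and w its number of primes, each of the first
  \<open>k\<close> sides holds O(x / n) blocks of length n, and the last coordinate is a single
  block. A cube of blocks contains O(C^w n^(k-1)) zeros, so the count is O(x^k C^w / n).\<close>

lemma card_E1_le:
  assumes x: "x \<ge> 1" and X: "X = nat \<lfloor>x\<rfloor>" and M: "M \<in> small_prime_sets x"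
  shows "finite (E1 X M)" "real (card (E1 X M)) \<le> real (2 * H + 2) ^ k * KB * x ^ k * (\<Prod>p\<in>M. real C / real p)"
proof -
  define n where "n = \<Prod>M"
  have n1: "n \<ge> 1" "real n \<ge> 1" "real n \<le> x"
    unfolding n_def by (rule small_prime_setsD(5)[OF M] small_prime_sets_ge_1[OF M] small_prime_setsD(3)[OF M])+
  have Xx: "real X \<le> x" using x by (simp add: X)
  have Mp: "finite M" "\<And>p. p \<in> M \<Longrightarrow> prime p" using small_prime_setsD[OF M] by auto
  define r where "r = (2 * H * X) div n + 1"
  define lo where "lo j = (if j < k then - int (H * X) else 0)" for j
  \<comment> \<open>The last coordinate runs through exactly one residue system modulo
    \<open>n\<close>.\<close>
  define rr where "rr j = (if j < k then r else 1)" for j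
  define A where "A = {a \<in> PiE {..<Suc k} (\<lambda>j. {lo j..<lo j + int n * int (rr j)}). \<forall>p\<in>M. Z' p a}"
  have sub: "E1 X M \<subseteq> A"
  proof
    fix e assume e: "e \<in> E1 X M"
    have "e j \<in> {lo j..<lo j + int n * int (rr j)}" if j: "j < Suc k" for j
    proof (cases "j < k")
      case True
      then have b: "\<bar>e j\<bar> \<le> int (H * X)" using e by (simp add: E1_def)
      have "nat (e j + int (H * X)) < n * (2 * H * X div n + 1)"
      proof (rule ceiling_block)
        have "int (2 * H * X) = 2 * int (H * X)" by simp
        then show "nat (e j + int (H * X)) \<le> 2 * H * X" using b unfolding nat_le_iff by linarith
      qed (use n1 in simp)
      then have "e j + int (H * X) < int (n * r)" unfolding r_def using b by linarith
      then show ?thesis using b True by (simp add: lo_def rr_def)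
    next
      case False
      then show ?thesis using e j by (simp add: E1_def lo_def rr_def n_def less_Suc_eq)
    qed
    then show "e \<in> A" using e unfolding A_def E1_def PiE_def by auto
  qed
  have finA: "finite A" unfolding A_def
    by (rule finite_subset[of _ "PiE {..<Suc k} (\<lambda>j. {lo j..<lo j + int n * int (rr j)})"]) (auto intro!: finite_PiE)
  show "finite (E1 X M)" using sub finA by (rule finite_subset)
  have cA: "card A = r ^ k * (\<Prod>p\<in>M. cnt (Suc k) p (Z' p))"
  proof -
    have per: "periodic (Suc k) n (\<lambda>a. \<forall>p\<in>M. Z' p a)"
      unfolding n_def by (rule periodic_prime_set) (use Mp periodic_Z' in auto)
    have "card A = (\<Prod>j<Suc k. rr j) * cnt (Suc k) n (\<lambda>a. \<forall>p\<in>M. Z' p a)"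
      unfolding A_def
      by (rule box_count[OF _ per]) (use n1 in simp)
    also have "(\<Prod>j<Suc k. rr j) = r ^ k" by (simp add: rr_def)
    also have "cnt (Suc k) n (\<lambda>a. \<forall>p\<in>M. Z' p a) = (\<Prod>p\<in>M. cnt (Suc k) p (Z' p))"
      unfolding n_def by (rule cnt_prime_set) (use Mp periodic_Z' in auto)
    finally show ?thesis .
  qed
  have "real r \<le> real (2 * H * X) / real n + 1"
    using of_nat_div_le_of_nat[of "2 * H * X" n, where ?'a = real] by (simp add: r_def)
  \<comment> \<open>The 1 from rounding is absorbed because \<open>n \<le> x\<close>; the
    restriction of the sieve to products up to \<open>x\<close> is essential here.\<close>
  also have "\<dots> \<le> real (2 * H) * x / real n + 2 * (x / real n)"
  proof (rule add_mono)
    have "real (2 * H) * real X \<le> real (2 * H) * x" using Xx by (intro mult_left_mono) auto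
    then show "real (2 * H * X) / real n \<le> real (2 * H) * x / real n" by (simp add: divide_right_mono)
    show "1 \<le> 2 * (x / real n)" using n1 by (simp add: field_simps)
  qed
  also have "\<dots> = real (2 * H + 2) * x / real n" by (simp add: add_divide_distrib algebra_simps)
  finally have r: "real r \<le> real (2 * H + 2) * x / real n" .
  have "real (card (E1 X M)) \<le> real (card A)" using card_mono[OF finA sub] by simp
  also have "\<dots> = real r ^ k * real (\<Prod>p\<in>M. cnt (Suc k) p (Z' p))" by (simp add: cA)
  also have "\<dots> \<le> (real (2 * H + 2) * x / real n) ^ k * (KB * (\<Prod>p\<in>M. real C * real p ^ (k - 1)))"
    using r Mp x by (intro mult_mono power_mono prod_cnt_Z'_le) (auto intro: prod_nonneg)
  also have "(\<Prod>p\<in>M. real C * real p ^ (k - 1)) = real C ^ card M * real n ^ (k - 1)"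
    by (simp add: prod.distrib n_def prod_power_distrib)
  also have "(real (2 * H + 2) * x / real n) ^ k * (KB * (real C ^ card M * real n ^ (k - 1))) =
      real (2 * H + 2) ^ k * KB * x ^ k * (real C ^ card M * (real n ^ (k - 1) / real n ^ k))"
    by (simp add: power_mult_distrib power_divide)
  also have "real n ^ (k - 1) / real n ^ k = 1 / real n" using n1 k by (cases k) auto
  also have "real C ^ card M * (1 / real n) = (\<Prod>p\<in>M. real C / real p)" by (simp add: prod_dividef n_def)
  finally show "real (card (E1 X M)) \<le> real (2 * H + 2) ^ k * KB * x ^ k * (\<Prod>p\<in>M. real C / real p)" .
qed

text \<open>The pairs counted by \<open>truncated_moebius_error\<close> for one \<open>M\<close>, at
  the points where the eliminant does not vanish.\<close>

definition T1 :: "real \<Rightarrow> nat \<Rightarrow> nat set \<Rightarrow> ((nat \<Rightarrow> int) \<times> nat) set" where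
  "T1 x X M = {(a, q). a \<in> Box X \<and> RT (coord_inv a) \<noteq> 0 \<and> prime q \<and> (\<forall>p\<in>M. Z p a) \<and> Z q a \<and>
     (\<forall>p\<in>M. p < q) \<and> x < real (q * \<Prod>M)}"

lemma RT_dvd: "Z' q e \<Longrightarrow> int q dvd RT e"
  unfolding Z'_def elimination[of e, symmetric] by (simp add: dvd_add)

text \<open>A pair is recovered from its element of \<open>E1\<close>, from \<open>q\<close> and
  from the last coordinate modulo \<open>q\<close>. The element of \<open>E1\<close> fixes
  \<open>RT\<close>, which leaves O(\<open>log_weight M\<close>) primes \<open>q\<close>, and it
  fixes \<open>fy\<close>, whose roots modulo \<open>q\<close> are bounded in number.\<close>

lemma card_T1_le:
  "\<exists>K>0. \<forall>x\<ge>3. \<forall>X. X = nat \<lfloor>x\<rfloor> \<longrightarrow> (\<forall>M\<in>small_prime_sets x. finite (T1 x X M) \<and>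
     real (card (T1 x X M)) \<le> K * x ^ k * ((\<Prod>p\<in>M. real C / real p) * log_weight M))"
proof -
  obtain KR where KR: "KR > 0" and lnR: "\<And>x (e :: nat \<Rightarrow> int). x \<ge> 3 \<Longrightarrow> (\<forall>j<k. \<bar>real_of_int (e j)\<bar> \<le> real H * x) \<Longrightarrow> RT e \<noteq> 0 \<Longrightarrow>
     ln \<bar>real_of_int (RT e)\<bar> \<le> KR * ln x" using ln_RT_le by blast
  define Kr where "Kr = n1 + nat \<bar>C0\<bar>"
  have Kr: "Kr \<ge> 1" using C0 by (simp add: Kr_def)
  show ?thesis
  proof (intro exI[of _ "real (2 * H + 2) ^ k * KB * KR * real Kr"] conjI allI impI ballI)
    fix x :: real and X M assume x: "x \<ge> 3" and X: "X = nat \<lfloor>x\<rfloor>" and M: "M \<in> small_prime_sets x"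
    have lx: "ln x > 0" using x by simp
    have Xx: "real X \<le> x" using x by (simp add: X)
    define n where "n = \<Prod>M"
    have n1: "n \<ge> 1" using small_prime_setsD(5)[OF M] by (simp add: n_def)
    define E where "E = {e \<in> E1 X M. RT e \<noteq> 0}"
    define Q where "Q e = {q. prime q \<and> int q dvd RT e \<and> (\<forall>p\<in>M. p < q) \<and> x < real (q * n)}" for e
    define S where "S e q = {s \<in> {0..<int q}. int q dvd poly (fy e) s}" for e q
    have x1: "x \<ge> 1" using x by simp
    note E1 = card_E1_le[OF x1 X M]
    have finE: "finite E" using E1(1) by (simp add: E_def)
    have Qb: "finite (Q e)" "real (card (Q e)) \<le> KR * log_weight M" if e: "e \<in> E" for e
    proof -
      have nz: "RT e \<noteq> 0" using e by (simp add: E_def)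
      have lw: "ln x \<le> log_weight M * ln (real q)" if "q \<in> Q e" for q
        using that by (intro log_weight_ge[OF x1 M]) (auto simp: Q_def n_def)
      have bnd: "\<forall>j<k. \<bar>real_of_int (e j)\<bar> \<le> real H * x"
      proof (intro allI impI)
        fix j assume "j < k"
        then have "\<bar>e j\<bar> \<le> int H * int X" using e by (simp add: E_def E1_def)
        then have "real_of_int \<bar>e j\<bar> \<le> real_of_int (int H * int X)" by (simp only: of_int_le_iff)
        also have "\<dots> \<le> real H * x" using Xx by (simp add: mult_left_mono)
        finally show "\<bar>real_of_int (e j)\<bar> \<le> real H * x" by simp
      qed
      note c = card_large_prime_divisors_le[OF nz, of "Q e" "ln x" "log_weight M"]
      show "finite (Q e)" using lw log_weight_nonneg[OF M] by (intro c(1)) (auto simp: Q_def)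
      have "real (card (Q e)) * ln x \<le> log_weight M * ln \<bar>real_of_int (RT e)\<bar>"
        using lw log_weight_nonneg[OF M] by (intro c(2)) (auto simp: Q_def)
      also have "\<dots> \<le> log_weight M * (KR * ln x)"
        by (rule mult_left_mono[OF lnR[OF x bnd nz] log_weight_nonneg[OF M]])
      finally have "real (card (Q e)) * ln x \<le> (KR * log_weight M) * ln x" by (simp only: ac_simps)
      then show "real (card (Q e)) \<le> KR * log_weight M" by (rule mult_right_le_imp_le[OF _ lx])
    qed
    have Sb: "finite (S e q)" "prime q \<Longrightarrow> card (S e q) \<le> Kr" for e q
    proof -
      show "finite (S e q)" unfolding S_def by (rule finite_subset[of _ "{0..<int q}"]) auto
      show "prime q \<Longrightarrow> card (S e q) \<le> Kr" unfolding S_def Kr_def by (rule fy_roots_const_le)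
    qed
    let ?P = "SIGMA e:E. SIGMA q:Q e. S e q"
    define \<phi> where "\<phi> = (\<lambda>(a :: nat \<Rightarrow> int, q :: nat). (restrict (\<lambda>j. if j < k then coord_inv a j else a k mod int n) {..<Suc k}, q, a k mod int q))"
    have inj: "inj_on \<phi> (T1 x X M)"
    proof (rule inj_onI)
      fix y z assume y: "y \<in> T1 x X M" and z: "z \<in> T1 x X M" and eq: "\<phi> y = \<phi> z"
      obtain a q b q' where yz: "y = (a, q)" "z = (b, q')" by (cases y, cases z) auto
      have qq: "q' = q" and s: "a k mod int q = b k mod int q"
        and r: "restrict (\<lambda>j. if j < k then coord_inv a j else a k mod int n) {..<Suc k} =
          restrict (\<lambda>j. if j < k then coord_inv b j else b k mod int n) {..<Suc k}"
        using eq by (auto simp: \<phi>_def yz)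
      have aB: "a \<in> Box X" "b \<in> Box X" and q: "prime q" "\<forall>p\<in>M. p < q" "x < real (q * n)"
        using y z by (auto simp: T1_def yz n_def)
      have lt: "coord_inv a j = coord_inv b j" if "j < k" for j using fun_cong[OF r, of j] that by simp
      have t: "a k mod int n = b k mod int n" using fun_cong[OF r, of k] by simp
      have "coprime q n" unfolding n_def
        using q small_prime_setsD(2)[OF M] by (intro prod_coprime_right primes_coprime) auto
      then have dv: "int q * int n dvd a k - b k"
        using s t by (intro divides_mult) (auto simp: mod_eq_dvd_iff)
      have "1 \<le> a k" "a k \<le> int X" "1 \<le> b k" "b k \<le> int X" using BoxD[OF aB(1), of k] BoxD[OF aB(2), of k] by auto
      moreover have "int X < int q * int n"
      proof -
        have "real X < real (q * n)" using Xx q(3) by linarith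
        then have "X < q * n" by (simp only: of_nat_less_iff)
        then show ?thesis by (simp flip: of_nat_mult)
      qed
      ultimately have lt': "\<bar>a k - b k\<bar> < int q * int n" by linarith
      have "a k = b k"
      proof (rule ccontr)
        assume "a k \<noteq> b k"
        then have "\<bar>int q * int n\<bar> \<le> \<bar>a k - b k\<bar>" by (intro dvd_imp_le_int dv) simp
        then show False using lt' by linarith
      qed
      then have "coord_inv a j = coord_inv b j" if "j < Suc k" for j
        using lt that by (cases "j = k") (auto simp: coord_inv_k)
      then have "a = b" by (rule coord_inv_inj[OF aB])
      then show "y = z" by (simp add: yz qq)
    qed
    have img: "\<phi> ` T1 x X M \<subseteq> ?P"
    proof
      fix u assume "u \<in> \<phi> ` T1 x X M"
      then obtain a q where u: "u = \<phi> (a, q)" and aq: "(a, q) \<in> T1 x X M" by auto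
      define e where "e = restrict (\<lambda>j. if j < k then coord_inv a j else a k mod int n) {..<Suc k}"
      have a: "a \<in> Box X" "RT (coord_inv a) \<noteq> 0" "prime q" "\<forall>p\<in>M. Z p a" "Z q a" "\<forall>p\<in>M. p < q" "x < real (q * n)"
        using aq by (auto simp: T1_def n_def)
      have ek: "e j = coord_inv a j" if "j < k" for j using that by (simp add: e_def)
      have ekk: "e k = a k mod int n" by (simp add: e_def)
      have RTe: "RT e = RT (coord_inv a)" by (rule RT_cong) (rule ek)
      have fye: "fy e = fy (coord_inv a)" by (rule fy_cong) (rule ek)
      have ZM: "Z' p e" if p: "p \<in> M" for p
      proof -
        have pn: "int p dvd int n" unfolding n_def int_dvd_int_iff
          by (rule dvd_prodI[OF small_prime_setsD(1)[OF M] p])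
        have "Z' p e = Z' p (coord_inv a)"
        proof (rule periodicD[OF periodic_Z'])
          fix j assume "j < Suc k"
          then show "e j mod int p = coord_inv a j mod int p"
            using pn by (cases "j = k") (auto simp: ek ekk coord_inv_k mod_mod_cancel)
        qed
        then show ?thesis using a(4) p Z'_coord_inv by blast
      qed
      have "e \<in> E1 X M"
        unfolding E1_def n_def[symmetric]
      proof (intro CollectI conjI allI impI ballI)
        show "e \<in> {..<Suc k} \<rightarrow>\<^sub>E UNIV" unfolding e_def by (simp add: PiE_def)
        show "\<bar>e j\<bar> \<le> int H * int X" if "j < k" for j
          unfolding ek[OF that] by (rule coord_inv_bound[OF a(1) that])
        show "e k \<in> {0..<int n}" using n1 by (simp add: ekk)
      qed (rule ZM)
      then have "e \<in> E" using a(2) RTe by (simp add: E_def)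
      moreover have "q \<in> Q e" using a RT_dvd[OF Z'_coord_inv[OF a(5)]] by (simp add: Q_def RTe)
      moreover have "a k mod int q \<in> S e q"
      proof -
        have "int q dvd fT (coord_inv a)" using Z'_coord_inv[OF a(5)] by (simp add: Z'_def)
        then have "int q dvd poly (fy e) (a k)"
          unfolding fye using poly_fy[of "coord_inv a"] by (simp add: coord_inv_k)
        moreover have "poly (fy e) (a k mod int q) mod int q = poly (fy e) (a k) mod int q"
          by (rule poly_fy_mod) simp
        ultimately show ?thesis using prime_nat_bounds(3)[OF a(3)] by (simp add: S_def dvd_eq_mod_eq_0)
      qed
      ultimately show "u \<in> ?P" by (simp add: u \<phi>_def e_def)
    qed
    have finP: "finite ?P" using finE Qb(1) Sb(1) by blast
    show "finite (T1 x X M)" using inj_on_finite[OF inj img finP] .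
    have cQ: "real (card (SIGMA q:Q e. S e q)) \<le> KR * log_weight M * real Kr" if e: "e \<in> E" for e
    proof -
      have "card (SIGMA q:Q e. S e q) = (\<Sum>q\<in>Q e. card (S e q))"
        using Qb(1)[OF e] Sb(1) by (intro card_SigmaI) auto
      also have "\<dots> \<le> (\<Sum>q\<in>Q e. Kr)" by (rule sum_mono) (use Sb(2) in \<open>auto simp: Q_def\<close>)
      finally have "card (SIGMA q:Q e. S e q) \<le> card (Q e) * Kr" by simp
      then have "real (card (SIGMA q:Q e. S e q)) \<le> real (card (Q e)) * real Kr"
        by (metis of_nat_le_iff of_nat_mult)
      also have "\<dots> \<le> KR * log_weight M * real Kr" using Qb(2)[OF e] by (intro mult_right_mono) auto
      finally show ?thesis .
    qed
    have "real (card (T1 x X M)) \<le> real (card ?P)" using card_inj_on_le[OF inj img finP] by simp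
    also have "card ?P = (\<Sum>e\<in>E. card (SIGMA q:Q e. S e q))"
      using finE Qb(1) Sb(1) by (intro card_SigmaI) blast+
    also have "real \<dots> \<le> (\<Sum>e\<in>E. KR * log_weight M * real Kr)" unfolding of_nat_sum by (rule sum_mono) (rule cQ)
    also have "\<dots> = real (card E) * (KR * log_weight M * real Kr)" by simp
    also have "\<dots> \<le> (real (2 * H + 2) ^ k * KB * x ^ k * (\<Prod>p\<in>M. real C / real p)) * (KR * log_weight M * real Kr)"
    proof (rule mult_right_mono)
      have "card E \<le> card (E1 X M)" by (rule card_mono[OF E1(1)]) (auto simp: E_def)
      then show "real (card E) \<le> real (2 * H + 2) ^ k * KB * x ^ k * (\<Prod>p\<in>M. real C / real p)" using E1(2) by linarith
    qed (use KR log_weight_nonneg[OF M] in auto)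
    finally show "real (card (T1 x X M)) \<le> real (2 * H + 2) ^ k * KB * KR * real Kr * x ^ k * ((\<Prod>p\<in>M. real C / real p) * log_weight M)"
      by (simp only: ac_simps)
  qed (use KR Kr KB_ge_1 in \<open>auto intro!: mult_pos_pos\<close>)
qed

section \<open>Points on the hypersurface R = 0\<close>

definition T2 :: "nat \<Rightarrow> nat set \<Rightarrow> (nat \<Rightarrow> int) set" where
  "T2 X M = {a \<in> Box X. RT (coord_inv a) = 0 \<and> (\<forall>p\<in>M. Z p a)}"

text \<open>As a polynomial in \<open>e 0\<close> with the other coordinates fixed,
  \<open>RT\<close> has the nonzero leading coefficient \<open>C1\<close>, hence at most
  \<open>total_deg R\<close> zeros.\<close>

lemma card_RT_zero_le:
  "finite {e \<in> {..<k} \<rightarrow>\<^sub>E {- int Y..int Y}. RT e = 0}"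
  "card {e \<in> {..<k} \<rightarrow>\<^sub>E {- int Y..int Y}. RT e = 0} \<le> total_deg R * (2 * Y + 1) ^ (k - 1)"
proof -
  let ?A = "{e \<in> {..<k} \<rightarrow>\<^sub>E {- int Y..int Y}. RT e = 0}"
  let ?B = "{1..<k} \<rightarrow>\<^sub>E {- int Y..int Y}"
  show finA: "finite ?A"
    by (rule finite_subset[of _ "{..<k} \<rightarrow>\<^sub>E {- int Y..int Y}"]) (auto intro!: finite_PiE)
  define Ry where "Ry e = mev R (\<lambda>j. [:if j = 0 then 0 else e j, of_int (c j):])" for e :: "nat \<Rightarrow> int"
  have cR: "coeff (Ry e) (total_deg R) = C1" "degree (Ry e) \<le> total_deg R" for e
    unfolding Ry_def C1_def using mev_linear[of R "\<lambda>j. if j = 0 then 0 else e j" c] by auto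
  have Ry0: "Ry e \<noteq> 0" for e using cR(1)[of e] C1 by auto
  have ev: "poly (Ry e) (e 0) = RT e" for e
  proof -
    have "poly (Ry e) (e 0) = mev R (\<lambda>j. poly [:if j = 0 then 0 else e j, of_int (c j):] (e 0))"
      unfolding Ry_def by (rule is_hom_mev[OF is_hom_poly])
    also have "\<dots> = RT e" unfolding RT_def by (rule mev_cong[OF R]) (simp add: bcoord_def)
    finally show ?thesis .
  qed
  define S where "S e = {z. poly (Ry e) z = 0}" for e
  have S: "finite (S e)" "card (S e) \<le> total_deg R" for e
    using poly_roots_finite[OF Ry0[of e]] card_poly_roots_bound[OF Ry0[of e]] cR(2)[of e] by (auto simp: S_def)
  define \<phi> where "\<phi> e = (restrict e {1..<k}, e 0)" for e :: "nat \<Rightarrow> int"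
  have "card ?A \<le> card (Sigma ?B S)"
  proof (rule card_inj_on_le[where f = \<phi>])
    show "inj_on \<phi> ?A"
    proof (rule inj_onI)
      fix a b assume a: "a \<in> ?A" and b: "b \<in> ?A" and eq: "\<phi> a = \<phi> b"
      have r: "restrict a {1..<k} = restrict b {1..<k}" "a 0 = b 0" using eq by (auto simp: \<phi>_def)
      have mid: "a j = b j" if "j \<in> {1..<k}" for j using fun_cong[OF r(1), of j] that by simp
      have ab: "a \<in> {..<k} \<rightarrow>\<^sub>E {- int Y..int Y}" "b \<in> {..<k} \<rightarrow>\<^sub>E {- int Y..int Y}" using a b by blast+
      show "a = b"
      proof (rule PiE_ext[OF ab])
        fix j assume "j \<in> {..<k}"
        then show "a j = b j" using r(2) mid by (cases "j = 0") auto
      qed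
    qed
    show "\<phi> ` ?A \<subseteq> Sigma ?B S"
    proof (rule image_subsetI)
      fix a assume a: "a \<in> ?A"
      have "Ry (restrict a {1..<k}) = Ry a"
        unfolding Ry_def by (rule mev_cong[OF R]) auto
      then have "poly (Ry (restrict a {1..<k})) (a 0) = 0" using ev[of a] a by simp
      moreover have "restrict a {1..<k} \<in> ?B" using a by (auto simp: PiE_def Pi_def)
      ultimately show "\<phi> a \<in> Sigma ?B S" by (simp add: \<phi>_def S_def)
    qed
    show "finite (Sigma ?B S)" using S(1) by (auto intro!: finite_PiE)
  qed
  also have "\<dots> = (\<Sum>e\<in>?B. card (S e))" using S by (intro card_SigmaI) (auto intro!: finite_PiE)
  also have "\<dots> \<le> (\<Sum>e\<in>?B. total_deg R)" by (rule sum_mono) (rule S(2))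
  also have "\<dots> = total_deg R * (2 * Y + 1) ^ (k - 1)"
  proof -
    have "nat (int Y + 1 + int Y) = 2 * Y + 1" by simp
    then show ?thesis by (simp add: card_PiE)
  qed
  finally show "card ?A \<le> total_deg R * (2 * Y + 1) ^ (k - 1)" .
qed

text \<open>The base coordinates satisfy \<open>RT = 0\<close>, which leaves O(x^(k-1)) choices. The
  last coordinate is a root of \<open>fy\<close> modulo the product n of \<open>M\<close>: O(C^w)
  residue classes, w the number of primes in \<open>M\<close>, each with O(x / n) members in the
  box.\<close>

lemma card_T2_le:
  "\<exists>K>0. \<forall>x\<ge>3. \<forall>X. X = nat \<lfloor>x\<rfloor> \<longrightarrow> (\<forall>M\<in>small_prime_sets x. finite (T2 X M) \<and>
     real (card (T2 X M)) \<le> K * x ^ k * (\<Prod>p\<in>M. real C / real p))"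
proof (intro exI[of _ "(real (total_deg R) + 1) * real (2 * H + 1) ^ (k - 1) * KB * 2"] conjI allI impI ballI)
  fix x :: real and X M assume x: "x \<ge> 3" and X: "X = nat \<lfloor>x\<rfloor>" and M: "M \<in> small_prime_sets x"
  have Xx: "real X \<le> x" using x by (simp add: X)
  show fin: "finite (T2 X M)" unfolding T2_def using finite_Box by (rule rev_finite_subset) auto
  define n where "n = \<Prod>M"
  have n1: "n \<ge> 1" "real n \<ge> 1" "real n \<le> x"
    unfolding n_def by (rule small_prime_setsD(5)[OF M] small_prime_sets_ge_1[OF M] small_prime_setsD(3)[OF M])+
  have Mp: "finite M" "\<And>p. p \<in> M \<Longrightarrow> prime p" using small_prime_setsD[OF M] by auto
  define A where "A = {e \<in> {..<k} \<rightarrow>\<^sub>E {- int (H * X)..int (H * X)}. RT e = 0}"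
  have A: "finite A" "card A \<le> total_deg R * (2 * (H * X) + 1) ^ (k - 1)"
    unfolding A_def by (rule card_RT_zero_le)+
  define S where "S e = {y \<in> {0..<int n}. \<forall>p\<in>M. int p dvd poly (fy e) y}" for e
  have finS: "finite (S e)" for e by (rule finite_subset[of _ "{0..<int n}"]) (auto simp: S_def)
  have S: "real (card (S e)) \<le> KB * real C ^ card M" for e
    unfolding S_def n_def by (rule card_fy_roots_prime_set_le) (use Mp in auto)
  define B where "B = {0..int X div int n}"
  let ?P = "SIGMA e:A. S e \<times> B"
  define \<phi> where "\<phi> a = (restrict (coord_inv a) {..<k}, a k mod int n, a k div int n)" for a :: "nat \<Rightarrow> int"
  have inj: "inj_on \<phi> (T2 X M)"
  proof (rule inj_onI)
    fix a b assume a: "a \<in> T2 X M" and b: "b \<in> T2 X M" and eq: "\<phi> a = \<phi> b"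
    have r: "restrict (coord_inv a) {..<k} = restrict (coord_inv b) {..<k}"
      and mk: "a k mod int n = b k mod int n" "a k div int n = b k div int n" using eq by (auto simp: \<phi>_def)
    have lt: "coord_inv a j = coord_inv b j" if "j < k" for j using fun_cong[OF r, of j] that by simp
    have "a k = b k" using mk by (metis mult_div_mod_eq)
    then have "coord_inv a j = coord_inv b j" if "j < Suc k" for j
      using lt that by (cases "j = k") (auto simp: coord_inv_k)
    then show "a = b" by (rule coord_inv_inj[rotated 2]) (use a b in \<open>auto simp: T2_def\<close>)
  qed
  have img: "\<phi> ` T2 X M \<subseteq> ?P"
  proof (rule image_subsetI)
    fix a assume "a \<in> T2 X M"
    then have a: "a \<in> Box X" "RT (coord_inv a) = 0" "\<forall>p\<in>M. Z p a" by (auto simp: T2_def)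
    define e where "e = restrict (coord_inv a) {..<k}"
    have ek: "e j = coord_inv a j" if "j < k" for j using that by (simp add: e_def)
    have RTe: "RT e = RT (coord_inv a)" by (rule RT_cong) (rule ek)
    have fye: "fy e = fy (coord_inv a)" by (rule fy_cong) (rule ek)
    have "coord_inv a j \<in> {- int (H * X)..int (H * X)}" if "j < k" for j
      using coord_inv_bound[OF a(1) that] by auto
    then have "e \<in> A" unfolding A_def using RTe a(2) by (auto simp: e_def)
    moreover have "a k mod int n \<in> S e"
    proof -
      have "int p dvd poly (fy e) (a k mod int n)" if p: "p \<in> M" for p
      proof -
        have pn: "int p dvd int n" unfolding n_def int_dvd_int_iff by (rule dvd_prodI[OF Mp(1) p])
        have "int p dvd fT (coord_inv a)" using Z'_coord_inv a(3) p by (auto simp: Z'_def)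
        then have "int p dvd poly (fy e) (a k)"
          unfolding fye using poly_fy[of "coord_inv a"] by (simp add: coord_inv_k)
        moreover have "poly (fy e) (a k mod int n) mod int p = poly (fy e) (a k) mod int p"
          by (rule poly_fy_mod) (rule mod_mod_cancel[OF pn])
        ultimately show ?thesis by (simp add: dvd_eq_mod_eq_0)
      qed
      then show ?thesis using n1 by (simp add: S_def)
    qed
    moreover have "a k div int n \<in> B"
    proof -
      have "1 \<le> a k" "a k \<le> int X" using BoxD[OF a(1), of k] by auto
      then show ?thesis using n1 by (simp add: B_def pos_imp_zdiv_nonneg_iff zdiv_mono1)
    qed
    ultimately show "\<phi> a \<in> ?P" by (simp add: \<phi>_def e_def)
  qed
  have finP: "finite ?P" using A(1) finS by (auto simp: B_def)
  have cB: "real (card B) \<le> 2 * (x / real n)"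
  proof -
    have "real (card B) = real (X div n) + 1" unfolding B_def by (simp flip: of_nat_div add: nat_add_distrib)
    also have "\<dots> \<le> real X / real n + 1" by (simp add: of_nat_div_le_of_nat)
    also have "\<dots> \<le> x / real n + x / real n"
      using Xx n1 by (intro add_mono divide_right_mono) (auto simp: field_simps)
    finally show ?thesis by simp
  qed
  have "real (card (T2 X M)) \<le> real (card ?P)" using card_inj_on_le[OF inj img finP] by simp
  also have "card ?P = (\<Sum>e\<in>A. card (S e \<times> B))"
    using A(1) finS by (intro card_SigmaI) (auto simp: B_def)
  also have "real \<dots> \<le> (\<Sum>e\<in>A. (KB * real C ^ card M) * (2 * (x / real n)))"
    unfolding of_nat_sum card_cartesian_product of_nat_mult
    using S cB KB_ge_1 by (intro sum_mono mult_mono) auto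
  also have "\<dots> = real (card A) * ((KB * real C ^ card M) * (2 * (x / real n)))" by simp
  also have "\<dots> \<le> ((real (total_deg R) + 1) * (real (2 * H + 1) * x) ^ (k - 1)) * ((KB * real C ^ card M) * (2 * (x / real n)))"
  proof (rule mult_right_mono)
    have "real (card A) \<le> real (total_deg R * (2 * (H * X) + 1) ^ (k - 1))" using A(2) by (rule of_nat_mono)
    also have "\<dots> = real (total_deg R) * (2 * (real H * real X) + 1) ^ (k - 1)" by (simp add: add.commute)
    also have "\<dots> \<le> (real (total_deg R) + 1) * (real (2 * H + 1) * x) ^ (k - 1)"
    proof (intro mult_mono power_mono)
      have "2 * (real H * real X) + 1 \<le> 2 * (real H * x) + x" using Xx x by (intro add_mono mult_left_mono) auto
      then show "2 * (real H * real X) + 1 \<le> real (2 * H + 1) * x" by (simp add: algebra_simps)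
    qed auto
    finally show "real (card A) \<le> (real (total_deg R) + 1) * (real (2 * H + 1) * x) ^ (k - 1)" .
  qed (use KB_ge_1 x in auto)
  also have "\<dots> = (real (total_deg R) + 1) * real (2 * H + 1) ^ (k - 1) * KB * 2 * (x ^ (k - 1) * x) * (real C ^ card M / real n)"
    by (simp add: power_mult_distrib)
  also have "x ^ (k - 1) * x = x ^ k" using k by (intro power_minus_mult) simp
  also have "real C ^ card M / real n = (\<Prod>p\<in>M. real C / real p)" by (simp add: prod_dividef n_def)
  finally show "real (card (T2 X M)) \<le> (real (total_deg R) + 1) * real (2 * H + 1) ^ (k - 1) * KB * 2 * x ^ k * (\<Prod>p\<in>M. real C / real p)" .
qed (use KB_ge_1 in \<open>auto intro!: mult_pos_pos add_nonneg_pos\<close>)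

end

subsection \<open>Summation\<close>

lemma power_Suc_diff_le:
  fixes r :: real
  assumes "r \<ge> 0" shows "(r + 1) ^ Suc n - r ^ Suc n \<le> real (Suc n) * (r + 1) ^ n"
proof (induction n)
  case (Suc n)
  have "(r + 1) ^ Suc (Suc n) - r ^ Suc (Suc n) = (r + 1) * ((r + 1) ^ Suc n - r ^ Suc n) + r ^ Suc n"
    by (simp add: algebra_simps)
  also have "\<dots> \<le> (r + 1) * (real (Suc n) * (r + 1) ^ n) + (r + 1) ^ Suc n"
    using assms Suc by (intro add_mono mult_left_mono power_mono) auto
  also have "\<dots> = real (Suc (Suc n)) * (r + 1) ^ Suc n" by (simp add: algebra_simps)
  finally show ?case .
qed simp

lemma sum_card_swap:
  assumes "finite A" "finite B"
  shows "(\<Sum>a\<in>A. card {b\<in>B. P a b}) = (\<Sum>b\<in>B. card {a\<in>A. P a b})"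
proof -
  have "(\<Sum>a\<in>A. card {b\<in>B. P a b}) = (\<Sum>a\<in>A. \<Sum>b\<in>B. if P a b then 1 else 0)"
    using assms by (simp add: sum.inter_filter[symmetric])
  also have "\<dots> = (\<Sum>b\<in>B. \<Sum>a\<in>A. if P a b then 1 else 0)" by (rule sum.swap)
  also have "\<dots> = (\<Sum>b\<in>B. card {a\<in>A. P a b})" using assms by (simp add: sum.inter_filter[symmetric])
  finally show ?thesis .
qed

context gcd_system
begin

definition PP :: "(nat \<Rightarrow> int) \<Rightarrow> nat set" where "PP a = {p. prime p \<and> Z p a}"

text \<open>After an exchange of sums the error is at most the total over \<open>M\<close> of
  \<open>card (T1 x X M)\<close> and \<open>card (T2 X M)\<close>. The constant part of
  \<open>log_weight\<close> is summed by \<open>sum_small_prime_sets_le\<close>, the ratio of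
  logarithms by \<open>sum_log_ratio_le\<close>; both give the exponent \<open>C\<close>.\<close>

lemma sieve_error_le:
  "\<exists>K>0. \<forall>x\<ge>3. \<forall>X. X = nat \<lfloor>x\<rfloor> \<longrightarrow>
     (\<Sum>a\<in>Box X. \<bar>of_bool (PP a = {}) - truncated_moebius x (PP a)\<bar>) \<le> K * x ^ k * ln x ^ C"
proof -
  obtain K1 where K1: "K1 > 0" "\<And>x X M. x \<ge> 3 \<Longrightarrow> X = nat \<lfloor>x\<rfloor> \<Longrightarrow> M \<in> small_prime_sets x \<Longrightarrow> finite (T1 x X M) \<and>
     real (card (T1 x X M)) \<le> K1 * x ^ k * ((\<Prod>p\<in>M. real C / real p) * log_weight M)"
    using card_T1_le by blast
  obtain K2 where K2: "K2 > 0" "\<And>x X M. x \<ge> 3 \<Longrightarrow> X = nat \<lfloor>x\<rfloor> \<Longrightarrow> M \<in> small_prime_sets x \<Longrightarrow> finite (T2 X M) \<and>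
     real (card (T2 X M)) \<le> K2 * x ^ k * (\<Prod>p\<in>M. real C / real p)"
    using card_T2_le by blast
  obtain K3 where K3: "K3 > 0" "\<And>x. x \<ge> 2 \<Longrightarrow> (\<Sum>M\<in>small_prime_sets x. \<Prod>p\<in>M. real C / real p) \<le> K3 * ln x ^ C"
    using sum_small_prime_sets_le[of C] by blast
  obtain K4 where K4: "K4 > 0" "\<And>x. x \<ge> 2 \<Longrightarrow> (\<Sum>M\<in>small_prime_sets x - {{}}. (\<Prod>p\<in>M. real C / real p) *
    (ln (real (\<Prod>M)) / ln (real (Max M)))) \<le> K4 * ln x ^ C"
    using sum_log_ratio_le[OF C_bounds(1)] by blast
  show ?thesis
  proof (intro exI[of _ "K1 * (2 * K3 + 2 * K4) + K2 * K3"] conjI allI impI)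
    fix x :: real and X assume x: "x \<ge> 3" and X: "X = nat \<lfloor>x\<rfloor>"
    define wt where "wt M = (\<Prod>p\<in>M. real C / real p)" for M :: "nat set"
    let ?F = "small_prime_sets x"
    have x1: "x \<ge> 1" "x \<ge> 2" using x by auto
    have err: "\<bar>of_bool (PP a = {}) - truncated_moebius x (PP a)\<bar> \<le>
        real (card {M\<in>?F. a \<in> T2 X M}) + real (card {(M, q). M \<in> ?F \<and> (a, q) \<in> T1 x X M})" if a: "a \<in> Box X" for a
    proof (cases "RT (coord_inv a) = 0")
      case True
      have "{M\<in>?F. M \<subseteq> PP a} = {M\<in>?F. a \<in> T2 X M}"
        using a True by (auto simp: T2_def PP_def small_prime_sets_def)
      with truncated_moebius_error_trivial[OF x1(1), of "PP a"] show ?thesis by simp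
    next
      case False
      \<comment> \<open>Every prime in \<open>PP a\<close> divides the nonzero eliminant, which
        makes \<open>PP a\<close> finite, as the cancellation argument requires.\<close>
      have "PP a \<subseteq> {..nat \<bar>RT (coord_inv a)\<bar>}"
      proof
        fix q assume "q \<in> PP a"
        then have "int q dvd RT (coord_inv a)" by (auto simp: PP_def intro: RT_dvd Z'_coord_inv)
        then have "\<bar>int q\<bar> \<le> \<bar>RT (coord_inv a)\<bar>" using False by (rule dvd_imp_le_int[rotated])
        then show "q \<in> {..nat \<bar>RT (coord_inv a)\<bar>}" by simp
      qed
      then have fin: "finite (PP a)" by (rule finite_subset) simp
      have eq: "{(M, q). M \<in> ?F \<and> M \<subseteq> PP a \<and> q \<in> PP a \<and> (\<forall>p\<in>M. p < q) \<and> x < real (q * \<Prod>M)} =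
          {(M, q). M \<in> ?F \<and> (a, q) \<in> T1 x X M}"
        using a False by (auto simp: T1_def PP_def small_prime_sets_def)
      have "prime p" if "p \<in> PP a" for p using that by (simp add: PP_def)
      from truncated_moebius_error[OF x1(1) fin this]
      show ?thesis unfolding eq by linarith
    qed
    have c1: "card {(M, q). M \<in> ?F \<and> (a, q) \<in> T1 x X M} = (\<Sum>M\<in>?F. card {q. (a, q) \<in> T1 x X M})" for a
    proof -
      have "{(M, q). M \<in> ?F \<and> (a, q) \<in> T1 x X M} = (SIGMA M:?F. {q. (a, q) \<in> T1 x X M})" by auto
      moreover have "finite {q. (a, q) \<in> T1 x X M}" if "M \<in> ?F" for M
      proof -
        have "finite (snd ` T1 x X M)" using K1(2)[OF x X that] by simp
        then show ?thesis by (rule rev_finite_subset) force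
      qed
      ultimately show ?thesis by (simp add: card_SigmaI)
    qed
    have c2: "(\<Sum>a\<in>Box X. card {q. (a, q) \<in> T1 x X M}) = card (T1 x X M)" if M: "M \<in> ?F" for M
    proof -
      have "finite {q. (a, q) \<in> T1 x X M}" for a
      proof -
        have "finite (snd ` T1 x X M)" using K1(2)[OF x X M] by simp
        then show ?thesis by (rule rev_finite_subset) force
      qed
      then have "(\<Sum>a\<in>Box X. card {q. (a, q) \<in> T1 x X M}) = card (SIGMA a:Box X. {q. (a, q) \<in> T1 x X M})"
        using finite_Box by (simp add: card_SigmaI)
      also have "(SIGMA a:Box X. {q. (a, q) \<in> T1 x X M}) = T1 x X M" by (auto simp: T1_def)
      finally show ?thesis .
    qed
    have "(\<Sum>a\<in>Box X. \<bar>of_bool (PP a = {}) - truncated_moebius x (PP a)\<bar>) \<le>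
        (\<Sum>a\<in>Box X. real (card {M\<in>?F. a \<in> T2 X M}) + real (card {(M, q). M \<in> ?F \<and> (a, q) \<in> T1 x X M}))"
      by (rule sum_mono) (rule err)
    also have "\<dots> = real (\<Sum>a\<in>Box X. card {M\<in>?F. a \<in> T2 X M}) + real (\<Sum>a\<in>Box X. \<Sum>M\<in>?F. card {q. (a, q) \<in> T1 x X M})"
      unfolding c1 sum.distrib of_nat_sum ..
    also have "(\<Sum>a\<in>Box X. card {M\<in>?F. a \<in> T2 X M}) = (\<Sum>M\<in>?F. card {a\<in>Box X. a \<in> T2 X M})"
      by (rule sum_card_swap) (use finite_Box in auto)
    also have "\<dots> = (\<Sum>M\<in>?F. card (T2 X M))"
      by (rule sum.cong[OF refl], rule arg_cong[where f = card]) (auto simp: T2_def)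
    also have "(\<Sum>a\<in>Box X. \<Sum>M\<in>?F. card {q. (a, q) \<in> T1 x X M}) = (\<Sum>M\<in>?F. card (T1 x X M))"
      by (subst sum.swap) (rule sum.cong[OF refl c2])
    also have "real (\<Sum>M\<in>?F. card (T2 X M)) + real (\<Sum>M\<in>?F. card (T1 x X M)) \<le>
        (\<Sum>M\<in>?F. K2 * x ^ k * wt M) + (\<Sum>M\<in>?F. K1 * x ^ k * (wt M * log_weight M))"
      unfolding of_nat_sum wt_def using K1(2)[OF x X] K2(2)[OF x X] by (intro add_mono sum_mono) auto
    also have "\<dots> = K2 * x ^ k * (\<Sum>M\<in>?F. wt M) + K1 * x ^ k * (\<Sum>M\<in>?F. wt M * log_weight M)"
      by (simp add: sum_distrib_left)
    also have "(\<Sum>M\<in>?F. wt M * log_weight M) = 2 * (\<Sum>M\<in>?F. wt M) + 2 * (\<Sum>M\<in>?F - {{}}. wt M * (ln (real (\<Prod>M)) / ln (real (Max M))))"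
    proof -
      have "(\<Sum>M\<in>?F. wt M * log_weight M) = (\<Sum>M\<in>?F. 2 * wt M + (if M \<noteq> {} then 2 * (wt M * (ln (real (\<Prod>M)) / ln (real (Max M)))) else 0))"
        by (rule sum.cong) (auto simp: log_weight_def distrib_left)
      also have "\<dots> = 2 * (\<Sum>M\<in>?F. wt M) + (\<Sum>M\<in>{M\<in>?F. M \<noteq> {}}. 2 * (wt M * (ln (real (\<Prod>M)) / ln (real (Max M)))))"
        by (subst sum.distrib, subst sum.inter_filter) (simp_all add: sum_distrib_left)
      also have "{M\<in>?F. M \<noteq> {}} = ?F - {{}}" by auto
      finally show ?thesis by (simp add: sum_distrib_left)
    qed
    also have "K2 * x ^ k * (\<Sum>M\<in>?F. wt M) + K1 * x ^ k * (2 * (\<Sum>M\<in>?F. wt M) + 2 * (\<Sum>M\<in>?F - {{}}. wt M * (ln (real (\<Prod>M)) / ln (real (Max M))))) \<le>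
        K2 * x ^ k * (K3 * ln x ^ C) + K1 * x ^ k * (2 * (K3 * ln x ^ C) + 2 * (K4 * ln x ^ C))"
      using K1(1) K2(1) K3(2)[OF x1(2)] K4(2)[OF x1(2)] x unfolding wt_def
      by (intro add_mono mult_left_mono) auto
    also have "\<dots> = (K1 * (2 * K3 + 2 * K4) + K2 * K3) * x ^ k * ln x ^ C" by (simp add: algebra_simps)
    finally show "(\<Sum>a\<in>Box X. \<bar>of_bool (PP a = {}) - truncated_moebius x (PP a)\<bar>) \<le> (K1 * (2 * K3 + 2 * K4) + K2 * K3) * x ^ k * ln x ^ C" .
  qed (use K1(1) K2(1) K3(1) K4(1) in \<open>auto intro!: add_pos_pos mult_pos_pos\<close>)
qed

definition \<nu> :: "nat \<Rightarrow> nat" where "\<nu> p = cnt (Suc k) p (Z p)"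

lemma \<nu>_le:
  assumes p: "prime p"
  shows "real (\<nu> p) \<le> (if p \<in> bad then real p ^ 2 else 1) * (real C * real p ^ (k - 1))"
  using cnt_Z'_real_le[OF p] of_nat_mono[OF cnt_Z_le[OF prime_nat_bounds(3)[OF p]], where ?'a = real]
  unfolding \<nu>_def by (rule order_trans[rotated])

text \<open>With n the product of \<open>M\<close> and \<open>r = X div n\<close>, the box lies
  between boxes of sides \<open>n * r\<close> and \<open>n * (r + 1)\<close>, which periodicity
  counts exactly. They differ by O((x / n)^k) residue systems, each with O(C^w n^(k-1)) zeros, w the
  number of primes in \<open>M\<close>.\<close>

lemma card_box_prime_set:
  assumes x: "x \<ge> 3" and X: "X = nat \<lfloor>x\<rfloor>" and M: "M \<in> small_prime_sets x"
  shows "\<bar>real (card {a \<in> Box X. \<forall>p\<in>M. Z p a}) - real (\<Prod>p\<in>M. \<nu> p) * (x / real (\<Prod>M)) ^ Suc k\<bar> \<le>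
    (KB * real (Suc k) * 2 ^ k) * x ^ k * (\<Prod>p\<in>M. real C / real p)"
proof -
  define n where "n = \<Prod>M"
  have n1: "n \<ge> 1" "real n \<ge> 1" "real n \<le> x"
    unfolding n_def by (rule small_prime_setsD(5)[OF M] small_prime_sets_ge_1[OF M] small_prime_setsD(3)[OF M])+
  have Mp: "finite M" "\<And>p. p \<in> M \<Longrightarrow> prime p" using small_prime_setsD[OF M] by auto
  define r where "r = X div n"
  define N where "N = (\<Prod>p\<in>M. \<nu> p)"
  define Q where "Q a \<longleftrightarrow> (\<forall>p\<in>M. Z p a)" for a
  have cN: "cnt (Suc k) n Q = N"
    unfolding N_def \<nu>_def n_def Q_def by (rule cnt_prime_set) (use Mp periodic_Z in auto)
  have per: "periodic (Suc k) n Q"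
    unfolding n_def Q_def by (rule periodic_prime_set) (use Mp periodic_Z in auto)
  have box: "card {a \<in> {..<Suc k} \<rightarrow>\<^sub>E {1..<1 + int n * int s}. Q a} = s ^ Suc k * N" for s
    using box_count[OF _ per, of "\<lambda>_. 1" "\<lambda>_. s"] n1 by (simp add: cN)
  have le1: "n * r \<le> X" unfolding r_def by simp
  have le2: "X < n * (r + 1)" unfolding r_def using n1 by (intro ceiling_block) auto
  define A where "A = card {a \<in> Box X. Q a}"
  have "r ^ Suc k * N \<le> A"
    unfolding box[symmetric] A_def
  proof (rule card_mono)
    show "finite {a \<in> Box X. Q a}" using finite_Box by simp
    have "int n * int r \<le> int X" using le1 by (metis of_nat_le_iff of_nat_mult)
    then have "{..<Suc k} \<rightarrow>\<^sub>E {1..<1 + int n * int r} \<subseteq> Box X" unfolding Box_def by (intro PiE_mono) auto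
    then show "{a \<in> {..<Suc k} \<rightarrow>\<^sub>E {1..<1 + int n * int r}. Q a} \<subseteq> {a \<in> Box X. Q a}" by blast
  qed
  then have A1: "real r ^ Suc k * real N \<le> real A" by (metis of_nat_le_iff of_nat_mult of_nat_power)
  have "A \<le> (r + 1) ^ Suc k * N"
    unfolding box[symmetric] A_def
  proof (rule card_mono)
    show "finite {a \<in> {..<Suc k} \<rightarrow>\<^sub>E {1..<1 + int n * int (r + 1)}. Q a}"
      by (rule finite_subset[of _ "{..<Suc k} \<rightarrow>\<^sub>E {1..<1 + int n * int (r + 1)}"]) (auto intro!: finite_PiE)
    have "int X \<le> int n * int (r + 1)" using le2 by (metis less_imp_le of_nat_le_iff of_nat_mult)
    then have "Box X \<subseteq> {..<Suc k} \<rightarrow>\<^sub>E {1..<1 + int n * int (r + 1)}" unfolding Box_def by (intro PiE_mono) auto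
    then show "{a \<in> Box X. Q a} \<subseteq> {a \<in> {..<Suc k} \<rightarrow>\<^sub>E {1..<1 + int n * int (r + 1)}. Q a}" by blast
  qed
  then have "real A \<le> real ((r + 1) ^ Suc k * N)" by (rule of_nat_mono)
  then have A2: "real A \<le> (real r + 1) ^ Suc k * real N" by (simp only: of_nat_mult of_nat_power of_nat_add of_nat_1)
  define t where "t = x / real n"
  have Xx: "real X \<le> x" "x < real X + 1" using x by (auto simp: X)
  have t1: "real r \<le> t"
  proof -
    have "real n * real r \<le> real X" using le1 by (metis of_nat_le_iff of_nat_mult)
    then show ?thesis using Xx n1 by (simp add: t_def field_simps)
  qed
  have t2: "t \<le> real r + 1"
  proof -
    have "real (X + 1) \<le> real (n * (r + 1))" using le2 by (intro of_nat_mono) simp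
    then have "x \<le> real n * (real r + 1)" using Xx by (simp add: algebra_simps)
    then show ?thesis using n1 by (simp add: t_def field_simps)
  qed
  have t3: "real r + 1 \<le> 2 * t"
  proof -
    have "1 \<le> t" using n1 by (simp add: t_def)
    then show ?thesis using t1 by linarith
  qed
  have B1: "real r ^ Suc k * real N \<le> t ^ Suc k * real N" using t1 by (intro mult_right_mono power_mono) auto
  have B2: "t ^ Suc k * real N \<le> (real r + 1) ^ Suc k * real N" using t1 t2 by (intro mult_right_mono power_mono) auto
  have "\<bar>real A - t ^ Suc k * real N\<bar> \<le> ((real r + 1) ^ Suc k - real r ^ Suc k) * real N"
    using A1 A2 B1 B2 unfolding left_diff_distrib by linarith
  also have "\<dots> \<le> (real (Suc k) * (real r + 1) ^ k) * real N"
    by (intro mult_right_mono power_Suc_diff_le) auto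
  also have "\<dots> \<le> (real (Suc k) * (2 * t) ^ k) * (KB * (\<Prod>p\<in>M. real C * real p ^ (k - 1)))"
    using t3 Mp \<nu>_le unfolding N_def of_nat_prod
    by (intro mult_mono mult_left_mono power_mono prod_le_KB prod_nonneg mult_nonneg_nonneg) auto
  also have "(\<Prod>p\<in>M. real C * real p ^ (k - 1)) = real C ^ card M * real n ^ (k - 1)"
    by (simp add: prod.distrib n_def prod_power_distrib)
  also have "(real (Suc k) * (2 * t) ^ k) * (KB * (real C ^ card M * real n ^ (k - 1))) =
      (KB * real (Suc k) * 2 ^ k) * x ^ k * (real C ^ card M * (real n ^ (k - 1) / real n ^ k))"
    by (simp add: t_def power_mult_distrib power_divide)
  also have "real n ^ (k - 1) / real n ^ k = 1 / real n" using n1 k by (cases k) auto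
  also have "real C ^ card M * (1 / real n) = (\<Prod>p\<in>M. real C / real p)" by (simp add: prod_dividef n_def)
  finally show ?thesis by (simp add: A_def t_def N_def n_def Q_def mult.commute)
qed

section \<open>The Euler product\<close>

lemma N_F_eq:
  assumes "n > 0" shows "N_F (Suc k) m F n = cnt (Suc k) n (Z n)"
proof -
  have Zc: "Z n a = Z n b" if "\<And>j. j < Suc k \<Longrightarrow> a j = b j" for a b
    by (rule periodicD[OF periodic_Z]) (use that in simp)
  have "N_F (Suc k) m F n = card {a \<in> {..<Suc k} \<rightarrow>\<^sub>E {1..n}. Z n (\<lambda>j. int (a j))}"
    unfolding N_F_def Z_def mev_int cong_0_iff ..
  also have "\<dots> = card {a \<in> {..<Suc k} \<rightarrow>\<^sub>E {1..<1 + int n}. Z n a}" by (rule card_nat_box) (rule Zc)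
  also have "\<dots> = cnt (Suc k) n (Z n)"
    using box_count[OF assms periodic_Z, of "\<lambda>_. 1" "\<lambda>_. 1"] by simp
  finally show ?thesis .
qed

definition g :: "nat \<Rightarrow> real" where "g p = real (\<nu> p) / real p ^ Suc k"

lemma euler_factor_eq: "euler_factor (Suc k) m F p = (if prime p then 1 - g p else 1)"
  using N_F_eq[of p] by (simp add: euler_factor_def g_def \<nu>_def prime_gt_0_nat)

lemma g_bounds:
  assumes p: "prime p" shows "0 \<le> g p" "g p \<le> (if p \<in> bad then real p ^ 2 else 1) * (real C / real p ^ 2)"
proof -
  show "0 \<le> g p" by (simp add: g_def)
  have p0: "real p > 0" using prime_nat_bounds(6)[OF p] .
  have "g p \<le> ((if p \<in> bad then real p ^ 2 else 1) * (real C * real p ^ (k - 1))) / real p ^ Suc k"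
    unfolding g_def using \<nu>_le[OF p] by (intro divide_right_mono) auto
  also have "\<dots> = (if p \<in> bad then real p ^ 2 else 1) * (real C * (real p ^ (k - 1) / real p ^ Suc k))" by simp
  also have "real p ^ (k - 1) / real p ^ Suc k = 1 / real p ^ 2"
    using k p0 by (cases k) (auto simp: power2_eq_square)
  finally show "g p \<le> (if p \<in> bad then real p ^ 2 else 1) * (real C / real p ^ 2)" by simp
qed

lemma convergent_euler_product: "convergent_prod (euler_factor (Suc k) m F)"
proof -
  have "summable (\<lambda>p. norm (euler_factor (Suc k) m F p - 1))"
  proof (rule summable_comparison_test)
    show "summable (\<lambda>p. KB * real C * inverse (real p ^ 2))"
      by (intro summable_mult inverse_power_summable) simp
    have "norm (euler_factor (Suc k) m F p - 1) \<le> KB * real C * inverse (real p ^ 2)" for p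
    proof (cases "prime p")
      case True
      \<comment> \<open>The singleton instance replaces the case distinction on bad primes by the
        constant \<open>KB\<close>.\<close>
      have "prod g {p} \<le> KB * (\<Prod>p\<in>{p}. real C / real p ^ 2)"
        by (rule prod_le_KB) (use g_bounds True in auto)
      then show ?thesis using g_bounds(1)[OF True] True by (simp add: euler_factor_eq divide_inverse)
    next
      case False
      then show ?thesis using KB_ge_1 by (simp add: euler_factor_eq)
    qed
    then show "\<exists>N. \<forall>p\<ge>N. norm (norm (euler_factor (Suc k) m F p - 1)) \<le> KB * real C * inverse (real p ^ 2)" by simp
  qed
  then show ?thesis
    by (intro abs_convergent_prod_imp_convergent_prod summable_imp_abs_convergent_prod)
qed

text \<open>The partial product up to \<open>y\<close> expands into a sum over sets of primes up to
  \<open>y\<close>. The sets with product above \<open>x\<close> form a tail bounded independently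
  of \<open>y\<close>, so the bound persists as \<open>y\<close> tends to infinity.\<close>

lemma euler_product_truncation:
  "\<exists>K>0. \<forall>x\<ge>3. \<bar>(\<Sum>M\<in>small_prime_sets x. (- 1) ^ card M * prod g M) - C_F (Suc k) m F\<bar> \<le> K * ln x ^ C / x"
proof -
  obtain K where K: "K > 0" "\<And>x P. x \<ge> 3 \<Longrightarrow> finite P \<Longrightarrow> (\<forall>p\<in>P. prime p) \<Longrightarrow>
     (\<Sum>M\<in>{M\<in>Pow P. real (\<Prod>M) > x}. \<Prod>p\<in>M. real C / real p ^ 2) \<le> K * ln x ^ C / x"
    using sum_large_prime_sets_le[of C] by blast
  show ?thesis
  proof (intro exI[of _ "KB * K"] conjI allI impI)
    fix x :: real assume x: "x \<ge> 3"
    define s where "s = (\<Sum>M\<in>small_prime_sets x. (- 1) ^ card M * prod g M)"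
    have near: "\<bar>s - (\<Prod>p\<le>y. euler_factor (Suc k) m F p)\<bar> \<le> KB * K * ln x ^ C / x" if y: "real y \<ge> x" for y
    proof -
      define P where "P = primes_upto (real y)"
      have P: "finite P" "\<forall>p\<in>P. prime p" by (auto simp: P_def) (simp add: primes_upto_def)
      define A where "A = {M\<in>Pow P. real (\<Prod>M) > x}"
      have "(\<Prod>p\<le>y. euler_factor (Suc k) m F p) = (\<Prod>p\<in>P. 1 + - g p)"
      proof (rule prod.mono_neutral_cong_right)
        show "P \<subseteq> {..y}" by (auto simp: P_def primes_upto_def)
        show "\<forall>p\<in>{..y} - P. euler_factor (Suc k) m F p = 1" by (auto simp: P_def primes_upto_def euler_factor_eq)
        show "euler_factor (Suc k) m F p = 1 + - g p" if "p \<in> P" for p using that P(2) by (simp add: euler_factor_eq)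
      qed simp
      also have "\<dots> = (\<Sum>M\<in>Pow P. \<Prod>p\<in>M. - g p)" by (rule prod_one_plus[OF P(1)])
      also have "\<dots> = (\<Sum>M\<in>Pow P. (- 1) ^ card M * prod g M)" by (simp add: prod_uminus)
      also have "\<dots> = (\<Sum>M\<in>Pow P - A. (- 1) ^ card M * prod g M) + (\<Sum>M\<in>A. (- 1) ^ card M * prod g M)"
        by (rule sum.subset_diff) (use P in \<open>auto simp: A_def\<close>)
      also have "Pow P - A = small_prime_sets x"
      proof
        show "Pow P - A \<subseteq> small_prime_sets x"
          using P finite_subset[OF _ P(1)] by (auto simp: A_def small_prime_sets_def)
        show "small_prime_sets x \<subseteq> Pow P - A"
        proof
          fix M assume M: "M \<in> small_prime_sets x"
          have "primes_upto x \<subseteq> P" using y by (auto simp: P_def primes_upto_def)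
          then have "M \<subseteq> P" using small_prime_setsD(4)[OF M] by blast
          then show "M \<in> Pow P - A" using small_prime_setsD(3)[OF M] by (auto simp: A_def)
        qed
      qed
      finally have eq: "(\<Prod>p\<le>y. euler_factor (Suc k) m F p) = s + (\<Sum>M\<in>A. (- 1) ^ card M * prod g M)"
        unfolding s_def .
      have "\<bar>\<Sum>M\<in>A. (- 1) ^ card M * prod g M\<bar> \<le> (\<Sum>M\<in>A. \<bar>(- 1) ^ card M * prod g M\<bar>)" by (rule sum_abs)
      also have "\<dots> \<le> (\<Sum>M\<in>A. KB * (\<Prod>p\<in>M. real C / real p ^ 2))"
      proof (rule sum_mono)
        fix M assume "M \<in> A"
        then have M: "finite M" "\<And>p. p \<in> M \<Longrightarrow> prime p" using P finite_subset by (auto simp: A_def)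
        have "0 \<le> prod g M" using g_bounds(1) M by (intro prod_nonneg) auto
        moreover have "prod g M \<le> KB * (\<Prod>p\<in>M. real C / real p ^ 2)"
          by (rule prod_le_KB) (use g_bounds M in auto)
        ultimately show "\<bar>(- 1) ^ card M * prod g M\<bar> \<le> KB * (\<Prod>p\<in>M. real C / real p ^ 2)"
          by (simp add: abs_mult power_abs)
      qed
      also have "\<dots> = KB * (\<Sum>M\<in>A. \<Prod>p\<in>M. real C / real p ^ 2)" by (simp add: sum_distrib_left)
      also have "\<dots> \<le> KB * (K * ln x ^ C / x)" unfolding A_def
        using KB_ge_1 by (intro mult_left_mono K(2)[OF x P]) simp
      finally show ?thesis unfolding eq by simp
    qed
    have ev: "eventually (\<lambda>y. \<bar>s - (\<Prod>p\<le>y. euler_factor (Suc k) m F p)\<bar> \<le> KB * K * ln x ^ C / x) sequentially"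
      using eventually_ge_at_top[of "nat \<lceil>x\<rceil>"] by eventually_elim (rule near, linarith)
    have "(\<lambda>y. \<Prod>p\<le>y. euler_factor (Suc k) m F p) \<longlonglongrightarrow> C_F (Suc k) m F"
      unfolding C_F_def by (rule convergent_prod_LIMSEQ[OF convergent_euler_product])
    then have "(\<lambda>y. \<bar>s - (\<Prod>p\<le>y. euler_factor (Suc k) m F p)\<bar>) \<longlonglongrightarrow> \<bar>s - C_F (Suc k) m F\<bar>"
      by (intro tendsto_intros)
    then show "\<bar>s - C_F (Suc k) m F\<bar> \<le> KB * K * ln x ^ C / x"
      by (rule tendsto_upperbound[OF _ ev]) simp
  qed (use K KB_ge_1 in auto)
qed

lemma gcd_F_eq_1_iff: "gcd_F m F a = 1 \<longleftrightarrow> PP (\<lambda>j. int (a j)) = {}"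
proof
  assume 1: "gcd_F m F a = 1"
  show "PP (\<lambda>j. int (a j)) = {}"
  proof (rule ccontr)
    assume "PP (\<lambda>j. int (a j)) \<noteq> {}"
    then obtain p where p: "prime p" "Z p (\<lambda>j. int (a j))" by (auto simp: PP_def)
    then have "int p dvd gcd_F m F a"
      unfolding gcd_F_def by (intro Gcd_greatest) (auto simp: Z_def mev_int)
    then show False using 1 p(1) by simp
  qed
next
  assume e: "PP (\<lambda>j. int (a j)) = {}"
  show "gcd_F m F a = 1"
  proof (rule ccontr)
    assume "gcd_F m F a \<noteq> 1"
    moreover have "gcd_F m F a \<ge> 0" unfolding gcd_F_def by simp
    ultimately have "\<bar>gcd_F m F a\<bar> \<noteq> 1" by linarith
    \<comment> \<open>A gcd of 0 is included here: every prime divides it.\<close>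
    then obtain p where p: "prime p" "p dvd gcd_F m F a" using prime_factor_int by blast
    have "p dvd mev (F i) (\<lambda>j. int (a j))" if "i < m" for i
      by (rule dvd_trans[OF p(2)]) (use that in \<open>auto simp: gcd_F_def mev_int intro!: Gcd_dvd\<close>)
    moreover have "p = int (nat p)" using p(1) prime_ge_0_int by simp
    ultimately have "Z (nat p) (\<lambda>j. int (a j))" unfolding Z_def by metis
    moreover have "prime (nat p)" using p(1) by simp
    ultimately show False using e by (auto simp: PP_def)
  qed
qed

text \<open>Three errors of the same size add up: the truncation at each point, the lattice points
  near the boundary for each \<open>M\<close>, and the tail of the Euler product times
  \<open>x ^ Suc k\<close>.\<close>

lemma asymptotics:
  "\<exists>K. \<forall>x\<ge>3. \<bar>(\<Sum>a | a \<in> {..<Suc k} \<rightarrow>\<^sub>E {n::nat. 1 \<le> n \<and> real n \<le> x} \<and> gcd_F m F a = 1. 1)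
        - C_F (Suc k) m F * x ^ Suc k\<bar> \<le> K * (x ^ k * ln x ^ C)"
proof -
  obtain K1 where K1: "K1 > 0" "\<And>x X. x \<ge> 3 \<Longrightarrow> X = nat \<lfloor>x\<rfloor> \<Longrightarrow>
     (\<Sum>a\<in>Box X. \<bar>of_bool (PP a = {}) - truncated_moebius x (PP a)\<bar>) \<le> K1 * x ^ k * ln x ^ C"
    using sieve_error_le by blast
  obtain K2 where K2: "K2 > 0" "\<And>x. x \<ge> 3 \<Longrightarrow>
     \<bar>(\<Sum>M\<in>small_prime_sets x. (- 1) ^ card M * prod g M) - C_F (Suc k) m F\<bar> \<le> K2 * ln x ^ C / x"
    using euler_product_truncation by blast
  obtain K3 where K3: "K3 > 0" "\<And>x. x \<ge> 2 \<Longrightarrow> (\<Sum>M\<in>small_prime_sets x. \<Prod>p\<in>M. real C / real p) \<le> K3 * ln x ^ C"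
    using sum_small_prime_sets_le[of C] by blast
  define KA where "KA = KB * real (Suc k) * 2 ^ k"
  have KA: "KA \<ge> 0" using KB_ge_1 by (simp add: KA_def)
  show ?thesis
  proof (intro exI[of _ "K1 + KA * K3 + K2"] allI impI)
    fix x :: real assume x: "x \<ge> 3"
    define X where "X = nat \<lfloor>x\<rfloor>"
    let ?F = "small_prime_sets x"
    define A where "A M = real (card {a \<in> Box X. \<forall>p\<in>M. Z p a})" for M
    define S where "S = real (card {a \<in> Box X. PP a = {}})"
    have "{n::nat. 1 \<le> n \<and> real n \<le> x} = {1..X}" using x by (auto simp: X_def le_nat_floor) linarith
    then have "(\<Sum>a | a \<in> {..<Suc k} \<rightarrow>\<^sub>E {n::nat. 1 \<le> n \<and> real n \<le> x} \<and> gcd_F m F a = 1. 1 :: real) =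
        real (card {a \<in> {..<Suc k} \<rightarrow>\<^sub>E {1..X}. PP (\<lambda>j. int (a j)) = {}})"
      by (simp add: gcd_F_eq_1_iff)
    also have "card {a \<in> {..<Suc k} \<rightarrow>\<^sub>E {1..X}. PP (\<lambda>j. int (a j)) = {}} = card {a \<in> Box X. PP a = {}}"
      unfolding Box_def
    proof (rule card_nat_box)
      fix a b :: "nat \<Rightarrow> int" assume ab: "\<And>j. j < Suc k \<Longrightarrow> a j = b j"
      have "Z p a = Z p b" for p by (rule periodicD[OF periodic_Z]) (use ab in simp)
      then show "(PP a = {}) = (PP b = {})" by (simp add: PP_def)
    qed
    finally have S: "(\<Sum>a | a \<in> {..<Suc k} \<rightarrow>\<^sub>E {n::nat. 1 \<le> n \<and> real n \<le> x} \<and> gcd_F m F a = 1. 1 :: real) = S"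
      by (simp add: S_def)
    have S': "S = (\<Sum>a\<in>Box X. of_bool (PP a = {}))"
      unfolding S_def using finite_Box by (simp add: of_bool_def sum.inter_filter[symmetric])
    have T: "(\<Sum>a\<in>Box X. truncated_moebius x (PP a)) = (\<Sum>M\<in>?F. (- 1) ^ card M * A M)"
    proof -
      have "truncated_moebius x (PP a) = (\<Sum>M\<in>?F. if \<forall>p\<in>M. Z p a then (- 1) ^ card M else 0)" for a
      proof -
        have "{M\<in>?F. M \<subseteq> PP a} = {M\<in>?F. \<forall>p\<in>M. Z p a}" by (auto simp: PP_def small_prime_sets_def)
        then show ?thesis unfolding truncated_moebius_def by (simp add: sum.inter_filter)
      qed
      then have "(\<Sum>a\<in>Box X. truncated_moebius x (PP a)) = (\<Sum>M\<in>?F. \<Sum>a\<in>Box X. if \<forall>p\<in>M. Z p a then (- 1) ^ card M else 0)"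
        using sum.swap by simp
      also have "\<dots> = (\<Sum>M\<in>?F. (- 1) ^ card M * A M)"
        using finite_Box by (intro sum.cong refl) (simp add: A_def sum.inter_filter[symmetric])
      finally show ?thesis .
    qed
    have "\<bar>S - (\<Sum>M\<in>?F. (- 1) ^ card M * A M)\<bar> \<le> (\<Sum>a\<in>Box X. \<bar>of_bool (PP a = {}) - truncated_moebius x (PP a)\<bar>)"
      unfolding S' T[symmetric] sum_subtractf[symmetric] by (rule sum_abs)
    also have "\<dots> \<le> K1 * x ^ k * ln x ^ C" by (rule K1(2)[OF x X_def])
    finally have 1: "\<bar>S - (\<Sum>M\<in>?F. (- 1) ^ card M * A M)\<bar> \<le> K1 * x ^ k * ln x ^ C" .
    \<comment> \<open>The expected number of points of the box at which the primes of
      \<open>M\<close> divide all values.\<close>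
    have pg: "prod g M * x ^ Suc k = real (\<Prod>p\<in>M. \<nu> p) * (x / real (\<Prod>M)) ^ Suc k" for M
      by (simp add: g_def prod_dividef prod_power_distrib power_divide prod.distrib power_mult_distrib)
    have "(\<Sum>M\<in>?F. (- 1) ^ card M * A M) - (\<Sum>M\<in>?F. (- 1) ^ card M * prod g M) * x ^ Suc k =
        (\<Sum>M\<in>?F. (- 1) ^ card M * (A M - prod g M * x ^ Suc k))"
      by (simp add: sum_subtractf sum_distrib_right right_diff_distrib mult.assoc)
    then have "\<bar>(\<Sum>M\<in>?F. (- 1) ^ card M * A M) - (\<Sum>M\<in>?F. (- 1) ^ card M * prod g M) * x ^ Suc k\<bar> \<le>
        (\<Sum>M\<in>?F. \<bar>(- 1) ^ card M * (A M - prod g M * x ^ Suc k)\<bar>)" by (simp only: sum_abs)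
    also have "\<dots> \<le> (\<Sum>M\<in>?F. KA * x ^ k * (\<Prod>p\<in>M. real C / real p))"
    proof (rule sum_mono)
      fix M assume M: "M \<in> ?F"
      show "\<bar>(- 1) ^ card M * (A M - prod g M * x ^ Suc k)\<bar> \<le> KA * x ^ k * (\<Prod>p\<in>M. real C / real p)"
        using card_box_prime_set[OF x X_def M] unfolding abs_mult power_abs A_def pg KA_def by simp
    qed
    also have "\<dots> = KA * x ^ k * (\<Sum>M\<in>?F. \<Prod>p\<in>M. real C / real p)" by (simp add: sum_distrib_left)
    also have "\<dots> \<le> KA * x ^ k * (K3 * ln x ^ C)" using KA x by (intro mult_left_mono K3(2)) auto
    finally have 2: "\<bar>(\<Sum>M\<in>?F. (- 1) ^ card M * A M) - (\<Sum>M\<in>?F. (- 1) ^ card M * prod g M) * x ^ Suc k\<bar> \<le> KA * x ^ k * (K3 * ln x ^ C)" .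
    have "\<bar>(\<Sum>M\<in>?F. (- 1) ^ card M * prod g M) * x ^ Suc k - C_F (Suc k) m F * x ^ Suc k\<bar> =
        \<bar>(\<Sum>M\<in>?F. (- 1) ^ card M * prod g M) - C_F (Suc k) m F\<bar> * x ^ Suc k"
      using x by (simp only: left_diff_distrib[symmetric] abs_mult) simp
    also have "\<dots> \<le> (K2 * ln x ^ C / x) * x ^ Suc k" using x by (intro mult_right_mono K2(2)) auto
    also have "\<dots> = K2 * x ^ k * ln x ^ C" using x by simp
    finally have 3: "\<bar>(\<Sum>M\<in>?F. (- 1) ^ card M * prod g M) * x ^ Suc k - C_F (Suc k) m F * x ^ Suc k\<bar> \<le> K2 * x ^ k * ln x ^ C" .
    have "\<bar>S - C_F (Suc k) m F * x ^ Suc k\<bar> \<le> K1 * x ^ k * ln x ^ C + KA * x ^ k * (K3 * ln x ^ C) + K2 * x ^ k * ln x ^ C"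
      using 1 2 3 by linarith
    also have "\<dots> = (K1 + KA * K3 + K2) * (x ^ k * ln x ^ C)" by (simp add: algebra_simps)
    finally show "\<bar>(\<Sum>a | a \<in> {..<Suc k} \<rightarrow>\<^sub>E {n::nat. 1 \<le> n \<and> real n \<le> x} \<and> gcd_F m F a = 1. 1)
        - C_F (Suc k) m F * x ^ Suc k\<bar> \<le> (K1 + KA * K3 + K2) * (x ^ k * ln x ^ C)"
      unfolding S .
  qed
qed

end

theorem corollary2:
  fixes k m d :: nat and F :: "nat \<Rightarrow> int mpoly"
  assumes "k \<ge> 2" and "m \<ge> 2"
    and "\<And>i. i < m \<Longrightarrow> F i \<in> mpolys k"
    and "\<And>i. i < m \<Longrightarrow> \<not> mconst (F i)"
    and "property_P m F"
    and "relatively_prime_over_rat k m F"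
    and "d = Max ((\<lambda>i. total_deg (F i)) ` {..<m})"
  shows "convergent_prod (euler_factor k m F) \<and>
    (\<lambda>x::real. (\<Sum>a | a \<in> {..<k} \<rightarrow>\<^sub>E {n::nat. 1 \<le> n \<and> real n \<le> x} \<and> gcd_F m F a = 1. 1)
        - C_F k m F * x ^ k)
      \<in> O[at_top](\<lambda>x. x ^ (k - 1) * ln x ^ (d ^ m))"
proof -
  \<comment> \<open>The locale counts the variables without the distinguished last one.\<close>
  define k' where "k' = k - 1"
  have kS: "k = Suc k'" "k' \<ge> 1" using assms(1) by (auto simp: k'_def)
  have F: "F i \<in> mpolys (Suc k')" if "i < m" for i using assms(3)[OF that] kS by simp
  have deg: "total_deg (F i) \<le> d" if "i < m" for i
    unfolding assms(7) by (rule Max_ge) (use that in auto)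
  have nc: "\<not> mconst (F 0)" using assms(2,4) by simp
  have "d \<ge> 1"
  proof -
    obtain t where t: "t \<in> Poly_Mapping.keys (F 0)" "t \<noteq> 0" using nc by (auto simp: mconst_def)
    then obtain j where "j \<in> Poly_Mapping.keys t" by fastforce
    then have "Poly_Mapping.lookup t j \<le> monom_deg t" "Poly_Mapping.lookup t j > 0"
      unfolding monom_deg_def by (auto simp: in_keys_iff intro!: member_le_sum)
    moreover have "monom_deg t \<le> d"
      using monom_deg_le_total_deg[OF t(1)] deg[of 0] assms(2) by linarith
    ultimately show ?thesis by linarith
  qed
  moreover have "top_at (F 0) (\<lambda>_. 1) > 0"
    by (rule top_at_ones_pos) (use assms(2,5) nc in \<open>auto simp: property_P_def mconst_def\<close>)
  moreover obtain w :: "nat \<Rightarrow> int" and U V R where R: "R \<in> mpolys k'" "R \<noteq> 0"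
    "U * mev (F 0) (\<lambda>j. if j < k' then mvar j + mvar k' else mvar j) +
      V * mev (\<Sum>i<m. of_int (w i) * F i) (\<lambda>j. if j < k' then mvar j + mvar k' else mvar j) = R"
    using exists_eliminant[of k' m F, OF kS(2) _ F assms(5) nc] assms(2,6) kS(1) by auto
  moreover obtain c where "c 0 = 1" "top_at R c \<noteq> 0" using exists_top_at_nonzero[OF R(1,2)] by blast
  ultimately interpret gcd_system k' m d F w U V R c
    by unfold_locales (use kS assms(2) F deg in auto)
  obtain K where K: "\<And>x. x \<ge> 3 \<Longrightarrow>
    \<bar>(\<Sum>a | a \<in> {..<Suc k'} \<rightarrow>\<^sub>E {n::nat. 1 \<le> n \<and> real n \<le> x} \<and> gcd_F m F a = 1. 1)
        - C_F (Suc k') m F * x ^ Suc k'\<bar> \<le> K * (x ^ k' * ln x ^ C)"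
    using asymptotics by blast
  have "(\<lambda>x::real. (\<Sum>a | a \<in> {..<k} \<rightarrow>\<^sub>E {n::nat. 1 \<le> n \<and> real n \<le> x} \<and> gcd_F m F a = 1. 1)
        - C_F k m F * x ^ k) \<in> O[at_top](\<lambda>x. x ^ (k - 1) * ln x ^ (d ^ m))"
  proof (rule bigoI)
    show "eventually (\<lambda>x. norm ((\<Sum>a | a \<in> {..<k} \<rightarrow>\<^sub>E {n::nat. 1 \<le> n \<and> real n \<le> x} \<and> gcd_F m F a = 1. 1)
        - C_F k m F * x ^ k) \<le> K * norm (x ^ (k - 1) * ln x ^ (d ^ m))) at_top"
      using eventually_ge_at_top[of 3]
    proof eventually_elim
      fix x :: real assume x: "3 \<le> x"
      then have "norm (x ^ k' * ln x ^ C) = x ^ k' * ln x ^ C" by simp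
      then show "norm ((\<Sum>a | a \<in> {..<k} \<rightarrow>\<^sub>E {n::nat. 1 \<le> n \<and> real n \<le> x} \<and> gcd_F m F a = 1. 1)
        - C_F k m F * x ^ k) \<le> K * norm (x ^ (k - 1) * ln x ^ (d ^ m))"
        using K[OF x] unfolding kS(1) C_def by simp
    qed
  qed
  then show ?thesis using convergent_euler_product kS(1) by simp
qed

end
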